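(* There exist principal ideals $J \subset I$ of $B(H)$ for which $J_{a^2} = I_{a^2}$ but $J_a \ne I_a$.
   Context: $H$ is an infinite-dimensional separable complex Hilbert space and $B(H)$ is the algebra of bounded operators on it. $\text{c}_{\text{o}}^*$ is the set of nonnegative real sequences $\xi = (\xi_n)_{n\ge 1}$ that are nonincreasing and converge to $0$. For $m \in \mathbb N$, the ampliation $D_m\xi$ is the sequence in which each entry of $\xi$ is repeated $m$ times. A characteristic set is a positive cone $\Sigma \subset \text{c}_{\text{o}}^*$ (closed under sums and nonnegative scalar multiples) that is hereditary ($0\le\eta \le \xi\in\Sigma$, $\eta\in \text{c}_{\text{o}}^*$, implies $\eta \in \Sigma$) and invariant under all $D_m$. By Calkin's theorem, $I \mapsto \Sigma(I) := \{s(X) \mid X \in I\}$, with $s(X)$ the sequence of $s$-numbers (singular values) of $X$ in decreasing order with multiplicity, completed by zeros if $X$ has finite rank, is an order-preserving bijection from the (proper, two-sided) ideals of $B(H)$ onto the characteristic sets; "ideal" means such an ideal. For $\xi\in \text{c}_{\text{o}}^*$, $(\xi_a)_n := \frac1n\sum_{j=1}^n \xi_j$. The arithmetic mean ideal $I_a$ of an ideal $I$ is the ideal with $\Sigma(I_a) = \{\xi \in \text{c}_{\text{o}}^* \mid \xi = O(\eta_a) \text{ for some } \eta\in\Sigma(I)\}$, and $I_{a^2} := (I_a)_a$. A principal ideal is an ideal generated by a single operator, equivalently an ideal $(\xi)$ with $\xi \in \text{c}_{\text{o}}^*$ and $\Sigma((\xi)) = \{\eta\in\text{c}_{\text{o}}^*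 \mid \eta = O(D_m\xi)\text{ for some } m \in \mathbb N\}$. *)

theory Defs
  imports "HOL-Analysis.Analysis" "HOL-Algebra.Ideal" "HOL-Library.Landau_Symbols"
begin

section \<open>Complex Hilbert spaces\<close>

text \<open>
  A complex inner product space, built on the library's class \<^class>\<open>real_inner\<close> so that norm,
  metric and topology are the ones the library already has: the real inner product is the real part
  of the complex one, whence the norm of \<open>x\<close> is the square root of \<open>cinner x x\<close>. The complex inner
  product is linear in its first argument.
\<close>

class complex_inner = real_inner +
  fixes scaleC :: "complex \<Rightarrow> 'a \<Rightarrow> 'a"  (infixr "*\<^sub>C" 75)
    and cinner :: "'a \<Rightarrow> 'a \<Rightarrow> complex"
  assumes scaleC_add_right: "c *\<^sub>C (x + y) = c *\<^sub>C x + c *\<^sub>C y"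
    and scaleC_add_left: "(c + d) *\<^sub>C x = c *\<^sub>C x + d *\<^sub>C x"
    and scaleC_scaleC: "c *\<^sub>C (d *\<^sub>C x) = (c * d) *\<^sub>C x"
    and scaleR_scaleC: "scaleR r x = complex_of_real r *\<^sub>C x"
    and cinner_commute: "cinner x y = cnj (cinner y x)"
    and cinner_add_left: "cinner (x + y) z = cinner x z + cinner y z"
    and cinner_scaleC_left: "cinner (c *\<^sub>C x) y = c * cinner x y"
    and inner_eq_Re_cinner: "inner x y = Re (cinner x y)"

class complex_hilbert = complex_inner + complete_space

lemma scaleC_one: "1 *\<^sub>C x = (x :: 'a :: complex_inner)"
  using scaleR_scaleC[of 1 x] by simp

global_interpretation complex_vector:
  vector_space "scaleC :: complex \<Rightarrow> 'a \<Rightarrow> 'a :: complex_inner"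
  by unfold_locales
    (simp_all add: scaleC_add_right scaleC_add_left scaleC_scaleC scaleC_one)


section \<open>The algebra of bounded operators and its ideals\<close>

definition bounded_ops :: "('a :: complex_hilbert \<Rightarrow> 'a) set" where
  "bounded_ops = {T. bounded_linear T \<and> (\<forall>c x. T (c *\<^sub>C x) = c *\<^sub>C T x)}"

definition BH :: "('a :: complex_hilbert \<Rightarrow> 'a) ring" where
  "BH = \<lparr>carrier = bounded_ops, mult = (\<circ>), one = id,
         zero = (\<lambda>x. 0), add = (\<lambda>S T x. S x + T x)\<rparr>"

lemma ring_BH: "ring (BH :: ('a :: complex_hilbert \<Rightarrow> 'a) ring)"
proof (rule ringI)
  show "abelian_group (BH :: ('a \<Rightarrow> 'a) ring)"
  proof (rule abelian_groupI)
    fix T :: "'a \<Rightarrow> 'a" assume "T \<in> carrier BH"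
    then show "\<exists>S\<in>carrier BH. S \<oplus>\<^bsub>BH\<^esub> T = \<zero>\<^bsub>BH\<^esub>"
      by (intro bexI[of _ "\<lambda>x. - T x"])
        (auto simp: BH_def bounded_ops_def bounded_linear_minus)
  qed (auto simp: BH_def bounded_ops_def bounded_linear_add bounded_linear_zero
        scaleC_add_right add_ac)
  show "monoid (BH :: ('a \<Rightarrow> 'a) ring)"
    by (rule monoidI)
      (auto simp: BH_def bounded_ops_def id_def o_def intro: bounded_linear_compose bounded_linear_ident)
qed (auto simp: BH_def bounded_ops_def fun_eq_iff linear_add bounded_linear.linear)

text \<open>
  ``Ideal'' means proper two-sided ideal; \<^const>\<open>ideal\<close> of the library is two-sided.
\<close>

definition BH_ideal :: "('a :: complex_hilbert \<Rightarrow> 'a) set \<Rightarrow> bool" where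
  "BH_ideal I \<longleftrightarrow> ideal I BH \<and> I \<noteq> carrier BH"

definition BH_principal_ideal :: "('a :: complex_hilbert \<Rightarrow> 'a) set \<Rightarrow> bool" where
  "BH_principal_ideal I \<longleftrightarrow> principalideal I BH \<and> I \<noteq> carrier BH"


section \<open>Singular values and characteristic sets\<close>

text \<open>
  Sequences are indexed from 0, so \<open>\<xi> n\<close> is the entry with number \<open>n + 1\<close>.
\<close>

definition c0_star :: "(nat \<Rightarrow> real) set" where
  "c0_star = {\<xi>. (\<forall>n. 0 \<le> \<xi> n) \<and> decseq \<xi> \<and> \<xi> \<longlonglongrightarrow> 0}"

definition adj :: "('a :: complex_hilbert \<Rightarrow> 'a) \<Rightarrow> 'a \<Rightarrow> 'a" where
  "adj T = (THE S. S \<in> bounded_ops \<and> (\<forall>x y. cinner (T x) y = cinner x (S y)))"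

text \<open>
  The singular values of \<open>X\<close> are the square roots of the eigenvalues of \<open>X\<^sup>*X\<close>. A sequence in
  \<^const>\<open>c0_star\<close> is determined by how often it takes each positive value, and each \<open>t > 0\<close> has to
  occur as often as the dimension of the corresponding eigenspace; if only finitely many
  positive values occur, the remaining entries are then 0. For a compact operator \<open>X\<close>, and so for
  every element of a proper ideal when the space is separable, these eigenspaces are
  finite-dimensional and exactly one such sequence exists. For other \<open>X\<close> the value of
  \<open>singular_values X\<close> has no meaning.
\<close>

definition singular_values :: "('a :: complex_hilbert \<Rightarrow> 'a) \<Rightarrow> nat \<Rightarrow> real" where
  "singular_values X = (THE s. s \<in> c0_star \<and>
     (\<forall>t>0. card {n. s n = t} =
        complex_vector.dim {x. adj X (X x) = complex_of_real (t\<^sup>2) *\<^sub>C x}))"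

definition char_set :: "('a :: complex_hilbert \<Rightarrow> 'a) set \<Rightarrow> (nat \<Rightarrow> real) set" where
  "char_set I = singular_values ` I"


section \<open>Arithmetic mean ideals\<close>

definition arith_mean :: "(nat \<Rightarrow> real) \<Rightarrow> nat \<Rightarrow> real" where
  "arith_mean \<xi> n = (\<Sum>j\<le>n. \<xi> j) / real (Suc n)"

text \<open>
  The description operator is legitimate by Calkin's theorem: exactly one proper ideal has the
  given characteristic set.
\<close>

definition am_ideal :: "('a :: complex_hilbert \<Rightarrow> 'a) set \<Rightarrow> ('a \<Rightarrow> 'a) set" where
  "am_ideal I = (THE K. BH_ideal K \<and>
     char_set K = {\<xi> \<in> c0_star. \<exists>\<eta>\<in>char_set I. \<xi> \<in> O(arith_mean \<eta>)})"

end

theory Submission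
  imports Defs "HOL-Complex_Analysis.Great_Picard"
begin

text \<open>
  Write \<open>\<xi>\<^sub>a\<close> for the arithmetic mean of \<open>\<xi>\<close>. For \<open>\<xi> \<in> c0_star\<close> with \<open>\<xi> 0 > 0\<close>, the arithmetic mean ideal of
  the principal ideal \<open>(\<xi>)\<close> has the characteristic set of all sequences that are \<open>O(\<xi>\<^sub>a)\<close>, because
  \<open>D\<^sub>m \<xi>\<close> has a mean of at most \<open>m \<xi>\<^sub>a\<close>. Iterating, the second order ideal belongs to \<open>O(\<xi>\<^sub>a\<^sub>a)\<close>. So the
  theorem follows once there are sequences \<open>\<xi> \<le> \<eta>\<close> with \<open>\<eta>\<^sub>a\<^sub>a = O(\<xi>\<^sub>a\<^sub>a)\<close> and \<open>\<eta>\<^sub>a \<noteq> O(\<xi>\<^sub>a)\<close>, and once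
  enough of the theory of ideals is available to pass between ideals and sequences.

  The sequences. A block of mass \<open>w\<close> and length \<open>N\<close> takes the value \<open>w / N\<close> at \<open>N\<close> places. Its
  partial sums reach \<open>w\<close> at time \<open>N\<close>, and the sums of its first means then go on growing like
  \<open>w log n\<close>. Let \<open>\<xi>\<close> be a superposition of blocks of rapidly increasing masses \<open>w\<^sub>k\<close> and lengths \<open>N\<^sub>k\<close>,
  and \<open>\<zeta>\<close> the same with the shorter lengths \<open>N\<^sub>k / 4^k\<close>. At the time \<open>N\<^sub>k / 4^k\<close> the partial sum of \<open>\<zeta>\<close> has
  gained \<open>w\<^sub>k\<close> already while that of \<open>\<xi>\<close> is still small compared to \<open>w\<^sub>k\<close>: the first means are not comparable.
  For the second means, the advantage of \<open>\<zeta>\<close> from the block \<open>k\<close> is only about \<open>w\<^sub>k log 4^k\<close>, and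
  this is less than what the block \<open>k - 1\<close> has contributed in the very long time
  since \<open>N\<^sub>k\<^sub>-\<^sub>1\<close> (lemmas \<open>second_mean_block_compare\<close> and \<open>second_mean_early_le\<close>). Then
  \<open>\<eta> = \<xi> + \<zeta>\<close> has the required properties (\<open>sequences_exist\<close>).

  The operators. Calkin's correspondence is needed in two forms. First, a proper ideal is determined by its
  characteristic set (\<open>ideal_subset_if_char_set_subset\<close>): its elements are compact, since a noncompact
  operator is bounded below on an infinite-dimensional subspace and hence divides the identity
  (\<open>noncompact_factor_identity\<close>); and a compact operator has a singular value decomposition
  (\<open>svd_exists\<close>), so that two operators with equal singular values divide each other (\<open>svd_factor\<close>).
  Second, the sequences dominated by dilations of a given one form the characteristic set of
  an ideal (\<open>char_set_gelfand_ideal\<close>). Here singular values are read off as Gelfand numbers, that is, as bounds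
  of the operator on subspaces of finite codimension, for which the ideal axioms are
  immediate. The decomposition itself is obtained by maximising \<open>norm (X x)\<close> over the unit vectors
  orthogonal to those already chosen; a maximiser exists by compactness and the parallelogram law
  (\<open>compact_op_norm_attained\<close>), and adjoints of compact operators come out of the decomposition.
\<close>

section \<open>Complex inner products\<close>

instance complex_hilbert \<subseteq> banach ..

lemma cinner_zero_left [simp]: "cinner 0 y = 0"
  using cinner_add_left[of 0 0 y] by simp

lemma cinner_zero_right [simp]: "cinner x 0 = 0"
  by (metis cinner_commute cinner_zero_left complex_cnj_zero)

lemma cinner_add_right: "cinner x (y + z) = cinner x y + cinner x z"
  by (metis cinner_add_left cinner_commute complex_cnj_add)

lemma cinner_scaleC_right: "cinner x (c *\<^sub>C y) = cnj c * cinner x y"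
  by (metis cinner_scaleC_left cinner_commute complex_cnj_mult)

lemma cinner_minus_left: "cinner (- x) y = - cinner x y"
  using cinner_add_left[of x "- x" y] by (simp add: add_eq_0_iff)

lemma cinner_minus_right: "cinner x (- y) = - cinner x y"
  using cinner_add_right[of x y "- y"] by (simp add: add_eq_0_iff)

lemma cinner_diff_left: "cinner (x - y) z = cinner x z - cinner y z"
  using cinner_add_left[of x "- y" z] by (simp add: cinner_minus_left)

lemma cinner_diff_right: "cinner x (y - z) = cinner x y - cinner x z"
  using cinner_add_right[of x y "- z"] by (simp add: cinner_minus_right)

lemma cinner_sum_left: "cinner (\<Sum>i\<in>A. f i) y = (\<Sum>i\<in>A. cinner (f i) y)"
  by (induction A rule: infinite_finite_induct) (auto simp: cinner_add_left)

lemma cinner_sum_right: "cinner x (\<Sum>i\<in>A. f i) = (\<Sum>i\<in>A. cinner x (f i))"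
  by (induction A rule: infinite_finite_induct) (auto simp: cinner_add_right)

lemma scaleC_minus_right: "c *\<^sub>C (- x) = - (c *\<^sub>C x)"
  by (rule complex_vector.scale_minus_right)

lemma scaleC_diff_right: "c *\<^sub>C (x - y) = c *\<^sub>C x - c *\<^sub>C y"
  by (rule complex_vector.scale_right_diff_distrib)

lemma cinner_self: "cinner x x = complex_of_real ((norm x)\<^sup>2)"
proof -
  have "Im (cinner x x) = 0"
    using cinner_commute[of x x] by (metis Im_complex_of_real Reals_cnj_iff complex_is_Real_iff)
  then show ?thesis
    by (simp add: complex_eq_iff power2_norm_eq_inner inner_eq_Re_cinner)
qed

lemma norm_scaleC: "norm (c *\<^sub>C x) = norm c * norm (x :: 'a :: complex_inner)"
proof -
  have "complex_of_real ((norm (c *\<^sub>C x))\<^sup>2) = c * cnj c * cinner x x"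
    by (simp only: cinner_self[symmetric] cinner_scaleC_left cinner_scaleC_right mult_ac)
  also have "\<dots> = complex_of_real ((norm c * norm x)\<^sup>2)"
    by (simp only: cinner_self complex_norm_square[symmetric] power_mult_distrib of_real_mult)
  finally have "complex_of_real ((norm (c *\<^sub>C x))\<^sup>2) = complex_of_real ((norm c * norm x)\<^sup>2)" .
  then have "(norm (c *\<^sub>C x))\<^sup>2 = (norm c * norm x)\<^sup>2"
    by (simp only: of_real_eq_iff)
  then show ?thesis
    by (simp add: power2_eq_iff_nonneg)
qed

lemma norm_cinner_le: "norm (cinner x y) \<le> norm x * norm y"
proof (cases "cinner x y = 0")
  case False
  \<comment> \<open>a phase that makes the complex inner product real, so that the real Cauchy-Schwarz inequality applies\<close>
  define u where "u = cnj (cinner x y) / norm (cinner x y)"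
  have u: "norm u = 1" using False by (simp add: u_def norm_divide)
  have "cinner (u *\<^sub>C x) y = norm (cinner x y)"
    using False complex_norm_square[of "cinner x y"]
    by (simp add: u_def cinner_scaleC_left power2_eq_square field_simps)
  then have "norm (cinner x y) = inner (u *\<^sub>C x) y"
    by (simp add: inner_eq_Re_cinner)
  also have "\<dots> \<le> norm (u *\<^sub>C x) * norm y" by (rule norm_cauchy_schwarz)
  finally show ?thesis by (simp add: norm_scaleC u)
qed simp

definition clinear_functional :: "('a :: complex_inner \<Rightarrow> complex) \<Rightarrow> bool" where
  "clinear_functional \<phi> \<longleftrightarrow> bounded_linear \<phi> \<and> (\<forall>c x. \<phi> (c *\<^sub>C x) = c * \<phi> x)"

lemma scaleR_of_real: "complex_of_real r * z = r *\<^sub>R z"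
  by (simp add: scaleR_conv_of_real)

lemma clinear_functional_cinner: "clinear_functional (\<lambda>x. cinner x y)"
proof -
  have "bounded_linear (\<lambda>x. cinner x y)"
    by (rule bounded_linear_intro[of _ "norm y"])
      (auto simp: cinner_add_left scaleR_scaleC cinner_scaleC_left scaleR_of_real norm_cinner_le)
  then show ?thesis by (simp add: clinear_functional_def cinner_scaleC_left)
qed

lemma bounded_linear_cinner_left: "bounded_linear (\<lambda>x. cinner x y)"
  using clinear_functional_cinner clinear_functional_def by blast

lemma bounded_linear_cinner_right: "bounded_linear (\<lambda>y. cinner x y)"
  by (rule bounded_linear_intro[of _ "norm x"])
    (use norm_cinner_le[of x] in \<open>auto simp: cinner_add_right scaleR_scaleC cinner_scaleC_right
      scaleR_of_real mult.commute[of "norm _" "norm x"]\<close>)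

lemma bounded_linear_scaleC: "bounded_linear (\<lambda>x. c *\<^sub>C x)"
  by (rule bounded_linear_intro[of _ "norm c"])
    (auto simp: scaleC_add_right scaleR_scaleC scaleC_scaleC norm_scaleC mult.commute)

lemma bounded_opsD:
  assumes "T \<in> bounded_ops"
  shows "bounded_linear T" "linear T" "T (c *\<^sub>C x) = c *\<^sub>C T x" "T (x + y) = T x + T y"
    "T (x - y) = T x - T y" "T 0 = 0" "T (- x) = - T x"
  using assms by (auto simp: bounded_ops_def linear_simps bounded_linear.linear)

lemma bounded_ops_sum: "T \<in> bounded_ops \<Longrightarrow> T (\<Sum>i\<in>A. f i) = (\<Sum>i\<in>A. T (f i))"
  by (simp add: bounded_opsD linear_sum)

lemma bounded_ops_comp: "S \<in> bounded_ops \<Longrightarrow> T \<in> bounded_ops \<Longrightarrow> S \<circ> T \<in> bounded_ops"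
  by (auto simp: bounded_ops_def o_def intro: bounded_linear_compose)

lemma bounded_ops_norm_le:
  assumes "T \<in> bounded_ops"
  obtains C where "C > 0" "\<And>x. norm (T x) \<le> C * norm x"
  using bounded_linear.pos_bounded[OF bounded_opsD(1)[OF assms]] by (metis mult.commute)

lemma clinear_functional_comp:
  "clinear_functional \<phi> \<Longrightarrow> T \<in> bounded_ops \<Longrightarrow> clinear_functional (\<lambda>x. \<phi> (T x))"
  by (auto simp: clinear_functional_def bounded_ops_def intro: bounded_linear_compose)

section \<open>Orthogonal sequences and diagonal operators\<close>

text \<open>
  Vectors of norm less than 1, in particular 0, are admitted so that the images of the vectors in a
  singular value decomposition, divided by the singular values, form such a sequence even if singular values vanish.
\<close>

definition orthogonal_seq :: "(nat \<Rightarrow> 'a :: complex_inner) \<Rightarrow> bool" where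
  "orthogonal_seq e \<longleftrightarrow> (\<forall>i j. i \<noteq> j \<longrightarrow> cinner (e i) (e j) = 0) \<and> (\<forall>i. norm (e i) \<le> 1)"

definition orthonormal_seq :: "(nat \<Rightarrow> 'a :: complex_inner) \<Rightarrow> bool" where
  "orthonormal_seq e \<longleftrightarrow> (\<forall>i j. cinner (e i) (e j) = (if i = j then 1 else 0))"

lemma orthonormal_seq_norm: "orthonormal_seq e \<Longrightarrow> norm (e i) = 1"
  using cinner_self[of "e i"] by (simp add: orthonormal_seq_def)
    (metis of_real_eq_1_iff of_real_power norm_ge_zero power2_eq_1_iff  neg_0_le_iff_le not_one_le_zero)

lemma orthonormal_imp_orthogonal: "orthonormal_seq e \<Longrightarrow> orthogonal_seq e"
  by (simp add: orthogonal_seq_def orthonormal_seq_norm) (simp add: orthonormal_seq_def)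

lemma norm_sum_orthogonal:
  fixes v :: "nat \<Rightarrow> 'a :: complex_inner"
  assumes "\<And>i j. i \<in> A \<Longrightarrow> j \<in> A \<Longrightarrow> i \<noteq> j \<Longrightarrow> cinner (v i) (v j) = 0"
  shows "(norm (\<Sum>i\<in>A. v i))\<^sup>2 = (\<Sum>i\<in>A. (norm (v i))\<^sup>2)"
proof (cases "finite A")
  case True
  have "cinner (\<Sum>i\<in>A. v i) (\<Sum>i\<in>A. v i) = (\<Sum>i\<in>A. \<Sum>j\<in>A. cinner (v i) (v j))"
    by (simp add: cinner_sum_left cinner_sum_right) (rule sum.swap)
  also have "\<dots> = (\<Sum>i\<in>A. \<Sum>j\<in>A. if i = j then cinner (v i) (v i) else 0)"
    using assms by (intro sum.cong) auto
  also have "\<dots> = (\<Sum>i\<in>A. cinner (v i) (v i))"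
    using True by (simp add: sum.delta')
  finally have "complex_of_real ((norm (\<Sum>i\<in>A. v i))\<^sup>2) = complex_of_real (\<Sum>i\<in>A. (norm (v i))\<^sup>2)"
    by (simp add: cinner_self)
  then show ?thesis by (simp only: of_real_eq_iff)
qed simp

lemma norm_sum_scaleC_le:
  assumes "orthogonal_seq f"
  shows "(norm (\<Sum>i\<in>A. c i *\<^sub>C f i))\<^sup>2 \<le> (\<Sum>i\<in>A. (norm (c i))\<^sup>2)"
proof -
  have "(norm (\<Sum>i\<in>A. c i *\<^sub>C f i))\<^sup>2 = (\<Sum>i\<in>A. (norm (c i *\<^sub>C f i))\<^sup>2)"
    using assms by (intro norm_sum_orthogonal)
      (auto simp: cinner_scaleC_left cinner_scaleC_right orthogonal_seq_def)
  also have "\<dots> \<le> (\<Sum>i\<in>A. (norm (c i))\<^sup>2)"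
  proof (rule sum_mono)
    fix i
    have "norm (f i) \<le> 1" using assms by (simp add: orthogonal_seq_def)
    then have "norm (c i *\<^sub>C f i) \<le> norm (c i)"
      by (simp add: norm_scaleC mult_left_le)
    then show "(norm (c i *\<^sub>C f i))\<^sup>2 \<le> (norm (c i))\<^sup>2" by (simp add: power_mono)
  qed
  finally show ?thesis .
qed

lemma bessel_sum:
  assumes "orthogonal_seq e" "finite A"
  shows "(\<Sum>i\<in>A. (norm (cinner x (e i)))\<^sup>2) \<le> (norm x)\<^sup>2"
proof -
  define y where "y = (\<Sum>i\<in>A. cinner x (e i) *\<^sub>C e i)"
  define S where "S = (\<Sum>i\<in>A. (norm (cinner x (e i)))\<^sup>2)"
  have "cinner x y = complex_of_real S"
    by (simp add: y_def S_def cinner_sum_right cinner_scaleC_right flip: complex_norm_square)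
       (simp add: mult.commute flip: complex_norm_square)
  then have "S = inner x y" by (simp add: inner_eq_Re_cinner)
  moreover have "(norm y)\<^sup>2 \<le> S"
    unfolding y_def S_def by (rule norm_sum_scaleC_le[OF assms(1)])
  moreover have "0 \<le> (norm (x - y))\<^sup>2" by simp
  moreover have "(norm (x - y))\<^sup>2 = (norm x)\<^sup>2 - 2 * inner x y + (norm y)\<^sup>2"
    by (simp add: power2_norm_eq_inner inner_diff_left inner_diff_right inner_commute)
  ultimately show ?thesis unfolding S_def[symmetric] by linarith
qed

lemma bessel:
  assumes "orthogonal_seq e"
  shows "summable (\<lambda>i. (norm (cinner x (e i)))\<^sup>2)"
    and "(\<Sum>i. (norm (cinner x (e i)))\<^sup>2) \<le> (norm x)\<^sup>2"
proof -
  have *: "(\<Sum>i<n. (norm (cinner x (e i)))\<^sup>2) \<le> (norm x)\<^sup>2" for n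
    using bessel_sum[OF assms] by simp
  show "summable (\<lambda>i. (norm (cinner x (e i)))\<^sup>2)"
    by (rule bounded_imp_summable[where B="(norm x)\<^sup>2"])
       (use *[of "Suc _"] in \<open>simp_all only: lessThan_Suc_atMost zero_le_power2\<close>)
  then show "(\<Sum>i. (norm (cinner x (e i)))\<^sup>2) \<le> (norm x)\<^sup>2"
    using * by (intro suminf_le_const)
qed

lemma riesz_fischer:
  fixes f :: "nat \<Rightarrow> 'a :: complex_hilbert"
  assumes f: "orthogonal_seq f" and c: "summable (\<lambda>i. (norm (c i))\<^sup>2)"
  shows "summable (\<lambda>i. c i *\<^sub>C f i)"
    and "(norm (\<Sum>i. c i *\<^sub>C f i))\<^sup>2 \<le> (\<Sum>i. (norm (c i))\<^sup>2)"
proof -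
  show s: "summable (\<lambda>i. c i *\<^sub>C f i)"
    unfolding summable_Cauchy
  proof (intro allI impI)
    fix \<epsilon> :: real assume "\<epsilon> > 0"
    then obtain N where N: "\<And>m n. m \<ge> N \<Longrightarrow> norm (\<Sum>i=m..<n. (norm (c i))\<^sup>2) < \<epsilon>\<^sup>2"
      using c unfolding summable_Cauchy by (meson zero_less_power)
    have "norm (\<Sum>i=m..<n. c i *\<^sub>C f i) < \<epsilon>" if "m \<ge> N" for m n
    proof -
      have "(norm (\<Sum>i=m..<n. c i *\<^sub>C f i))\<^sup>2 < \<epsilon>\<^sup>2"
        using N[OF that, of n] norm_sum_scaleC_le[OF f, of c "{m..<n}"] by simp
      then show ?thesis using \<open>\<epsilon> > 0\<close> by (simp add: power2_less_imp_less)
    qed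
    then show "\<exists>N. \<forall>m\<ge>N. \<forall>n. norm (\<Sum>i=m..<n. c i *\<^sub>C f i) < \<epsilon>" by blast
  qed
  have "(\<lambda>n. (norm (\<Sum>i<n. c i *\<^sub>C f i))\<^sup>2) \<longlonglongrightarrow> (norm (\<Sum>i. c i *\<^sub>C f i))\<^sup>2"
    by (intro tendsto_intros summable_LIMSEQ s)
  then show "(norm (\<Sum>i. c i *\<^sub>C f i))\<^sup>2 \<le> (\<Sum>i. (norm (c i))\<^sup>2)"
  proof (rule LIMSEQ_le_const2, intro exI allI impI)
    fix n
    have "(norm (\<Sum>i<n. c i *\<^sub>C f i))\<^sup>2 \<le> (\<Sum>i<n. (norm (c i))\<^sup>2)"
      by (rule norm_sum_scaleC_le[OF f])
    also have "\<dots> \<le> (\<Sum>i. (norm (c i))\<^sup>2)" by (rule sum_le_suminf[OF c]) auto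
    finally show "(norm (\<Sum>i<n. c i *\<^sub>C f i))\<^sup>2 \<le> (\<Sum>i. (norm (c i))\<^sup>2)" .
  qed
qed

text \<open>
  Schmidt's form \<open>\<Sum> s\<^sub>i \<langle>\<cdot>, e\<^sub>i\<rangle> f\<^sub>i\<close> of an operator. With suitable \<open>s\<close>, \<open>e\<close>, \<open>f\<close> this covers diagonal operators, the
  partial isometries that map \<open>e\<^sub>i\<close> to \<open>f\<^sub>i\<close>, all compact operators and their adjoints.
\<close>

definition diag_op :: "(nat \<Rightarrow> real) \<Rightarrow> (nat \<Rightarrow> 'a) \<Rightarrow> (nat \<Rightarrow> 'a) \<Rightarrow> 'a :: complex_hilbert \<Rightarrow> 'a" where
  "diag_op s e f x = (\<Sum>i. (complex_of_real (s i) * cinner x (e i)) *\<^sub>C f i)"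

context
  fixes s :: "nat \<Rightarrow> real" and e f :: "nat \<Rightarrow> 'a :: complex_hilbert" and B :: real
  assumes e: "orthogonal_seq e" and f: "orthogonal_seq f" and B: "\<And>i. \<bar>s i\<bar> \<le> B"
begin

lemma diag_op_weights_le: "(norm (complex_of_real (s i) * cinner x (e i)))\<^sup>2 \<le> B\<^sup>2 * (norm (cinner x (e i)))\<^sup>2"
proof -
  have "\<bar>s i\<bar>\<^sup>2 \<le> B\<^sup>2" by (intro power_mono B) auto
  then show ?thesis by (simp add: norm_mult power_mult_distrib mult_right_mono)
qed

lemma diag_op_weights_summable: "summable (\<lambda>i. (norm (complex_of_real (s i) * cinner x (e i)))\<^sup>2)"
  by (rule summable_comparison_test'[OF summable_mult[OF bessel(1)[OF e]]])
    (use diag_op_weights_le in auto)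

lemma diag_op_summable: "summable (\<lambda>i. (complex_of_real (s i) * cinner x (e i)) *\<^sub>C f i)"
  by (rule riesz_fischer(1)[OF f diag_op_weights_summable])

lemma diag_op_norm_le: "norm (diag_op s e f x) \<le> B * norm x"
proof -
  have "0 \<le> B" using B[of 0] by linarith
  have "(norm (diag_op s e f x))\<^sup>2 \<le> (\<Sum>i. (norm (complex_of_real (s i) * cinner x (e i)))\<^sup>2)"
    unfolding diag_op_def by (rule riesz_fischer(2)[OF f diag_op_weights_summable])
  also have "\<dots> \<le> (\<Sum>i. B\<^sup>2 * (norm (cinner x (e i)))\<^sup>2)"
    by (rule suminf_le[OF diag_op_weights_le diag_op_weights_summable summable_mult[OF bessel(1)[OF e]]])
  also have "\<dots> = B\<^sup>2 * (\<Sum>i. (norm (cinner x (e i)))\<^sup>2)"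
    by (rule suminf_mult[OF bessel(1)[OF e]])
  also have "\<dots> \<le> B\<^sup>2 * (norm x)\<^sup>2" by (intro mult_left_mono bessel(2)[OF e]) auto
  finally have "(norm (diag_op s e f x))\<^sup>2 \<le> (B * norm x)\<^sup>2" by (simp add: power_mult_distrib)
  then show ?thesis by (rule power2_le_imp_le) (simp add: \<open>0 \<le> B\<close>)
qed

lemma diag_op_bounded_ops: "diag_op s e f \<in> bounded_ops"
proof -
  have add: "diag_op s e f (x + y) = diag_op s e f x + diag_op s e f y" for x y
    unfolding diag_op_def suminf_add[OF diag_op_summable diag_op_summable]
    by (simp add: cinner_add_left algebra_simps scaleC_add_left)
  have scale: "diag_op s e f (c *\<^sub>C x) = c *\<^sub>C diag_op s e f x" for c x
    unfolding diag_op_def bounded_linear.suminf[OF bounded_linear_scaleC diag_op_summable]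
    by (simp add: cinner_scaleC_left scaleC_scaleC mult_ac)
  have "bounded_linear (diag_op s e f)"
    by (rule bounded_linear_intro[of _ B])
      (simp_all add: add scale scaleR_scaleC diag_op_norm_le mult.commute[of _ B])
  then show ?thesis by (simp add: bounded_ops_def scale)
qed

lemma cinner_diag_op: "cinner (diag_op s e f x) y = (\<Sum>i. complex_of_real (s i) * cinner x (e i) * cinner (f i) y)"
  unfolding diag_op_def bounded_linear.suminf[OF bounded_linear_cinner_left diag_op_summable]
  by (simp add: cinner_scaleC_left)

lemma cinner_diag_op_basis: "cinner (diag_op s e f x) (f k) = complex_of_real (s k * (norm (f k))\<^sup>2) * cinner x (e k)"
proof -
  have "cinner (diag_op s e f x) (f k) = (\<Sum>i\<in>{k}. complex_of_real (s i) * cinner x (e i) * cinner (f i) (f k))"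
    unfolding cinner_diag_op
    using f by (intro suminf_finite) (auto simp: orthogonal_seq_def)
  then show ?thesis by (simp add: cinner_self)
qed

lemma diag_op_basis: "orthonormal_seq e \<Longrightarrow> diag_op s e f (e k) = complex_of_real (s k) *\<^sub>C f k"
proof -
  assume o: "orthonormal_seq e"
  have "diag_op s e f (e k) = (\<Sum>i\<in>{k}. (complex_of_real (s i) * cinner (e k) (e i)) *\<^sub>C f i)"
    unfolding diag_op_def using o by (intro suminf_finite) (auto simp: orthonormal_seq_def)
  then show ?thesis using o by (simp add: orthonormal_seq_def)
qed

end

lemma cinner_diag_op_adjoint:
  fixes e f :: "nat \<Rightarrow> 'a :: complex_hilbert"
  assumes e: "orthogonal_seq e" and f: "orthogonal_seq f" and B: "\<And>i. \<bar>s i\<bar> \<le> B"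
  shows "cinner (diag_op s e f x) y = cinner x (diag_op s f e y)"
proof -
  have "cinner x (diag_op s f e y) = (\<Sum>i. cinner x ((complex_of_real (s i) * cinner y (f i)) *\<^sub>C e i))"
    unfolding diag_op_def
    by (rule bounded_linear.suminf[OF bounded_linear_cinner_right diag_op_summable[OF f e B]])
  also have "\<dots> = (\<Sum>i. complex_of_real (s i) * cinner x (e i) * cinner (f i) y)"
  proof -
    have "cinner x ((complex_of_real (s i) * cinner y (f i)) *\<^sub>C e i)
        = complex_of_real (s i) * cinner x (e i) * cinner (f i) y" for i
      using cinner_commute[of "f i" y] by (simp add: cinner_scaleC_right)
    then show ?thesis by simp
  qed
  finally show ?thesis by (simp add: cinner_diag_op[OF e f B])
qed

lemma diag_op_comp:
  fixes e f g :: "nat \<Rightarrow> 'a :: complex_hilbert"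
  assumes "orthogonal_seq g" "orthogonal_seq e" "orthogonal_seq f" "\<And>i. \<bar>s i\<bar> \<le> B" "\<And>i. \<bar>t i\<bar> \<le> C"
  shows "diag_op s e f (diag_op t g e x) = diag_op (\<lambda>i. s i * t i * (norm (e i))\<^sup>2) g f x"
proof -
  have "complex_of_real (s i) * cinner (diag_op t g e x) (e i)
      = complex_of_real (s i * t i * (norm (e i))\<^sup>2) * cinner x (g i)" for i
    by (subst cinner_diag_op_basis[OF assms(1,2,5)]) simp
  then show ?thesis
    by (simp only: diag_op_def[of s] diag_op_def[of "\<lambda>i. s i * t i * (norm (e i))\<^sup>2"])
qed

lemma adj_eqI:
  fixes T :: "'a :: complex_hilbert \<Rightarrow> 'a"
  assumes "S \<in> bounded_ops" "\<And>x y. cinner (T x) y = cinner x (S y)"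
  shows "adj T = S"
  unfolding adj_def
proof (rule the_equality)
  fix R assume R: "R \<in> bounded_ops \<and> (\<forall>x y. cinner (T x) y = cinner x (R y))"
  show "R = S"
  proof
    fix y
    have "cinner (R y - S y) (R y - S y) = 0"
      using R assms(2) by (metis cinner_diff_right right_minus_eq)
    then show "R y = S y" by (simp add: cinner_self)
  qed
qed (use assms in auto)

section \<open>Gelfand numbers and compactness\<close>

text \<open>
  The Gelfand number of \<open>X\<close> with index \<open>n\<close> (counted from 0) is at most \<open>\<epsilon>\<close>. Cutting down by functionals
  instead of vectors makes composition with operators on the right a substitution, with no adjoint involved.
\<close>

definition gelfand_le :: "('a :: complex_hilbert \<Rightarrow> 'a) \<Rightarrow> nat \<Rightarrow> real \<Rightarrow> bool" where
  "gelfand_le X n \<epsilon> \<longleftrightarrow> (\<exists>\<phi>. (\<forall>i<n. clinear_functional (\<phi> i)) \<and>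
     (\<forall>x. (\<forall>i<n. \<phi> i x = 0) \<longrightarrow> norm (X x) \<le> \<epsilon> * norm x))"

text \<open>
  For bounded operators this is equivalent to the relative compactness of the image of the unit ball; the
  implication from this form is lemma \<open>compact_op_convergent_subsequence\<close>.
\<close>

definition compact_op :: "('a :: complex_hilbert \<Rightarrow> 'a) \<Rightarrow> bool" where
  "compact_op X \<longleftrightarrow> (\<forall>\<epsilon>>0. \<exists>n. gelfand_le X n \<epsilon>)"

lemma gelfand_le_mono:
  assumes "gelfand_le X m \<delta>" "m \<le> n" "\<delta> \<le> \<epsilon>"
  shows "gelfand_le X n \<epsilon>"
proof -
  obtain \<phi> where \<phi>: "\<And>i. i < m \<Longrightarrow> clinear_functional (\<phi> i)"
    "\<And>x. (\<And>i. i < m \<Longrightarrow> \<phi> i x = 0) \<Longrightarrow> norm (X x) \<le> \<delta> * norm x"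
    using assms(1) unfolding gelfand_le_def by metis
  show ?thesis unfolding gelfand_le_def
  proof (intro exI[of _ "\<lambda>i. if i < m then \<phi> i else (\<lambda>x. 0)"] conjI allI impI)
    fix x assume x: "\<forall>i<n. (if i < m then \<phi> i else (\<lambda>x. 0)) x = 0"
    have "norm (X x) \<le> \<delta> * norm x"
    proof (rule \<phi>(2))
      fix i assume "i < m"
      then show "\<phi> i x = 0" using x[rule_format, of i] \<open>m \<le> n\<close> by simp
    qed
    also have "\<dots> \<le> \<epsilon> * norm x" using assms(3) by (simp add: mult_right_mono)
    finally show "norm (X x) \<le> \<epsilon> * norm x" .
  qed (use \<phi>(1) in \<open>auto simp: clinear_functional_def bounded_linear_zero\<close>)
qed

lemma gelfand_le_add:
  assumes "gelfand_le X m \<delta>" "gelfand_le Y n \<epsilon>"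
  shows "gelfand_le (\<lambda>x. X x + Y x) (m + n) (\<delta> + \<epsilon>)"
proof -
  obtain \<phi> \<psi> where \<phi>: "\<And>i. i < m \<Longrightarrow> clinear_functional (\<phi> i)"
      "\<And>x. (\<And>i. i < m \<Longrightarrow> \<phi> i x = 0) \<Longrightarrow> norm (X x) \<le> \<delta> * norm x"
    and \<psi>: "\<And>i. i < n \<Longrightarrow> clinear_functional (\<psi> i)"
      "\<And>x. (\<And>i. i < n \<Longrightarrow> \<psi> i x = 0) \<Longrightarrow> norm (Y x) \<le> \<epsilon> * norm x"
    using assms unfolding gelfand_le_def by metis
  show ?thesis unfolding gelfand_le_def
  proof (intro exI[of _ "\<lambda>i. if i < m then \<phi> i else \<psi> (i - m)"] conjI allI impI)
    fix x assume x: "\<forall>i<m+n. (if i < m then \<phi> i else \<psi> (i - m)) x = 0"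
    have "norm (X x) \<le> \<delta> * norm x"
    proof (rule \<phi>(2))
      fix i assume "i < m"
      then show "\<phi> i x = 0" using x[rule_format, of i] by simp
    qed
    moreover have "norm (Y x) \<le> \<epsilon> * norm x"
    proof (rule \<psi>(2))
      fix i assume "i < n"
      then show "\<psi> i x = 0" using x[rule_format, of "m + i"] by simp
    qed
    ultimately show "norm (X x + Y x) \<le> (\<delta> + \<epsilon>) * norm x"
      using norm_triangle_ineq[of "X x" "Y x"] by (simp add: distrib_right)
  next
    fix i assume "i < m + n"
    then show "clinear_functional (if i < m then \<phi> i else \<psi> (i - m))"
      using \<phi>(1) \<psi>(1) by auto
  qed
qed

lemma gelfand_le_comp_left:
  assumes "gelfand_le X n \<epsilon>" "\<And>x. norm (A x) \<le> C * norm x" "C \<ge> 0"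
  shows "gelfand_le (A \<circ> X) n (C * \<epsilon>)"
proof -
  obtain \<phi> where \<phi>: "\<And>i. i < n \<Longrightarrow> clinear_functional (\<phi> i)"
    "\<And>x. (\<And>i. i < n \<Longrightarrow> \<phi> i x = 0) \<Longrightarrow> norm (X x) \<le> \<epsilon> * norm x"
    using assms(1) unfolding gelfand_le_def by metis
  have "norm (A (X x)) \<le> C * \<epsilon> * norm x" if "\<And>i. i < n \<Longrightarrow> \<phi> i x = 0" for x
    using order_trans[OF assms(2) mult_left_mono[OF \<phi>(2)[OF that] assms(3)]] by (simp add: mult.assoc)
  then show ?thesis unfolding gelfand_le_def using \<phi>(1) by (intro exI[of _ \<phi>]) auto
qed

lemma gelfand_le_comp_right:
  assumes "gelfand_le X n \<epsilon>" "A \<in> bounded_ops" "\<And>x. norm (A x) \<le> C * norm x" "\<epsilon> \<ge> 0"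
  shows "gelfand_le (X \<circ> A) n (C * \<epsilon>)"
proof -
  obtain \<phi> where \<phi>: "\<And>i. i < n \<Longrightarrow> clinear_functional (\<phi> i)"
    "\<And>x. (\<And>i. i < n \<Longrightarrow> \<phi> i x = 0) \<Longrightarrow> norm (X x) \<le> \<epsilon> * norm x"
    using assms(1) unfolding gelfand_le_def by metis
  have "norm (X (A x)) \<le> C * \<epsilon> * norm x" if "\<And>i. i < n \<Longrightarrow> \<phi> i (A x) = 0" for x
    using order_trans[OF \<phi>(2)[OF that] mult_left_mono[OF assms(3,4)]] by (simp add: mult_ac)
  then show ?thesis unfolding gelfand_le_def using \<phi>(1) assms(2)
    by (intro exI[of _ "\<lambda>i x. \<phi> i (A x)"]) (auto intro: clinear_functional_comp)
qed

lemma homogeneous_system: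
  fixes a :: "nat \<Rightarrow> 'b \<Rightarrow> 'c :: field"
  assumes "finite S" "card S > n"
  shows "\<exists>c. (\<exists>j\<in>S. c j \<noteq> 0) \<and> (\<forall>i<n. (\<Sum>j\<in>S. c j * a i j) = 0)"
  using assms
proof (induction n arbitrary: S a)
  case 0
  then obtain j where "j \<in> S" by fastforce
  then show ?case by (intro exI[of _ "\<lambda>j. 1"]) auto
next
  case (Suc n)
  show ?case
  proof (cases "\<forall>j\<in>S. a n j = 0")
    case True
    then show ?thesis using Suc.IH[of S a] Suc.prems by (auto simp: less_Suc_eq)
  next
    case False
    then obtain p where p: "p \<in> S" "a n p \<noteq> 0" by blast
    \<comment> \<open>Gaussian elimination of the unknown \<open>p\<close> by means of equation \<open>n\<close>\<close>
    define b where "b i j = a i j - a n j / a n p * a i p" for i j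
    have "card (S - {p}) > n" using p Suc.prems by simp
    with Suc.IH[of "S - {p}" b] Suc.prems obtain d where
      d: "\<exists>j\<in>S - {p}. d j \<noteq> 0" "\<forall>i<n. (\<Sum>j\<in>S - {p}. d j * b i j) = 0" by auto
    define c where "c = d(p := - (\<Sum>j\<in>S - {p}. d j * (a n j / a n p)))"
    have *: "(\<Sum>j\<in>S. c j * a i j) = (\<Sum>j\<in>S - {p}. d j * b i j)" for i
    proof -
      have "(\<Sum>j\<in>S. c j * a i j) = c p * a i p + (\<Sum>j\<in>S - {p}. c j * a i j)"
        using p Suc.prems by (simp add: sum.remove)
      also have "(\<Sum>j\<in>S - {p}. c j * a i j) = (\<Sum>j\<in>S - {p}. d j * a i j)"
        by (rule sum.cong) (auto simp: c_def)
      moreover have "(\<Sum>j\<in>S - {p}. d j * b i j)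
          = (\<Sum>j\<in>S - {p}. d j * a i j) - (\<Sum>j\<in>S - {p}. d j * (a n j / a n p)) * a i p"
        by (simp add: b_def right_diff_distrib sum_subtractf sum_distrib_right mult.assoc)
      ultimately show ?thesis by (simp add: c_def)
    qed
    have "b n j = 0" for j using p by (simp add: b_def)
    then have "\<forall>i<Suc n. (\<Sum>j\<in>S. c j * a i j) = 0"
      using d(2) by (simp add: * less_Suc_eq)
    moreover have "\<exists>j\<in>S. c j \<noteq> 0" using d(1) by (auto simp: c_def)
    ultimately show ?thesis by blast
  qed
qed

lemma clinear_functional_sum:
  assumes "clinear_functional \<phi>"
  shows "\<phi> (\<Sum>i\<in>A. c i *\<^sub>C f i) = (\<Sum>i\<in>A. c i * \<phi> (f i))"
proof -
  have "\<phi> (\<Sum>i\<in>A. c i *\<^sub>C f i) = (\<Sum>i\<in>A. \<phi> (c i *\<^sub>C f i))"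
    using assms by (simp add: clinear_functional_def linear_sum bounded_linear.linear)
  then show ?thesis using assms by (simp add: clinear_functional_def)
qed

text \<open>
  This is what bounds Gelfand numbers from below: \<open>n\<close> functionals cannot
  be jointly injective on the span of \<open>n + 1\<close> orthonormal vectors.
\<close>

lemma orthonormal_combination_in_kernel:
  fixes e :: "nat \<Rightarrow> 'a :: complex_hilbert" and \<phi> :: "nat \<Rightarrow> 'a \<Rightarrow> complex"
  assumes e: "orthonormal_seq e" and \<phi>: "\<And>i. i < n \<Longrightarrow> clinear_functional (\<phi> i)"
  obtains c where "norm (\<Sum>j\<le>n. c j *\<^sub>C e j) > 0" "(norm (\<Sum>j\<le>n. c j *\<^sub>C e j))\<^sup>2 = (\<Sum>j\<le>n. (norm (c j))\<^sup>2)"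
    "\<And>i. i < n \<Longrightarrow> \<phi> i (\<Sum>j\<le>n. c j *\<^sub>C e j) = 0"
proof -
  obtain c where c: "\<exists>j\<in>{..n}. c j \<noteq> 0" "\<forall>i<n. (\<Sum>j\<le>n. c j * \<phi> i (e j)) = 0"
    using homogeneous_system[of "{..n}" n "\<lambda>i j. \<phi> i (e j)"] by auto
  have eq: "(norm (\<Sum>j\<le>n. c j *\<^sub>C e j))\<^sup>2 = (\<Sum>j\<le>n. (norm (c j))\<^sup>2)"
    using e by (subst norm_sum_orthogonal)
      (auto simp: cinner_scaleC_left cinner_scaleC_right orthonormal_seq_def norm_scaleC orthonormal_seq_norm[OF e])
  obtain j where j: "j \<le> n" "c j \<noteq> 0" using c(1) by auto
  have "0 < (norm (c j))\<^sup>2" using j by simp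
  also have "\<dots> \<le> (\<Sum>j\<le>n. (norm (c j))\<^sup>2)" using j by (intro member_le_sum) auto
  finally have "norm (\<Sum>j\<le>n. c j *\<^sub>C e j) > 0" unfolding eq[symmetric] by simp
  moreover have "\<phi> i (\<Sum>j\<le>n. c j *\<^sub>C e j) = 0" if "i < n" for i
    using c(2) that by (simp add: clinear_functional_sum[OF \<phi>])
  ultimately show ?thesis using eq that by blast
qed

text \<open>
  The map \<open>x \<mapsto> \<Sum> \<phi>\<^sub>j(x) w\<^sub>j\<close> is a finite rank correction that sends \<open>x\<close> into the common kernel; the vectors \<open>w\<^sub>j\<close>
  play the role of a dual basis, but the functionals may be linearly dependent.
\<close>

lemma projection_along_kernel:
  fixes n :: nat and \<phi> :: "nat \<Rightarrow> 'a :: complex_hilbert \<Rightarrow> complex"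
  assumes "\<And>i. i < n \<Longrightarrow> clinear_functional (\<phi> i)"
  shows "\<exists>w. \<forall>x. \<forall>i<n. \<phi> i (x - (\<Sum>j<n. \<phi> j x *\<^sub>C w j)) = 0"
  using assms
proof (induction n)
  case (Suc n)
  then obtain w where w: "\<And>x i. i < n \<Longrightarrow> \<phi> i (x - (\<Sum>j<n. \<phi> j x *\<^sub>C w j)) = 0" by auto
  have lin: "\<phi> i (x - y) = \<phi> i x - \<phi> i y" "\<phi> i (x + y) = \<phi> i x + \<phi> i y" "\<phi> i 0 = 0" "\<phi> i (c *\<^sub>C x) = c * \<phi> i x"
     "\<phi> i (\<Sum>j\<in>A. d j *\<^sub>C f j) = (\<Sum>j\<in>A. d j * \<phi> i (f j))"
    if "i < Suc n" for i x y c A f and d :: "nat \<Rightarrow> complex"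
    using Suc.prems[OF that] clinear_functional_sum[OF Suc.prems[OF that]]
    by (auto simp: clinear_functional_def linear_simps)
  show ?case
  proof (cases "\<forall>x. (\<forall>i<n. \<phi> i x = 0) \<longrightarrow> \<phi> n x = 0")
    case True
    have "\<forall>x. \<forall>i<Suc n. \<phi> i (x - (\<Sum>j<Suc n. \<phi> j x *\<^sub>C (w(n := 0)) j)) = 0"
      using w True by (simp add: less_Suc_eq)
    then show ?thesis by blast
  next
    case False
    then obtain v0 where v0: "\<And>i. i < n \<Longrightarrow> \<phi> i v0 = 0" "\<phi> n v0 \<noteq> 0" by blast
    \<comment> \<open>correct the projection for the first \<open>n\<close> functionals along a vector that only \<open>\<phi> n\<close> detects\<close>
    define v where "v = (1 / \<phi> n v0) *\<^sub>C v0"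
    have v: "\<And>i. i < n \<Longrightarrow> \<phi> i v = 0" "\<phi> n v = 1" using v0 by (simp_all add: v_def lin)
    define w' where "w' = (\<lambda>j. w j - \<phi> n (w j) *\<^sub>C v)(n := v)"
    have "\<phi> i (x - (\<Sum>j<Suc n. \<phi> j x *\<^sub>C w' j)) = 0" if i: "i < Suc n" for x i
    proof -
      have "(\<Sum>j<n. \<phi> j x *\<^sub>C w' j) = (\<Sum>j<n. \<phi> j x *\<^sub>C w j) - (\<Sum>j<n. (\<phi> j x * \<phi> n (w j)) *\<^sub>C v)"
        by (simp add: w'_def scaleC_diff_right scaleC_scaleC sum_subtractf)
      also have "\<dots> = (\<Sum>j<n. \<phi> j x *\<^sub>C w j) - (\<Sum>j<n. \<phi> j x * \<phi> n (w j)) *\<^sub>C v"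
        by (simp add: complex_vector.scale_sum_left)
      finally have "(\<Sum>j<Suc n. \<phi> j x *\<^sub>C w' j)
          = (\<Sum>j<n. \<phi> j x *\<^sub>C w j) - (\<Sum>j<n. \<phi> j x * \<phi> n (w j)) *\<^sub>C v + \<phi> n x *\<^sub>C v"
        by (simp add: w'_def)
      then have "x - (\<Sum>j<Suc n. \<phi> j x *\<^sub>C w' j) = (x - (\<Sum>j<n. \<phi> j x *\<^sub>C w j))
          + ((\<Sum>j<n. \<phi> j x * \<phi> n (w j)) - \<phi> n x) *\<^sub>C v"
        by (simp add: complex_vector.scale_left_diff_distrib)
      then have "\<phi> i (x - (\<Sum>j<Suc n. \<phi> j x *\<^sub>C w' j)) = \<phi> i (x - (\<Sum>j<n. \<phi> j x *\<^sub>C w j))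
          + ((\<Sum>j<n. \<phi> j x * \<phi> n (w j)) - \<phi> n x) * \<phi> i v"
        by (simp only: lin(2,4)[OF i])
      moreover have "\<phi> n (x - (\<Sum>j<n. \<phi> j x *\<^sub>C w j)) = \<phi> n x - (\<Sum>j<n. \<phi> j x * \<phi> n (w j))"
        by (simp add: lin)
      ultimately show ?thesis
        using i w v by (cases "i = n") (auto simp: less_Suc_eq)
    qed
    then show ?thesis by blast
  qed
qed simp

text \<open>
  Turns a bound on a subspace of finite codimension into a bound on the whole space, by splitting off the
  finite rank correction of the previous lemma.
\<close>

lemma gelfand_le_bound:
  fixes X :: "'a :: complex_hilbert \<Rightarrow> 'a" and n :: nat
  assumes X: "X \<in> bounded_ops" and \<phi>: "\<And>i. i < n \<Longrightarrow> clinear_functional (\<phi> i)"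
    and le: "\<And>x. (\<And>i. i < n \<Longrightarrow> \<phi> i x = 0) \<Longrightarrow> norm (X x) \<le> \<epsilon> * norm x" and "\<epsilon> \<ge> 0"
  shows "\<exists>C\<ge>0. \<forall>x. norm (X x) \<le> \<epsilon> * norm x + C * (\<Sum>j<n. norm (\<phi> j x))"
proof -
  obtain w where w: "\<And>x i. i < n \<Longrightarrow> \<phi> i (x - (\<Sum>j<n. \<phi> j x *\<^sub>C w j)) = 0"
    using projection_along_kernel[of n \<phi>] \<phi> by auto
  obtain B where B: "B > 0" "\<And>x. norm (X x) \<le> B * norm x"
    using bounded_ops_norm_le[OF X] by blast
  define W where "W = (\<Sum>j<n. norm (w j))"
  have "W \<ge> 0" by (simp add: W_def sum_nonneg)
  have "norm (X x) \<le> \<epsilon> * norm x + ((\<epsilon> + B) * W) * (\<Sum>j<n. norm (\<phi> j x))" for x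
  proof -
    define y where "y = (\<Sum>j<n. \<phi> j x *\<^sub>C w j)"
    have "norm y \<le> (\<Sum>j<n. norm (\<phi> j x *\<^sub>C w j))" unfolding y_def by (rule norm_sum)
    also have "\<dots> \<le> (\<Sum>j<n. norm (\<phi> j x) * W)"
      unfolding W_def norm_scaleC
      by (intro sum_mono mult_left_mono member_le_sum) auto
    finally have y: "norm y \<le> W * (\<Sum>j<n. norm (\<phi> j x))" by (simp add: sum_distrib_left mult.commute)
    have "norm (X x) = norm (X (x - y) + X y)" using X by (simp add: bounded_opsD)
    also have "\<dots> \<le> norm (X (x - y)) + norm (X y)" by (rule norm_triangle_ineq)
    also have "\<dots> \<le> \<epsilon> * norm (x - y) + B * norm y"
      using w by (intro add_mono le B(2)) (auto simp: y_def)
    also have "\<dots> \<le> \<epsilon> * (norm x + norm y) + B * norm y"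
      using \<open>\<epsilon> \<ge> 0\<close> by (intro add_right_mono mult_left_mono norm_triangle_ineq4)
    also have "\<dots> = \<epsilon> * norm x + (\<epsilon> + B) * norm y" by (simp add: algebra_simps)
    also have "\<dots> \<le> \<epsilon> * norm x + (\<epsilon> + B) * (W * (\<Sum>j<n. norm (\<phi> j x)))"
      using y \<open>\<epsilon> \<ge> 0\<close> B(1) by (intro add_left_mono mult_left_mono) auto
    finally show ?thesis by (simp add: mult.assoc)
  qed
  moreover have "(\<epsilon> + B) * W \<ge> 0" using \<open>W \<ge> 0\<close> \<open>\<epsilon> \<ge> 0\<close> B(1) by simp
  ultimately show ?thesis by blast
qed

lemma clinear_functional_scaled:
  assumes "clinear_functional \<phi>"
  shows "\<exists>c>0. \<forall>x. norm (\<phi> x) \<le> c * norm x"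
  using assms bounded_linear.pos_bounded[of \<phi>] unfolding clinear_functional_def
  by (metis mult.commute)

text \<open>
  Countably many functionals suffice for all \<open>\<epsilon> = 1 / (k + 1)\<close>. A diagonal subsequence makes all of them
  converge, and the preceding bound then makes the images a Cauchy sequence.
\<close>

lemma compact_op_convergent_subsequence:
  fixes X :: "'a :: complex_hilbert \<Rightarrow> 'a"
  assumes X: "X \<in> bounded_ops" and comp: "compact_op X" and x: "\<And>n. norm (x n) \<le> 1"
  obtains r where "strict_mono (r :: nat \<Rightarrow> nat)" "Cauchy (\<lambda>n. X (x (r n)))"
proof -
  have ex: "\<forall>k. \<exists>(n::nat) \<phi>. (\<forall>i<n. clinear_functional (\<phi> i)) \<and>
     (\<forall>x. (\<forall>i<n. \<phi> i x = 0) \<longrightarrow> norm (X x) \<le> 1 / real (Suc k) * norm x)"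
    using comp[unfolded compact_op_def, rule_format, of "1 / real (Suc _)"] unfolding gelfand_le_def by simp
  obtain n :: "nat \<Rightarrow> nat" where "\<forall>k. \<exists>\<phi>. (\<forall>i<n k. clinear_functional (\<phi> i)) \<and>
     (\<forall>x. (\<forall>i<n k. \<phi> i x = 0) \<longrightarrow> norm (X x) \<le> 1 / real (Suc k) * norm x)"
    using choice[OF ex] by blast
  from choice[OF this] obtain \<phi> where "\<forall>k. (\<forall>i<n k. clinear_functional (\<phi> k i)) \<and>
     (\<forall>x. (\<forall>i<n k. \<phi> k i x = 0) \<longrightarrow> norm (X x) \<le> 1 / real (Suc k) * norm x)"
    by blast
  then have \<phi>: "\<And>k i. i < n k \<Longrightarrow> clinear_functional (\<phi> k i)"
    "\<And>k x. (\<And>i. i < n k \<Longrightarrow> \<phi> k i x = 0) \<Longrightarrow> norm (X x) \<le> 1 / real (Suc k) * norm x"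
    by blast+
  define c where "c k i = (SOME c. c > 0 \<and> (\<forall>x. norm (\<phi> k i x) \<le> c * norm x))" for k i
  have c: "c k i > 0" "norm (\<phi> k i x) \<le> c k i * norm x" if "i < n k" for k i x
    using someI_ex[OF clinear_functional_scaled[OF \<phi>(1)[OF that]]] by (auto simp: c_def)
  \<comment> \<open>the functionals are scaled to norm at most 1, so that one uniform bound serves the diagonal argument\<close>
  define S where "S = {(k, i). i < n k}"
  have "\<exists>r :: nat \<Rightarrow> nat. strict_mono r \<and>
    (\<forall>p\<in>S. \<exists>l. (\<lambda>m. (case p of (k, i) \<Rightarrow> \<phi> k i (x (r m)) / c k i)) \<longlonglongrightarrow> l)"
  proof (rule function_convergent_subsequence[of S
        "\<lambda>m p. case p of (k, i) \<Rightarrow> \<phi> k i (x m) / complex_of_real (c k i)" 1])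
    fix m p assume "p \<in> S"
    then obtain k i where p: "p = (k, i)" "i < n k" by (auto simp: S_def)
    have "norm (\<phi> k i (x m)) \<le> c k i * norm (x m)" using c(2) p by simp
    also have "\<dots> \<le> c k i" using x[of m] c(1)[OF p(2)] by (simp add: mult_left_le)
    finally show "norm (case p of (k, i) \<Rightarrow> \<phi> k i (x m) / complex_of_real (c k i)) \<le> 1"
      using c(1)[OF p(2)] by (simp add: p norm_divide)
  qed auto
  then obtain r where r: "strict_mono (r :: nat \<Rightarrow> nat)" and
    "\<And>p. p \<in> S \<Longrightarrow> \<exists>l. (\<lambda>m. (case p of (k, i) \<Rightarrow> \<phi> k i (x (r m)) / c k i)) \<longlonglongrightarrow> l" by blast
  then have conv: "\<exists>l. (\<lambda>m. \<phi> k i (x (r m)) / c k i) \<longlonglongrightarrow> l" if "i < n k" for k i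
    using that by (force simp: S_def)
  have cau: "Cauchy (\<lambda>m. \<phi> k i (x (r m)))" if "i < n k" for k i
  proof -
    obtain l where "(\<lambda>m. \<phi> k i (x (r m)) / c k i) \<longlonglongrightarrow> l" using conv \<open>i < n k\<close> by blast
    from tendsto_mult_right[OF this, of "c k i"] show ?thesis
      using c(1)[OF that] by (auto intro: LIMSEQ_imp_Cauchy)
  qed
  have "Cauchy (\<lambda>m. X (x (r m)))"
  proof (rule CauchyI)
    fix \<epsilon> :: real assume "\<epsilon> > 0"
    then obtain k where k: "1 / real (Suc k) < \<epsilon> / 4"
      by (metis nat_approx_posE zero_less_divide_iff zero_less_numeral)
    obtain C where C: "C \<ge> 0" "\<And>x. norm (X x) \<le> 1 / real (Suc k) * norm x + C * (\<Sum>j<n k. norm (\<phi> k j x))"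
      using gelfand_le_bound[of X "n k" "\<phi> k" "1 / real (Suc k)", OF X \<phi>] by auto
    define \<delta> where "\<delta> = \<epsilon> / 2 / ((C + 1) * (real (n k) + 1))"
    have "\<delta> > 0" using \<open>\<epsilon> > 0\<close> C(1) by (simp add: \<delta>_def)
    have "\<exists>M. i < n k \<longrightarrow> (\<forall>p\<ge>M. \<forall>q\<ge>M. norm (\<phi> k i (x (r p)) - \<phi> k i (x (r q))) < \<delta>)" for i
      using CauchyD[OF cau \<open>\<delta> > 0\<close>] by blast
    then obtain M where M: "\<And>i p q. i < n k \<Longrightarrow> p \<ge> M i \<Longrightarrow> q \<ge> M i \<Longrightarrow> norm (\<phi> k i (x (r p)) - \<phi> k i (x (r q))) < \<delta>"
      by metis
    define N where "N = (\<Sum>i<n k. M i)"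
    have MN: "M i \<le> N" if "i < n k" for i
      unfolding N_def using that by (intro member_le_sum) auto
    have "norm (X (x (r p)) - X (x (r q))) < \<epsilon>" if pq: "p \<ge> N" "q \<ge> N" for p q
    proof -
      define z where "z = x (r p) - x (r q)"
      have "norm z \<le> 2" unfolding z_def using norm_triangle_ineq4[of "x (r p)" "x (r q)"] x[of "r p"] x[of "r q"] by linarith
      have "norm (\<phi> k j z) \<le> \<delta>" if "j < n k" for j
      proof -
        have "\<phi> k j z = \<phi> k j (x (r p)) - \<phi> k j (x (r q))"
          using \<phi>(1)[OF that] by (simp add: z_def clinear_functional_def linear_simps)
        then show ?thesis using M[OF that, of p q] MN[OF that] pq by simp
      qed
      then have "(\<Sum>j<n k. norm (\<phi> k j z)) \<le> real (n k) * \<delta>"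
        using sum_bounded_above[of "{..<n k}" "\<lambda>j. norm (\<phi> k j z)" \<delta>] by simp
      then have "C * (\<Sum>j<n k. norm (\<phi> k j z)) \<le> C * (real (n k) * \<delta>)" using C(1) by (rule mult_left_mono)
      also have "\<dots> \<le> (C + 1) * ((real (n k) + 1) * \<delta>)" using C(1) \<open>\<delta> > 0\<close> by (intro mult_mono) auto
      also have "\<dots> = \<epsilon> / 2"
      proof -
        have "(C + 1) * (real (n k) + 1) \<noteq> 0" using C(1) by simp
        then have "(C + 1) * (real (n k) + 1) * \<delta> = \<epsilon> / 2"
          unfolding \<delta>_def by (metis nonzero_mult_div_cancel_left times_divide_eq_right)
        then show ?thesis by (simp add: mult.assoc)
      qed
      finally have 1: "C * (\<Sum>j<n k. norm (\<phi> k j z)) \<le> \<epsilon> / 2" .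
      have "1 / real (Suc k) * norm z \<le> 1 / real (Suc k) * 2" using \<open>norm z \<le> 2\<close> by (intro mult_left_mono) auto
      then have "1 / real (Suc k) * norm z < \<epsilon> / 2" using k by linarith
      then have "norm (X z) < \<epsilon>" using C(2)[of z] 1 by linarith
      then show ?thesis using X by (simp add: z_def bounded_opsD)
    qed
    then show "\<exists>M. \<forall>m\<ge>M. \<forall>n\<ge>M. norm (X (x (r m)) - X (x (r n))) < \<epsilon>" by blast
  qed
  with r show ?thesis using that by blast
qed

text \<open>
  A maximising sequence of unit vectors is itself convergent along a subsequence: once the images
  converge, the parallelogram law forces \<open>norm (y i + y j)\<close> to tend to 2, hence \<open>norm (y i - y j)\<close> to 0.
  This replaces weak compactness of the unit ball.
\<close>

lemma compact_op_norm_attained: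
  fixes X :: "'a :: complex_hilbert \<Rightarrow> 'a"
  assumes X: "X \<in> bounded_ops" and comp: "compact_op X"
    and V: "closed V" "complex_vector.subspace V" and v: "v \<in> V" "v \<noteq> 0"
  obtains u where "u \<in> V" "norm u = 1" "\<And>x. x \<in> V \<Longrightarrow> norm (X x) \<le> norm (X u) * norm x"
proof -
  obtain B where B: "B > 0" "\<And>x. norm (X x) \<le> B * norm x"
    using bounded_ops_norm_le[OF X] by blast
  define U where "U = {x \<in> V. norm x = 1}"
  define L where "L = (SUP x\<in>U. norm (X x))"
  have scale: "c *\<^sub>R x \<in> V" if "x \<in> V" for c x
    using V(2) that by (simp add: scaleR_scaleC complex_vector.subspace_scale)
  have normalized: "(1 / norm x) *\<^sub>R x \<in> U" if "x \<in> V" "x \<noteq> 0" for x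
    using that scale by (simp add: U_def)
  then have U0: "U \<noteq> {}" using v by blast
  have bdd: "bdd_above ((\<lambda>x. norm (X x)) ` U)"
  proof (rule bdd_aboveI2)
    fix x assume "x \<in> U"
    then show "norm (X x) \<le> B" using B(2)[of x] by (simp add: U_def)
  qed
  have leL: "norm (X x) \<le> L * norm x" if "x \<in> V" for x
  proof (cases "x = 0")
    case False
    have "norm (X ((1 / norm x) *\<^sub>R x)) \<le> L"
      unfolding L_def by (rule cSUP_upper[OF normalized[OF that False] bdd])
    moreover have "X ((1 / norm x) *\<^sub>R x) = (1 / norm x) *\<^sub>R X x"
      using X by (simp add: scaleR_scaleC bounded_opsD)
    ultimately show ?thesis using False by (simp add: field_simps)
  qed (simp add: bounded_opsD[OF X])
  have "\<exists>u\<in>U. norm (X u) > L - 1 / real (Suc n)" for n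
    using less_cSUP_iff[OF U0 bdd, of "L - 1 / real (Suc n)"] by (simp add: L_def)
  then obtain x where x: "\<And>n. x n \<in> U" "\<And>n. norm (X (x n)) > L - 1 / real (Suc n)" by metis
  have x1: "norm (x n) = 1" "x n \<in> V" for n using x(1)[of n] by (auto simp: U_def)
  have lim: "(\<lambda>n. norm (X (x n))) \<longlonglongrightarrow> L"
  proof (rule tendsto_sandwich[of "\<lambda>n. L - 1 / real (Suc n)" _ _ "\<lambda>n. L"])
    have "(\<lambda>n. L - 1 / real (Suc n)) \<longlonglongrightarrow> L - 0"
      by (intro tendsto_diff tendsto_const LIMSEQ_inverse_real_of_nat[unfolded inverse_eq_divide])
    then show "(\<lambda>n. L - 1 / real (Suc n)) \<longlonglongrightarrow> L" by simp
    show "\<forall>\<^sub>F n in sequentially. L - 1 / real (Suc n) \<le> norm (X (x n))"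
      by (intro always_eventually allI less_imp_le x(2))
  qed (use leL[OF x1(2)] x1(1) in auto)
  have "L \<ge> 0" by (rule LIMSEQ_le_const[OF lim]) auto
  show ?thesis
  proof (cases "L = 0")
    case True
    then show ?thesis using that[of "x 0"] leL x1 by (metis mult_zero_left norm_ge_zero order_antisym)
  next
    case False
    then have "L > 0" using \<open>L \<ge> 0\<close> by simp
    obtain r where r: "strict_mono (r :: nat \<Rightarrow> nat)" "Cauchy (\<lambda>n. X (x (r n)))"
      using compact_op_convergent_subsequence[OF X comp, of x] x1 by (metis order_refl)
    define y where "y n = x (r n)" for n
    have y1: "norm (y n) = 1" "y n \<in> V" for n using x1 by (auto simp: y_def)
    have ylim: "(\<lambda>n. norm (X (y n))) \<longlonglongrightarrow> L"
      unfolding y_def using LIMSEQ_subseq_LIMSEQ[OF lim r(1)] by (simp add: o_def)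
    \<comment> \<open>parallelogram law for \<open>y i, y j\<close> and for their images, and \<open>norm (X (y i + y j)) \<le> L * norm (y i + y j)\<close>\<close>
    have par: "L\<^sup>2 * (norm (y i - y j))\<^sup>2 \<le> 2 * (L\<^sup>2 - (norm (X (y i)))\<^sup>2) + 2 * (L\<^sup>2 - (norm (X (y j)))\<^sup>2)
        + (norm (X (y i) - X (y j)))\<^sup>2" for i j
    proof -
      have pl: "(norm (a + b))\<^sup>2 = 2 * (norm a)\<^sup>2 + 2 * (norm b)\<^sup>2 - (norm (a - b))\<^sup>2" for a b :: 'a
        by (simp add: power2_norm_eq_inner inner_diff_left inner_diff_right inner_add_left inner_add_right inner_commute)
      have "y i + y j \<in> V" using y1 V(2) by (simp add: complex_vector.subspace_add)
      from power_mono[OF leL[OF this], of 2]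
      have "(norm (X (y i) + X (y j)))\<^sup>2 \<le> L\<^sup>2 * (norm (y i + y j))\<^sup>2"
        using X by (simp add: bounded_opsD power_mult_distrib)
      then show ?thesis by (simp add: pl y1 algebra_simps)
    qed
    have "Cauchy y"
    proof (rule CauchyI)
      fix \<epsilon> :: real assume "\<epsilon> > 0"
      define \<eta> where "\<eta> = L\<^sup>2 * \<epsilon>\<^sup>2 / 8"
      have "\<eta> > 0" using \<open>\<epsilon> > 0\<close> \<open>L > 0\<close> by (simp add: \<eta>_def)
      have "(\<lambda>n. L\<^sup>2 - (norm (X (y n)))\<^sup>2) \<longlonglongrightarrow> L\<^sup>2 - L\<^sup>2" by (intro tendsto_intros ylim)
      then have "\<forall>\<^sub>F n in sequentially. L\<^sup>2 - (norm (X (y n)))\<^sup>2 < \<eta>"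
        using \<open>\<eta> > 0\<close> by (auto dest: order_tendstoD)
      then obtain N1 where N1: "\<And>n. n \<ge> N1 \<Longrightarrow> L\<^sup>2 - (norm (X (y n)))\<^sup>2 < \<eta>"
        by (auto simp: eventually_sequentially)
      obtain N2 where N2: "\<And>i j. i \<ge> N2 \<Longrightarrow> j \<ge> N2 \<Longrightarrow> norm (X (y i) - X (y j)) < sqrt \<eta>"
        using CauchyD[OF r(2), of "sqrt \<eta>"] \<open>\<eta> > 0\<close> unfolding y_def by auto
      have lin: "a < \<eta> \<Longrightarrow> b < \<eta> \<Longrightarrow> c < \<eta> \<Longrightarrow> d \<le> 2 * b + 2 * c + a \<Longrightarrow> \<eta> > 0 \<Longrightarrow> d < 8 * \<eta>"
        for a b c d :: real by linarith
      have "norm (y i - y j) < \<epsilon>" if "i \<ge> max N1 N2" "j \<ge> max N1 N2" for i j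
      proof -
        have "(norm (X (y i) - X (y j)))\<^sup>2 < \<eta>"
          using N2[of i j] that real_less_rsqrt \<open>\<eta> > 0\<close>
          by (metis max.bounded_iff norm_ge_zero power_strict_mono pos2 real_sqrt_pow2 less_imp_le)
        moreover have "L\<^sup>2 - (norm (X (y i)))\<^sup>2 < \<eta>" "L\<^sup>2 - (norm (X (y j)))\<^sup>2 < \<eta>"
          using N1[of i] N1[of j] that by auto
        ultimately have "L\<^sup>2 * (norm (y i - y j))\<^sup>2 < 8 * \<eta>"
          using par[of i j] \<open>\<eta> > 0\<close> lin by blast
        then have "L\<^sup>2 * (norm (y i - y j))\<^sup>2 < L\<^sup>2 * \<epsilon>\<^sup>2" by (simp add: \<eta>_def)
        then have "(norm (y i - y j))\<^sup>2 < \<epsilon>\<^sup>2" using \<open>L > 0\<close> by simp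
        then show ?thesis using \<open>\<epsilon> > 0\<close> by (simp add: power2_less_imp_less)
      qed
      then show "\<exists>M. \<forall>m\<ge>M. \<forall>n\<ge>M. norm (y m - y n) < \<epsilon>" by blast
    qed
    then obtain u where u: "y \<longlonglongrightarrow> u" using Cauchy_convergent_iff convergent_def by blast
    have "u \<in> V" using closed_sequentially[OF V(1) y1(2) u] .
    moreover have "norm u = 1"
      using LIMSEQ_unique[OF tendsto_norm[OF u]] y1(1) by simp
    moreover have "norm (X u) = L"
      using LIMSEQ_unique[OF tendsto_norm[OF bounded_linear.tendsto[OF bounded_opsD(1)[OF X] u]] ylim] .
    ultimately show ?thesis using that leL by blast
  qed
qed

section \<open>Singular value decompositions\<close>

text \<open>
  Only the right singular vectors \<open>e\<close> are recorded; the left ones are the normalised images. The last clause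
  says that the norm of \<open>X\<close> on the orthogonal complement of the first \<open>n\<close> vectors is \<open>s n\<close>, and it makes \<open>s\<close>
  the sequence of Gelfand numbers.
\<close>

definition svd :: "('a :: complex_hilbert \<Rightarrow> 'a) \<Rightarrow> (nat \<Rightarrow> real) \<Rightarrow> (nat \<Rightarrow> 'a) \<Rightarrow> bool" where
  "svd X s e \<longleftrightarrow> s \<in> c0_star \<and> orthonormal_seq e \<and>
     (\<forall>i j. i \<noteq> j \<longrightarrow> cinner (X (e i)) (X (e j)) = 0) \<and> (\<forall>i. norm (X (e i)) = s i) \<and>
     (\<forall>n x. (\<forall>i<n. cinner x (e i) = 0) \<longrightarrow> norm (X x) \<le> s n * norm x)"

lemma svdD:
  assumes "svd X s e"
  shows "s \<in> c0_star" "orthonormal_seq e" "orthogonal_seq e" "i \<noteq> j \<Longrightarrow> cinner (X (e i)) (X (e j)) = 0"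
    "norm (X (e i)) = s i" "(\<And>i. i < n \<Longrightarrow> cinner x (e i) = 0) \<Longrightarrow> norm (X x) \<le> s n * norm x"
  using assms by (auto simp: svd_def intro: orthonormal_imp_orthogonal)

lemma c0_starD:
  assumes "s \<in> c0_star"
  shows "0 \<le> s n" "decseq s" "s \<longlonglongrightarrow> 0" "i \<le> j \<Longrightarrow> s j \<le> s i" "\<bar>s n\<bar> \<le> s 0"
  using assms by (auto simp: c0_star_def decseq_def)

text \<open>
  On the span of the first \<open>n + 1\<close> vectors \<open>X\<close> expands norms at least by the factor \<open>norm (X (e n))\<close>, and
  this span meets every subspace of codimension at most \<open>n\<close> in a nonzero vector.
\<close>

lemma gelfand_le_imp_weight_le:
  fixes X :: "'a :: complex_hilbert \<Rightarrow> 'a"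
  assumes X: "X \<in> bounded_ops" and e: "orthonormal_seq e"
    and orth: "\<And>i j. i \<noteq> j \<Longrightarrow> cinner (X (e i)) (X (e j)) = 0"
    and dec: "\<And>i j. i \<le> j \<Longrightarrow> norm (X (e j)) \<le> norm (X (e i))"
    and g: "gelfand_le X n \<epsilon>"
  shows "norm (X (e n)) \<le> \<epsilon>"
proof -
  obtain \<phi> where \<phi>: "\<And>i. i < n \<Longrightarrow> clinear_functional (\<phi> i)"
    "\<And>x. (\<And>i. i < n \<Longrightarrow> \<phi> i x = 0) \<Longrightarrow> norm (X x) \<le> \<epsilon> * norm x"
    using g unfolding gelfand_le_def by metis
  obtain c where c: "norm (\<Sum>j\<le>n. c j *\<^sub>C e j) > 0"
    "(norm (\<Sum>j\<le>n. c j *\<^sub>C e j))\<^sup>2 = (\<Sum>j\<le>n. (norm (c j))\<^sup>2)"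
    "\<And>i. i < n \<Longrightarrow> \<phi> i (\<Sum>j\<le>n. c j *\<^sub>C e j) = 0"
    using orthonormal_combination_in_kernel[where \<phi>=\<phi>, OF e \<phi>(1)] by blast
  define x where "x = (\<Sum>j\<le>n. c j *\<^sub>C e j)"
  have "X x = (\<Sum>j\<le>n. c j *\<^sub>C X (e j))"
    using X by (simp add: x_def bounded_ops_sum bounded_opsD)
  then have "(norm (X x))\<^sup>2 = (\<Sum>j\<le>n. (norm (c j *\<^sub>C X (e j)))\<^sup>2)"
    using orth by (simp add: norm_sum_orthogonal cinner_scaleC_left cinner_scaleC_right)
  also have "\<dots> \<ge> (\<Sum>j\<le>n. (norm (X (e n)))\<^sup>2 * (norm (c j))\<^sup>2)"
    by (intro sum_mono) (auto simp: norm_scaleC power_mult_distrib mult.commute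
        intro!: mult_left_mono power_mono dec)
  also have "(\<Sum>j\<le>n. (norm (X (e n)))\<^sup>2 * (norm (c j))\<^sup>2) = (norm (X (e n)) * norm x)\<^sup>2"
    by (simp add: x_def c(2) power_mult_distrib sum_distrib_left)
  finally have "norm (X (e n)) * norm x \<le> norm (X x)"
    by (rule power2_le_imp_le) simp
  also have "\<dots> \<le> \<epsilon> * norm x" using c(3) by (intro \<phi>(2)) (auto simp: x_def)
  finally show ?thesis using c(1) by (simp add: x_def)
qed

lemma svd_gelfand_le_iff:
  assumes X: "X \<in> bounded_ops" and svd: "svd X s e"
  shows "gelfand_le X n \<epsilon> \<longleftrightarrow> s n \<le> \<epsilon>"
proof
  assume "gelfand_le X n \<epsilon>"
  then show "s n \<le> \<epsilon>"
    using gelfand_le_imp_weight_le[OF X svdD(2)[OF svd] svdD(4)[OF svd], of n \<epsilon>]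
      c0_starD(4)[OF svdD(1)[OF svd]] by (simp add: svdD(5)[OF svd])
next
  assume "s n \<le> \<epsilon>"
  moreover have "gelfand_le X n (s n)"
    unfolding gelfand_le_def using svdD(6)[OF svd]
    by (intro exI[of _ "\<lambda>i x. cinner x (e i)"]) (auto simp: clinear_functional_cinner)
  ultimately show "gelfand_le X n \<epsilon>" by (auto intro: gelfand_le_mono)
qed

lemma norm_add_scaleC:
  "(norm (a + c *\<^sub>C w))\<^sup>2 = (norm a)\<^sup>2 + 2 * Re (c * cinner w a) + (norm c)\<^sup>2 * (norm (w :: 'a :: complex_inner))\<^sup>2"
proof -
  have "(norm (a + c *\<^sub>C w))\<^sup>2 = (norm a)\<^sup>2 + 2 * inner (c *\<^sub>C w) a + (norm (c *\<^sub>C w))\<^sup>2"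
    by (simp add: power2_norm_eq_inner inner_add_left inner_add_right inner_commute)
  then show ?thesis by (simp add: inner_eq_Re_cinner[of "c *\<^sub>C w"] cinner_scaleC_left norm_scaleC power_mult_distrib)
qed

text \<open>
  Otherwise a perturbation of \<open>u\<close> in the direction of \<open>x\<close> would increase the quotient
  \<open>norm (X v) / norm v\<close> to first order, while \<open>norm v\<close> changes to second order only.
\<close>

lemma maximizer_image_orthogonal:
  fixes X :: "'a :: complex_hilbert \<Rightarrow> 'a"
  assumes X: "X \<in> bounded_ops" and V: "complex_vector.subspace V"
    and u: "u \<in> V" "norm u = 1" and max: "\<And>x. x \<in> V \<Longrightarrow> norm (X x) \<le> norm (X u) * norm x"
    and x: "x \<in> V" "cinner x u = 0"
  shows "cinner (X x) (X u) = 0"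
proof -
  define z where "z = cinner (X x) (X u)"
  define K where "K = (norm (X u))\<^sup>2 * (norm x)\<^sup>2"
  have "K \<ge> 0" by (simp add: K_def)
  \<comment> \<open>small enough for the first order term of \<open>norm (X (u + c *\<^sub>C x))\<close> to outweigh the second order term\<close>
  define t where "t = 1 / (K + 1)"
  have t: "t > 0" "t * K < 1" using \<open>K \<ge> 0\<close> by (simp_all add: t_def divide_simps)
  define c where "c = complex_of_real t * cnj z"
  have nc: "norm c = t * norm z" using t by (simp add: c_def norm_mult)
  have "c * z = complex_of_real (t * (norm z)\<^sup>2)"
    by (simp add: c_def complex_norm_square mult_ac del: of_real_power)
  then have cz: "Re (c * z) = t * (norm z)\<^sup>2" by (metis Re_complex_of_real)
  have "u + c *\<^sub>C x \<in> V" using V u x by (simp add: complex_vector.subspace_add complex_vector.subspace_scale)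
  from power_mono[OF max[OF this], of 2]
  have "(norm (X u + c *\<^sub>C X x))\<^sup>2 \<le> (norm (X u))\<^sup>2 * (norm (u + c *\<^sub>C x))\<^sup>2"
    using X by (simp add: bounded_opsD power_mult_distrib)
  then have "(norm (X u))\<^sup>2 + 2 * (t * (norm z)\<^sup>2) + (norm c)\<^sup>2 * (norm (X x))\<^sup>2
      \<le> (norm (X u))\<^sup>2 * (1 + (norm c)\<^sup>2 * (norm x)\<^sup>2)"
    unfolding norm_add_scaleC z_def[symmetric] cz using u x by simp
  then have "2 * (t * (norm z)\<^sup>2) + (norm c)\<^sup>2 * (norm (X x))\<^sup>2 \<le> (norm c)\<^sup>2 * K"
    by (simp add: K_def algebra_simps)
  moreover have "0 \<le> (norm c)\<^sup>2 * (norm (X x))\<^sup>2" by simp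
  ultimately have "2 * (t * (norm z)\<^sup>2) \<le> (norm c)\<^sup>2 * K" by linarith
  also have "\<dots> = (t * K) * (t * (norm z)\<^sup>2)" by (simp add: nc power2_eq_square)
  also have "\<dots> \<le> 1 * (t * (norm z)\<^sup>2)" using t by (intro mult_right_mono) auto
  finally have "t * (norm z)\<^sup>2 \<le> 0" by simp
  then show ?thesis using t(1) by (simp add: z_def mult_le_0_iff)
qed

lemma subspace_orthogonal: "complex_vector.subspace {x. \<forall>i<n. cinner x (e i) = 0}"
  by (rule complex_vector.subspaceI) (auto simp: cinner_add_left cinner_scaleC_left)

lemma closed_orthogonal: "closed {x. \<forall>i<n. cinner x (e i) = 0}"
proof -
  have "{x. \<forall>i<n. cinner x (e i) = 0} = (\<Inter>i\<in>{..<n}. {x. cinner x (e i) = 0})" by auto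
  moreover have "closed {x. cinner x y = 0}" for y :: 'a
    by (intro closed_Collect_eq continuous_on_const linear_continuous_on bounded_linear_cinner_left)
  ultimately show ?thesis by auto
qed

text \<open>
  Successive maximisation. The given orthonormal sequence only serves to guarantee that the orthogonal
  complement of finitely many vectors is never trivial, so that the construction goes on even after the singular
  values have become 0.
\<close>

lemma svd_exists:
  fixes X :: "'a :: complex_hilbert \<Rightarrow> 'a"
  assumes X: "X \<in> bounded_ops" and comp: "compact_op X" and b: "orthonormal_seq (b :: nat \<Rightarrow> 'a)"
  shows "\<exists>s e. svd X s e"
proof -
  define V where "V e n = {x. \<forall>i<n. cinner x (e i) = 0}" for e :: "nat \<Rightarrow> 'a" and n
  define P where "P e n r \<longleftrightarrow> r \<in> V e n \<and> norm r = 1 \<and> (\<forall>x\<in>V e n. norm (X x) \<le> norm (X r) * norm x)"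
    for e :: "nat \<Rightarrow> 'a" and n r
  have "\<exists>e. \<forall>n. P e n (e n)"
  proof (rule dependent_wellorder_choice)
    fix n and e :: "nat \<Rightarrow> 'a"
    obtain c where "norm (\<Sum>j\<le>n. c j *\<^sub>C b j) > 0"
      "\<And>i. i < n \<Longrightarrow> cinner (\<Sum>j\<le>n. c j *\<^sub>C b j) (e i) = 0"
      using orthonormal_combination_in_kernel[OF b, where \<phi>="\<lambda>i x. cinner x (e i)", OF clinear_functional_cinner]
      by blast
    then obtain v where v: "v \<in> V e n" "v \<noteq> 0" by (auto simp: V_def)
    obtain u where "u \<in> V e n" "norm u = 1" "\<And>x. x \<in> V e n \<Longrightarrow> norm (X x) \<le> norm (X u) * norm x"
      using compact_op_norm_attained[OF X comp _ _ v] unfolding V_def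
      using closed_orthogonal subspace_orthogonal by blast
    then show "\<exists>r. P e n r" by (auto simp: P_def)
  qed (simp add: P_def V_def)
  then obtain e where e: "\<And>n. e n \<in> V e n" "\<And>n. norm (e n) = 1"
    "\<And>n x. x \<in> V e n \<Longrightarrow> norm (X x) \<le> norm (X (e n)) * norm x"
    unfolding P_def by blast
  have orth: "cinner (e i) (e j) = 0" if "i \<noteq> j" for i j
  proof (cases "i < j")
    case True
    then have "cinner (e j) (e i) = 0" using e(1)[of j] by (simp add: V_def)
    then show ?thesis using cinner_commute[of "e i" "e j"] by simp
  next
    case False
    then show ?thesis using that e(1)[of i] by (simp add: V_def)
  qed
  then have on: "orthonormal_seq e" by (simp add: orthonormal_seq_def cinner_self e(2))
  have inV: "e j \<in> V e i" if "i \<le> j" for i j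
    using that orth by (auto simp: V_def)
  have dec: "norm (X (e j)) \<le> norm (X (e i))" if "i \<le> j" for i j
    using e(3)[OF inV[OF that]] e(2) by simp
  have Xorth': "cinner (X (e j)) (X (e i)) = 0" if "i < j" for i j
    using that orth inV[of i j] inV[of i i] e
    by (intro maximizer_image_orthogonal[OF X, of "V e i"])
      (auto simp: subspace_orthogonal V_def)
  have Xorth: "cinner (X (e i)) (X (e j)) = 0" if "i \<noteq> j" for i j
    using Xorth'[of i j] Xorth'[of j i] that cinner_commute[of "X (e i)" "X (e j)"]
    by (cases "i < j") auto
  have "(\<lambda>n. norm (X (e n))) \<longlonglongrightarrow> 0"
  proof (rule LIMSEQ_I)
    fix \<epsilon> :: real assume "\<epsilon> > 0"
    then obtain N where "gelfand_le X N (\<epsilon> / 2)"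
      using comp unfolding compact_op_def by (meson half_gt_zero)
    then have "norm (X (e N)) \<le> \<epsilon> / 2"
      using gelfand_le_imp_weight_le[OF X on Xorth dec] by blast
    then have "norm (X (e n)) < \<epsilon>" if "n \<ge> N" for n
      using dec[OF that] \<open>\<epsilon> > 0\<close> by linarith
    then show "\<exists>N. \<forall>n\<ge>N. norm (norm (X (e n)) - 0) < \<epsilon>" by auto
  qed
  then have "(\<lambda>n. norm (X (e n))) \<in> c0_star" using dec by (auto simp: c0_star_def decseq_def)
  then have "svd X (\<lambda>n. norm (X (e n))) e"
    using on Xorth e(3) by (auto simp: svd_def V_def)
  then show ?thesis by blast
qed

lemma svd_expansion:
  fixes X :: "'a :: complex_hilbert \<Rightarrow> 'a"
  assumes X: "X \<in> bounded_ops" and svd: "svd X s e"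
  obtains f where "orthogonal_seq f" "\<And>i. s i * (norm (f i))\<^sup>2 = s i" "X = diag_op s e f"
proof -
  note D = svdD[OF svd] and S = c0_starD[OF svdD(1)[OF svd]]
  \<comment> \<open>equal to 0 where \<open>s i = 0\<close>, because division by 0 yields 0\<close>
  define f where "f i = complex_of_real (1 / s i) *\<^sub>C X (e i)" for i
  have nf: "norm (f i) = (if s i = 0 then 0 else 1)" for i
    using S(1)[of i] by (simp add: f_def norm_scaleC D(5) norm_divide)
  have sf: "complex_of_real (s i) *\<^sub>C f i = X (e i)" for i
    using D(5)[of i] by (cases "s i = 0") (auto simp: f_def scaleC_scaleC scaleC_one)
  have "X x = diag_op s e f x" for x
  proof -
    have "(\<lambda>n. X x - (\<Sum>i<n. cinner x (e i) *\<^sub>C X (e i))) \<longlonglongrightarrow> 0"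
    proof (rule Lim_null_comparison)
      show "(\<lambda>n. s n * (2 * norm x)) \<longlonglongrightarrow> 0" using tendsto_mult_left_zero[OF S(3)] .
      show "\<forall>\<^sub>F n in sequentially. norm (X x - (\<Sum>i<n. cinner x (e i) *\<^sub>C X (e i))) \<le> s n * (2 * norm x)"
      proof (intro always_eventually allI)
        fix n
        define y where "y = (\<Sum>i<n. cinner x (e i) *\<^sub>C e i)"
        have "(norm y)\<^sup>2 \<le> (\<Sum>i<n. (norm (cinner x (e i)))\<^sup>2)"
          unfolding y_def by (rule norm_sum_scaleC_le[OF D(3)])
        also have "\<dots> \<le> (norm x)\<^sup>2" by (rule bessel_sum[OF D(3)]) simp
        finally have "norm y \<le> norm x" by (rule power2_le_imp_le) simp
        then have "norm (x - y) \<le> 2 * norm x" using norm_triangle_ineq4[of x y] by linarith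
        have "cinner y (e j) = cinner x (e j)" if "j < n" for j
        proof -
          have "cinner y (e j) = (\<Sum>i<n. if i = j then cinner x (e i) else 0)"
            unfolding y_def cinner_sum_left using D(2)
            by (intro sum.cong) (auto simp: cinner_scaleC_left orthonormal_seq_def)
          then show ?thesis using that by simp
        qed
        then have "norm (X (x - y)) \<le> s n * norm (x - y)"
          by (intro D(6)) (simp add: cinner_diff_left)
        also have "\<dots> \<le> s n * (2 * norm x)" using S(1) \<open>norm (x - y) \<le> _\<close> by (rule mult_left_mono[rotated])
        also have "X (x - y) = X x - (\<Sum>i<n. cinner x (e i) *\<^sub>C X (e i))"
          using X by (simp add: y_def bounded_opsD bounded_ops_sum)
        finally show "norm (X x - (\<Sum>i<n. cinner x (e i) *\<^sub>C X (e i))) \<le> s n * (2 * norm x)" .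
      qed
    qed
    from tendsto_diff[OF tendsto_const[of "X x"] this]
    have "(\<lambda>i. cinner x (e i) *\<^sub>C X (e i)) sums X x" by (simp add: sums_def)
    then have "(\<lambda>i. (complex_of_real (s i) * cinner x (e i)) *\<^sub>C f i) sums X x"
      by (simp add: sf[symmetric] scaleC_scaleC mult.commute)
    then show ?thesis by (simp add: diag_op_def sums_unique)
  qed
  moreover have "orthogonal_seq f"
    using D(4) nf by (auto simp: orthogonal_seq_def) (simp add: f_def cinner_scaleC_left cinner_scaleC_right)
  moreover have "s i * (norm (f i))\<^sup>2 = s i" for i by (simp add: nf)
  ultimately show ?thesis using that by blast
qed

text \<open>
  Partial isometries carry the right singular vectors of \<open>X\<close> to those of \<open>Y\<close>, and the left ones of \<open>Y\<close> to
  those of \<open>X\<close>.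
\<close>

lemma svd_factor:
  fixes X Y :: "'a :: complex_hilbert \<Rightarrow> 'a"
  assumes X: "X \<in> bounded_ops" "svd X s e" and Y: "Y \<in> bounded_ops" "svd Y s e'"
  obtains A B where "A \<in> bounded_ops" "B \<in> bounded_ops" "X = A \<circ> (Y \<circ> B)"
proof -
  note b = c0_starD(5)[OF svdD(1)[OF X(2)]]
  note e = svdD(3)[OF X(2)] and e' = svdD(3)[OF Y(2)]
  obtain f where f: "orthogonal_seq f" "X = diag_op s e f" using svd_expansion[OF X] by blast
  obtain f' where f': "orthogonal_seq f'" "\<And>i. s i * (norm (f' i))\<^sup>2 = s i" "Y = diag_op s e' f'"
    using svd_expansion[OF Y] by blast
  have 1: "\<bar>1 :: real\<bar> \<le> 1" by simp
  show ?thesis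
  proof
    show "diag_op (\<lambda>_. 1) f' f \<in> bounded_ops" "diag_op (\<lambda>_. 1) e e' \<in> bounded_ops"
      by (rule diag_op_bounded_ops[OF f'(1) f(1) 1] diag_op_bounded_ops[OF e e' 1])+
    show "X = diag_op (\<lambda>_. 1) f' f \<circ> (Y \<circ> diag_op (\<lambda>_. 1) e e')"
    proof
      fix x
      have "Y (diag_op (\<lambda>_. 1) e e' x) = diag_op s e f' x"
        unfolding f'(3) using diag_op_comp[where s=s, OF e e' f'(1) b 1, of x]
        by (simp add: orthonormal_seq_norm[OF svdD(2)[OF Y(2)]])
      then show "X x = (diag_op (\<lambda>_. 1) f' f \<circ> (Y \<circ> diag_op (\<lambda>_. 1) e e')) x"
        using diag_op_comp[where t=s, OF e f'(1) f(1) 1 b, of x] by (simp add: f f'(2))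
    qed
  qed
qed

lemma svd_adj:
  fixes X :: "'a :: complex_hilbert \<Rightarrow> 'a"
  assumes X: "X \<in> bounded_ops" "svd X s e"
  shows "adj X (X x) = diag_op (\<lambda>i. (s i)\<^sup>2) e e x"
proof -
  note b = c0_starD(5)[OF svdD(1)[OF X(2)]] and e = svdD(3)[OF X(2)]
  obtain f where f: "orthogonal_seq f" "\<And>i. s i * (norm (f i))\<^sup>2 = s i" "X = diag_op s e f"
    using svd_expansion[OF X] by blast
  have "adj X = diag_op s f e"
    unfolding f(3) by (intro adj_eqI diag_op_bounded_ops[OF f(1) e b] cinner_diag_op_adjoint[OF e f(1) b])
  then show ?thesis
    using diag_op_comp[where s=s and t=s, OF e f(1) e b b, of x]
    by (simp add: f(3) mult.assoc f(2)) (simp add: power2_eq_square)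
qed

lemma finite_level_set:
  assumes "s \<in> c0_star" "t > 0"
  shows "finite {n. s n = t}"
proof -
  have "\<forall>\<^sub>F n in sequentially. s n < t" using c0_starD(3)[OF assms(1)] assms(2) by (auto dest: order_tendstoD)
  then obtain M where "\<And>n. n \<ge> M \<Longrightarrow> s n < t" by (auto simp: eventually_sequentially)
  then have "{n. s n = t} \<subseteq> {..<M}" by (auto simp: not_less[symmetric])
  then show ?thesis by (rule finite_subset) simp
qed

text \<open>
  Comparing coefficients, an eigenvector for \<open>t\<^sup>2\<close> is a combination of those \<open>e n\<close> with \<open>s n = t\<close>; these are
  finitely many, because \<open>s\<close> tends to 0.
\<close>

lemma dim_diag_eigenspace:
  fixes e :: "nat \<Rightarrow> 'a :: complex_hilbert"
  assumes s: "s \<in> c0_star" and e: "orthonormal_seq e" and t: "t > 0"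
  shows "complex_vector.dim {x. diag_op (\<lambda>i. (s i)\<^sup>2) e e x = complex_of_real (t\<^sup>2) *\<^sub>C x} = card {n. s n = t}"
proof -
  note S = c0_starD[OF s]
  have oe: "orthogonal_seq e" by (rule orthonormal_imp_orthogonal[OF e])
  have b: "\<bar>(s i)\<^sup>2\<bar> \<le> (s 0)\<^sup>2" for i using S(1) S(4)[of 0 i] by (simp add: power_mono)
  define N where "N = {n. s n = t}"
  have fin: "finite N" unfolding N_def by (rule finite_level_set[OF s t])
  have inj: "inj_on e N" using e by (auto simp: inj_on_def orthonormal_seq_def) (metis zero_neq_one)
  have indep: "complex_vector.independent (e ` N)"
  proof
    assume "complex_vector.dependent (e ` N)"
    then obtain u where u: "\<exists>v\<in>e ` N. u v \<noteq> 0" "(\<Sum>v\<in>e ` N. u v *\<^sub>C v) = 0"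
      using complex_vector.dependent_finite[of "e ` N"] fin by blast
    then obtain k where k: "k \<in> N" "u (e k) \<noteq> 0" by auto
    have "0 = cinner (\<Sum>i\<in>N. u (e i) *\<^sub>C e i) (e k)" using u(2) inj by (simp add: sum.reindex)
    also have "\<dots> = (\<Sum>i\<in>N. if i = k then u (e k) else 0)"
      unfolding cinner_sum_left using e by (intro sum.cong) (auto simp: cinner_scaleC_left orthonormal_seq_def)
    also have "\<dots> = u (e k)" using k fin by simp
    finally show False using k by simp
  qed
  have eq: "{x. diag_op (\<lambda>i. (s i)\<^sup>2) e e x = complex_of_real (t\<^sup>2) *\<^sub>C x} = complex_vector.span (e ` N)"
  proof
    have sub: "complex_vector.subspace {x. diag_op (\<lambda>i. (s i)\<^sup>2) e e x = complex_of_real (t\<^sup>2) *\<^sub>C x}"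
      using bounded_opsD[OF diag_op_bounded_ops[OF oe oe b]]
      by (intro complex_vector.subspaceI) (simp_all add: scaleC_add_right scaleC_scaleC mult.commute)
    show "complex_vector.span (e ` N) \<subseteq> {x. diag_op (\<lambda>i. (s i)\<^sup>2) e e x = complex_of_real (t\<^sup>2) *\<^sub>C x}"
      by (intro complex_vector.span_minimal sub) (auto simp: diag_op_basis[OF oe oe b e] N_def)
    show "{x. diag_op (\<lambda>i. (s i)\<^sup>2) e e x = complex_of_real (t\<^sup>2) *\<^sub>C x} \<subseteq> complex_vector.span (e ` N)"
    proof
      fix x assume "x \<in> {x. diag_op (\<lambda>i. (s i)\<^sup>2) e e x = complex_of_real (t\<^sup>2) *\<^sub>C x}"
      then have x: "diag_op (\<lambda>i. (s i)\<^sup>2) e e x = complex_of_real (t\<^sup>2) *\<^sub>C x" by simp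
      have z: "cinner x (e k) = 0" if "k \<notin> N" for k
      proof -
        have "complex_of_real ((s k)\<^sup>2) * cinner x (e k) = complex_of_real (t\<^sup>2) * cinner x (e k)"
          using cinner_diag_op_basis[where s="\<lambda>i. (s i)\<^sup>2", OF oe oe b, of x k]
          by (auto simp: x cinner_scaleC_left orthonormal_seq_norm[OF e])
        moreover have "(s k)\<^sup>2 \<noteq> t\<^sup>2"
          using that S(1)[of k] t by (simp add: N_def power2_eq_iff_nonneg)
        ultimately show ?thesis by (metis mult_cancel_right of_real_eq_iff)
      qed
      have "diag_op (\<lambda>i. (s i)\<^sup>2) e e x = (\<Sum>i\<in>N. (complex_of_real ((s i)\<^sup>2) * cinner x (e i)) *\<^sub>C e i)"
        unfolding diag_op_def using fin z by (intro suminf_finite) auto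
      also have "\<dots> \<in> complex_vector.span (e ` N)"
        by (intro complex_vector.span_sum complex_vector.span_scale complex_vector.span_base) auto
      finally have "(1 / complex_of_real (t\<^sup>2)) *\<^sub>C diag_op (\<lambda>i. (s i)\<^sup>2) e e x \<in> complex_vector.span (e ` N)"
        by (rule complex_vector.span_scale)
      then show "x \<in> complex_vector.span (e ` N)" using t by (simp add: x scaleC_scaleC scaleC_one)
    qed
  qed
  show ?thesis
    unfolding eq complex_vector.dim_span_eq_card_independent[OF indep]
    using card_image[OF inj] by (simp add: N_def)
qed

text \<open>
  At the first index where the sequences differ, the larger value is taken more often by the sequence
  that has it there: the other one has dropped below it for good. This is the uniqueness behind the definition of \<open>singular_values\<close>.
\<close>

lemma c0_star_eq_if_level_cards_eq:
  assumes s: "s \<in> c0_star" and s': "s' \<in> c0_star" and eq: "\<And>t. t > 0 \<Longrightarrow> card {n. s n = t} = card {n. s' n = t}"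
  shows "s = s'"
proof (rule ccontr)
  have less: False
    if s: "s \<in> c0_star" and s': "s' \<in> c0_star" and eq: "\<And>t. t > 0 \<Longrightarrow> card {n. s n = t} = card {n. s' n = t}"
      and n: "s n < s' n" and same: "\<And>i. i < n \<Longrightarrow> s i = s' i" for s s' :: "nat \<Rightarrow> real" and n
  proof -
    define t where "t = s' n"
    have t: "t > 0" using n c0_starD(1)[OF s, of n] by (simp add: t_def)
    have "s i \<noteq> t" if "i \<ge> n" for i using c0_starD(4)[OF s that] n by (simp add: t_def)
    then have "{i. s i = t} \<subseteq> {i. s' i = t}" using same by (metis (mono_tags, lifting) Collect_mono not_less)
    moreover have "n \<in> {i. s' i = t}" "n \<notin> {i. s i = t}" using n by (auto simp: t_def)
    ultimately have "{i. s i = t} \<subset> {i. s' i = t}" by blast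
    from psubset_card_mono[OF finite_level_set[OF s' t] this] show False using eq[OF t] by simp
  qed
  assume "s \<noteq> s'"
  then have ex: "\<exists>n. s n \<noteq> s' n" by auto
  define n where "n = (LEAST n. s n \<noteq> s' n)"
  have n: "s n \<noteq> s' n" unfolding n_def by (rule LeastI_ex[OF ex])
  have same: "s i = s' i" if "i < n" for i using not_less_Least[of i] that by (auto simp: n_def)
  show False
  proof (cases "s n < s' n")
    case True
    then show False using less[OF s s' eq] same by blast
  next
    case False
    then have "s' n < s n" using n by simp
    then show False using less[OF s' s eq[symmetric]] same[symmetric] by blast
  qed
qed

lemma singular_values_eq:
  fixes X :: "'a :: complex_hilbert \<Rightarrow> 'a"
  assumes X: "X \<in> bounded_ops" "svd X s e"
  shows "singular_values X = s"
proof -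
  have s: "s \<in> c0_star" by (rule svdD(1)[OF X(2)])
  have dim: "card {n. s n = t} = complex_vector.dim {x. adj X (X x) = complex_of_real (t\<^sup>2) *\<^sub>C x}" if "t > 0" for t
    unfolding svd_adj[OF X] using dim_diag_eigenspace[OF s svdD(2)[OF X(2)] that] by simp
  show ?thesis unfolding singular_values_def
  proof (rule the_equality)
    fix s' assume s': "s' \<in> c0_star \<and> (\<forall>t>0. card {n. s' n = t} =
        complex_vector.dim {x. adj X (X x) = complex_of_real (t\<^sup>2) *\<^sub>C x})"
    then show "s' = s"
      using dim by (intro c0_star_eq_if_level_cards_eq s) auto
  qed (use s dim in auto)
qed

lemma svd_diag_op:
  fixes e :: "nat \<Rightarrow> 'a :: complex_hilbert"
  assumes s: "s \<in> c0_star" and e: "orthonormal_seq e"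
  shows "diag_op s e e \<in> bounded_ops" "svd (diag_op s e e) s e"
proof -
  note S = c0_starD[OF s]
  have oe: "orthogonal_seq e" by (rule orthonormal_imp_orthogonal[OF e])
  note basis = diag_op_basis[OF oe oe S(5) e]
  show "diag_op s e e \<in> bounded_ops" by (rule diag_op_bounded_ops[OF oe oe S(5)])
  have "norm (diag_op s e e x) \<le> s n * norm x" if "\<forall>i<n. cinner x (e i) = 0" for n x
  proof -
    \<comment> \<open>the first \<open>n\<close> weights do not act on \<open>x\<close>\<close>
    define s' where "s' i = (if i < n then 0 else s i)" for i
    have "diag_op s e e x = diag_op s' e e x"
      unfolding diag_op_def using that by (intro suminf_cong) (auto simp: s'_def)
    moreover have "\<bar>s' i\<bar> \<le> s n" for i using S(1) S(4)[of n i] by (auto simp: s'_def)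
    ultimately show ?thesis using diag_op_norm_le[OF oe oe, of s' "s n" x] by simp
  qed
  then show "svd (diag_op s e e) s e"
    using s e S(1) by (simp add: svd_def basis cinner_scaleC_left cinner_scaleC_right norm_scaleC orthonormal_seq_norm)
      (simp add: orthonormal_seq_def)
qed

section \<open>Orthonormal bases\<close>

lemma orthonormal_seqI:
  assumes "\<And>n. norm (e n) = 1" "\<And>n i. i < n \<Longrightarrow> cinner (e n) (e i) = 0"
  shows "orthonormal_seq e"
proof -
  have "cinner (e i) (e j) = 0" if "i \<noteq> j" for i j
    using assms(2)[of i j] assms(2)[of j i] cinner_commute[of "e i" "e j"] that by (cases "i < j") auto
  then show ?thesis by (simp add: orthonormal_seq_def cinner_self assms(1))
qed

definition total_seq :: "(nat \<Rightarrow> 'a :: complex_inner) \<Rightarrow> bool" where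
  "total_seq b \<longleftrightarrow> (\<forall>x. (\<forall>i. cinner x (b i) = 0) \<longrightarrow> x = 0)"

text \<open>
  Gram-Schmidt on a dense sequence \<open>d\<close>, arranged so that the span of the first \<open>n + 1\<close> vectors contains
  \<open>d n\<close>; infinite dimension provides a new direction when \<open>d n\<close> is in the span already.
\<close>

lemma orthonormal_basis_exists:
  assumes separable: "separable_space (euclidean :: 'a :: complex_hilbert topology)"
    and infinite_dim: "\<nexists>B :: 'a set. finite B \<and> complex_vector.span B = UNIV"
  shows "\<exists>b :: nat \<Rightarrow> 'a. orthonormal_seq b \<and> total_seq b"
proof -
  obtain D :: "'a set" where D: "countable D" "closure D = UNIV"
    using separable unfolding separable_space_def by auto
  then have "D \<noteq> {}" by auto
  define d where "d = from_nat_into D"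
  have d: "range d = D" unfolding d_def by (rule range_from_nat_into[OF \<open>D \<noteq> {}\<close> D(1)])
  define P where "P e n r \<longleftrightarrow> norm r = 1 \<and> (\<forall>i<n. cinner r (e i) = 0) \<and>
      d n \<in> complex_vector.span (insert r (e ` {..<n}))" for e :: "nat \<Rightarrow> 'a" and n r
  have "\<exists>e. \<forall>n. P e n (e n)"
  proof (rule dependent_wellorder_choice)
    fix n and e :: "nat \<Rightarrow> 'a" assume IH: "\<And>i. i < n \<Longrightarrow> P e i (e i)"
    have on: "cinner (e i) (e j) = (if i = j then 1 else 0)" if "i < n" "j < n" for i j
      using IH[OF that(1)] IH[OF that(2)] cinner_commute[of "e i" "e j"]
      by (cases i j rule: linorder_cases) (auto simp: P_def cinner_self)
    define S where "S = complex_vector.span (e ` {..<n})"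
    have "S \<noteq> UNIV" using infinite_dim unfolding S_def by blast
    \<comment> \<open>the Gram-Schmidt step for \<open>d n\<close>, or for an arbitrary vector outside \<open>S\<close> if \<open>d n\<close> lies in \<open>S\<close>\<close>
    then obtain x where x: "x \<notin> S" "d n \<in> S \<or> d n = x" by blast
    define p where "p = (\<Sum>i<n. cinner x (e i) *\<^sub>C e i)"
    define y where "y = x - p"
    have pS: "p \<in> S" unfolding p_def S_def
      by (intro complex_vector.span_sum complex_vector.span_scale complex_vector.span_base) auto
    then have "y \<noteq> 0" using x(1) by (auto simp: y_def)
    have yorth: "cinner y (e j) = 0" if "j < n" for j
    proof -
      have "cinner p (e j) = (\<Sum>i<n. if i = j then cinner x (e i) else 0)"
        unfolding p_def cinner_sum_left using on that by (intro sum.cong) (auto simp: cinner_scaleC_left)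
      then show ?thesis using that by (simp add: y_def cinner_diff_left)
    qed
    define r where "r = complex_of_real (1 / norm y) *\<^sub>C y"
    let ?T = "complex_vector.span (insert r (e ` {..<n}))"
    have ST: "S \<subseteq> ?T" unfolding S_def by (rule complex_vector.span_mono) auto
    have "y = complex_of_real (norm y) *\<^sub>C r" using \<open>y \<noteq> 0\<close> by (simp add: r_def scaleC_scaleC scaleC_one)
    then have "y \<in> ?T" by (metis complex_vector.span_base complex_vector.span_scale insertI1)
    then have "x \<in> ?T" using pS ST complex_vector.span_add[of y _ p] by (auto simp: y_def)
    then have "d n \<in> ?T" using x(2) ST by auto
    moreover have "norm r = 1" using \<open>y \<noteq> 0\<close> by (simp add: r_def norm_scaleC norm_divide)
    ultimately have "P e n r" using yorth by (simp add: P_def r_def cinner_scaleC_left)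
    then show "\<exists>r. P e n r" by blast
  next
    fix r :: 'a and e e' :: "nat \<Rightarrow> 'a" and n :: nat
    assume same: "\<And>i. i < n \<Longrightarrow> e i = e' i"
    then have "e ` {..<n} = e' ` {..<n}" by auto
    then show "P e n r = P e' n r" using same by (auto simp: P_def)
  qed
  then obtain b where b: "\<And>n. P b n (b n)" by blast
  have "x = 0" if x: "\<And>i. cinner x (b i) = 0" for x
  proof -
    have sub: "complex_vector.subspace {y. cinner y x = 0}"
      by (rule complex_vector.subspaceI) (auto simp: cinner_add_left cinner_scaleC_left)
    have "cinner (b i) x = 0" for i using x[of i] cinner_commute[of "b i" x] by simp
    then have "complex_vector.span (insert (b n) (b ` {..<n})) \<subseteq> {y. cinner y x = 0}" for n
      by (intro complex_vector.span_minimal sub) auto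
    then have "D \<subseteq> {y. cinner y x = 0}" using b d unfolding P_def by blast
    moreover have "closed {y. cinner y x = 0}"
      by (intro closed_Collect_eq continuous_on_const linear_continuous_on bounded_linear_cinner_left)
    ultimately have "closure D \<subseteq> {y. cinner y x = 0}" by (rule closure_minimal)
    then have "cinner x x = 0" using D(2) by auto
    then show ?thesis by (simp add: cinner_self)
  qed
  moreover have "orthonormal_seq b" using b by (intro orthonormal_seqI) (auto simp: P_def)
  ultimately show ?thesis unfolding total_seq_def by blast
qed

lemma fixes_basis_imp_identity:
  fixes b :: "nat \<Rightarrow> 'a :: complex_hilbert"
  assumes b: "orthonormal_seq b" "total_seq b" and T: "T \<in> bounded_ops" "\<And>k. T (b k) = b k"
  shows "T = id"
proof
  fix x
  have ob: "orthogonal_seq b" by (rule orthonormal_imp_orthogonal[OF b(1)])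
  have 1: "\<bar>1 :: real\<bar> \<le> 1" by simp
  have "cinner (x - diag_op (\<lambda>_. 1) b b x) (b k) = 0" for k
    using cinner_diag_op_basis[where s="\<lambda>_. 1", OF ob ob 1, of x k]
    by (simp add: cinner_diff_left orthonormal_seq_norm[OF b(1)])
  then have x: "x = diag_op (\<lambda>_. 1) b b x" using b(2) unfolding total_seq_def by (metis right_minus_eq)
  have "T (diag_op (\<lambda>_. 1) b b x) = diag_op (\<lambda>_. 1) b b x"
    unfolding diag_op_def bounded_linear.suminf[OF bounded_opsD(1)[OF T(1)] diag_op_summable[where s="\<lambda>_. 1", OF ob ob 1]]
    by (simp add: bounded_opsD(3)[OF T(1)] T(2))
  then show "T x = id x" using x by simp
qed

section \<open>Proper ideals consist of compact operators\<close>

text \<open>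
  If \<open>X\<close> exceeds the bound \<open>\<epsilon>\<close> on every subspace of finite codimension, then the next vector can be chosen
  orthogonal to the previous ones and with an image orthogonal to the previous images.
\<close>

lemma noncompact_orthonormal_seq:
  fixes X :: "'a :: complex_hilbert \<Rightarrow> 'a"
  assumes X: "X \<in> bounded_ops" and nc: "\<not> compact_op X"
  obtains \<epsilon> e where "\<epsilon> > 0" "orthonormal_seq e" "\<And>i j. i \<noteq> j \<Longrightarrow> cinner (X (e i)) (X (e j)) = 0"
    "\<And>i. norm (X (e i)) \<ge> \<epsilon>"
proof -
  obtain \<epsilon> where \<epsilon>: "\<epsilon> > 0" "\<And>n. \<not> gelfand_le X n \<epsilon>"
    using nc unfolding compact_op_def by blast
  define P where "P e n r \<longleftrightarrow> norm r = 1 \<and> (\<forall>i<n. cinner r (e i) = 0) \<and>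
      (\<forall>i<n. cinner (X r) (X (e i)) = 0) \<and> norm (X r) > \<epsilon>" for e :: "nat \<Rightarrow> 'a" and n r
  have "\<exists>e. \<forall>n. P e n (e n)"
  proof (rule dependent_wellorder_choice)
    fix n and e :: "nat \<Rightarrow> 'a"
    define \<phi> where "\<phi> i = (if i < n then (\<lambda>x. cinner x (e i)) else (\<lambda>x. cinner (X x) (X (e (i - n)))))" for i
    have "clinear_functional (\<phi> i)" for i
      using clinear_functional_comp[OF clinear_functional_cinner X] by (auto simp: \<phi>_def clinear_functional_cinner)
    then have "\<not> (\<forall>x. (\<forall>i<n + n. \<phi> i x = 0) \<longrightarrow> norm (X x) \<le> \<epsilon> * norm x)"
      using \<epsilon>(2)[of "n + n"] unfolding gelfand_le_def by blast
    then obtain x where x: "\<And>i. i < n + n \<Longrightarrow> \<phi> i x = 0" "norm (X x) > \<epsilon> * norm x" by force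
    have 1: "cinner x (e i) = 0" if "i < n" for i using x(1)[of i] that by (simp add: \<phi>_def)
    have 2: "cinner (X x) (X (e i)) = 0" if "i < n" for i using x(1)[of "n + i"] that by (simp add: \<phi>_def)
    have "x \<noteq> 0" using x(2) X by (auto simp: bounded_opsD)
    define r where "r = complex_of_real (1 / norm x) *\<^sub>C x"
    have Xr: "X r = complex_of_real (1 / norm x) *\<^sub>C X x" using X by (simp add: r_def bounded_opsD)
    then have "norm (X r) > \<epsilon>" using x(2) \<open>x \<noteq> 0\<close> by (simp add: norm_scaleC norm_divide field_simps)
    moreover have "norm r = 1" using \<open>x \<noteq> 0\<close> by (simp add: r_def norm_scaleC norm_divide)
    ultimately have "P e n r" using 1 2 unfolding P_def Xr by (simp add: r_def cinner_scaleC_left)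
    then show "\<exists>r. P e n r" by blast
  qed (simp add: P_def)
  then obtain e where e: "\<And>n. P e n (e n)" by blast
  have "orthonormal_seq e" using e by (intro orthonormal_seqI) (auto simp: P_def)
  moreover have "cinner (X (e i)) (X (e j)) = 0" if "i \<noteq> j" for i j
    using e[of i] e[of j] cinner_commute[of "X (e i)" "X (e j)"] that by (cases "i < j") (auto simp: P_def)
  moreover have "norm (X (e i)) \<ge> \<epsilon>" for i using e[of i] by (simp add: P_def)
  ultimately show ?thesis using that \<epsilon>(1) by blast
qed

lemma noncompact_factor_identity:
  fixes X :: "'a :: complex_hilbert \<Rightarrow> 'a"
  assumes b: "orthonormal_seq (b :: nat \<Rightarrow> 'a)" "total_seq b"
    and X: "X \<in> bounded_ops" and nc: "\<not> compact_op X"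
  obtains A B where "A \<in> bounded_ops" "B \<in> bounded_ops" "A \<circ> (X \<circ> B) = id"
proof -
  obtain \<epsilon> e where e: "\<epsilon> > 0" "orthonormal_seq e" "\<And>i j. i \<noteq> j \<Longrightarrow> cinner (X (e i)) (X (e j)) = 0"
    "\<And>i. norm (X (e i)) \<ge> \<epsilon>"
    using noncompact_orthonormal_seq[OF X nc] by blast
  have ob: "orthogonal_seq b" and oe: "orthogonal_seq e"
    using b e(2) by (auto intro: orthonormal_imp_orthogonal)
  \<comment> \<open>\<open>B\<close> moves the basis onto \<open>e\<close>, and \<open>A\<close> moves the normalised images back onto the basis\<close>
  define g where "g i = complex_of_real (1 / norm (X (e i))) *\<^sub>C X (e i)" for i
  have pos: "norm (X (e i)) > 0" for i using e(1) e(4)[of i] by linarith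
  have on: "orthonormal_seq g"
  proof (rule orthonormal_seqI)
    show "norm (g i) = 1" for i using pos[of i] by (simp add: g_def norm_scaleC norm_divide)
  qed (simp add: g_def cinner_scaleC_left cinner_scaleC_right e(3))
  then have og: "orthogonal_seq g" by (rule orthonormal_imp_orthogonal)
  have Xe: "X (e i) = complex_of_real (norm (X (e i))) *\<^sub>C g i" for i
    using pos[of i] by (simp add: g_def scaleC_scaleC scaleC_one)
  have 1: "\<bar>1 :: real\<bar> \<le> 1" by simp
  have 2: "\<bar>1 / norm (X (e i))\<bar> \<le> 1 / \<epsilon>" for i using e(1) e(4)[of i] pos[of i] by (simp add: frac_le)
  define A where "A = diag_op (\<lambda>i. 1 / norm (X (e i))) g b"
  define B where "B = diag_op (\<lambda>_. 1) b e"
  have A: "A \<in> bounded_ops" unfolding A_def by (rule diag_op_bounded_ops[where s="\<lambda>i. 1 / norm (X (e i))", OF og ob 2])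
  have B: "B \<in> bounded_ops" unfolding B_def by (rule diag_op_bounded_ops[OF ob oe 1])
  have "(A \<circ> (X \<circ> B)) (b k) = b k" for k
  proof -
    have "B (b k) = e k" using diag_op_basis[where s="\<lambda>_. 1", OF ob oe 1 b(1)] by (simp add: B_def scaleC_one)
    moreover have "A (g k) = complex_of_real (1 / norm (X (e k))) *\<^sub>C b k"
      unfolding A_def by (rule diag_op_basis[where s="\<lambda>i. 1 / norm (X (e i))", OF og ob 2 on])
    then have "A (X (e k)) = b k"
      by (subst Xe) (use pos[of k] A in \<open>simp add: bounded_opsD scaleC_scaleC scaleC_one\<close>)
    ultimately show ?thesis by simp
  qed
  then have "A \<circ> (X \<circ> B) = id"
    using A B X by (intro fixes_basis_imp_identity[OF b]) (auto intro: bounded_ops_comp)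
  then show ?thesis using that A B by blast
qed

lemma BH_simps [simp]:
  "carrier BH = bounded_ops" "mult BH S T = S \<circ> T" "one BH = id" "zero BH = (\<lambda>x. 0)"
  "add BH S T = (\<lambda>x. S x + T x)"
  by (simp_all add: BH_def)

lemma BH_idealD:
  assumes "BH_ideal K"
  shows "X \<in> K \<Longrightarrow> X \<in> bounded_ops" "X \<in> K \<Longrightarrow> A \<in> bounded_ops \<Longrightarrow> A \<circ> X \<in> K"
    "X \<in> K \<Longrightarrow> A \<in> bounded_ops \<Longrightarrow> X \<circ> A \<in> K" "id \<notin> K"
proof -
  interpret ideal K BH using assms by (simp add: BH_ideal_def)
  show "X \<in> K \<Longrightarrow> X \<in> bounded_ops" using Icarr by simp
  show "X \<in> K \<Longrightarrow> A \<in> bounded_ops \<Longrightarrow> A \<circ> X \<in> K" using I_l_closed[of X A] by simp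
  show "X \<in> K \<Longrightarrow> A \<in> bounded_ops \<Longrightarrow> X \<circ> A \<in> K" using I_r_closed[of X A] by simp
  show "id \<notin> K" using one_imp_carrier assms by (auto simp: BH_ideal_def)
qed

lemma proper_ideal_compact:
  fixes b :: "nat \<Rightarrow> 'a :: complex_hilbert" and K :: "('a \<Rightarrow> 'a) set"
  assumes b: "orthonormal_seq b" "total_seq b" and K: "BH_ideal K" "X \<in> K"
  shows "compact_op X"
proof (rule ccontr)
  assume "\<not> compact_op X"
  then obtain A B where "A \<in> bounded_ops" "B \<in> bounded_ops" "A \<circ> (X \<circ> B) = id"
    using noncompact_factor_identity[OF b BH_idealD(1)[OF K]] by blast
  then show False using BH_idealD[OF K(1)] K(2) by metis
qed

section \<open>Ideals and their characteristic sets\<close>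

lemma proper_ideal_svd:
  fixes b :: "nat \<Rightarrow> 'a :: complex_hilbert" and K :: "('a \<Rightarrow> 'a) set"
  assumes b: "orthonormal_seq b" "total_seq b" and K: "BH_ideal K" "X \<in> K"
  shows "\<exists>e. svd X (singular_values X) e"
  using svd_exists[OF BH_idealD(1)[OF K] proper_ideal_compact[OF b K] b(1)]
    singular_values_eq[OF BH_idealD(1)[OF K]] by metis

text \<open>
  The injectivity of Calkin's correspondence, which makes the description operator in \<open>am_ideal\<close>
  well defined.
\<close>

lemma ideal_subset_if_char_set_subset:
  fixes b :: "nat \<Rightarrow> 'a :: complex_hilbert" and K K' :: "('a \<Rightarrow> 'a) set"
  assumes b: "orthonormal_seq b" "total_seq b" and K: "BH_ideal K" and K': "BH_ideal K'"
    and sub: "char_set K \<subseteq> char_set K'"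
  shows "K \<subseteq> K'"
proof
  fix X assume X: "X \<in> K"
  then obtain Y where Y: "Y \<in> K'" "singular_values X = singular_values Y"
    using sub unfolding char_set_def by blast
  obtain e e' where e: "svd X (singular_values X) e" "svd Y (singular_values X) e'"
    using proper_ideal_svd[OF b K X] proper_ideal_svd[OF b K' Y(1)] Y(2) by metis
  then obtain A B where "A \<in> bounded_ops" "B \<in> bounded_ops" "X = A \<circ> (Y \<circ> B)"
    using svd_factor[OF BH_idealD(1)[OF K X] e(1) BH_idealD(1)[OF K' Y(1)] e(2)] by blast
  then show "X \<in> K'" using BH_idealD[OF K'] Y(1) by metis
qed

lemma am_ideal_eqI:
  fixes b :: "nat \<Rightarrow> 'a :: complex_hilbert"
  assumes b: "orthonormal_seq b" "total_seq b" and K: "BH_ideal (K :: ('a \<Rightarrow> 'a) set)"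
    and "char_set K = {\<xi> \<in> c0_star. \<exists>\<eta>\<in>char_set J. \<xi> \<in> O(arith_mean \<eta>)}"
  shows "am_ideal J = K"
  unfolding am_ideal_def
proof (rule the_equality)
  fix K' :: "('a \<Rightarrow> 'a) set"
  assume K': "BH_ideal K' \<and> char_set K' = {\<xi> \<in> c0_star. \<exists>\<eta>\<in>char_set J. \<xi> \<in> O(arith_mean \<eta>)}"
  then show "K' = K"
    using ideal_subset_if_char_set_subset[OF b K, of K'] ideal_subset_if_char_set_subset[OF b, of K' K] K assms(4)
    by blast
qed (use assms in auto)

text \<open>
  The ideal that Calkin's correspondence assigns to the set of sequences \<open>\<eta> = O(D\<^sub>m \<omega>)\<close>, that is, the
  principal ideal \<open>(\<omega>)\<close>. With indices starting from 0, the entry of \<open>D\<^sub>m \<omega>\<close> with index \<open>n\<close> is \<open>\<omega> (n div m)\<close>. The definition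
  by Gelfand numbers avoids any reference to singular values in the proof of the ideal axioms.
\<close>

definition gelfand_ideal :: "(nat \<Rightarrow> real) \<Rightarrow> ('a :: complex_hilbert \<Rightarrow> 'a) set" where
  "gelfand_ideal \<omega> = {X \<in> bounded_ops. \<exists>C\<ge>0. \<exists>m>0. \<forall>n. gelfand_le X n (C * \<omega> (n div m))}"

lemma gelfand_idealD:
  assumes "X \<in> gelfand_ideal \<omega>"
  obtains C m where "X \<in> bounded_ops" "C \<ge> 0" "m > 0" "\<And>n. gelfand_le X n (C * \<omega> (n div m))"
  using assms unfolding gelfand_ideal_def by blast

lemma gelfand_idealI:
  "X \<in> bounded_ops \<Longrightarrow> C \<ge> 0 \<Longrightarrow> m > 0 \<Longrightarrow> (\<And>n. gelfand_le X n (C * \<omega> (n div m))) \<Longrightarrow> X \<in> gelfand_ideal \<omega>"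
  unfolding gelfand_ideal_def by blast

lemma bounded_ops_add: "X \<in> bounded_ops \<Longrightarrow> Y \<in> bounded_ops \<Longrightarrow> (\<lambda>x. X x + Y x) \<in> bounded_ops"
  by (auto simp: bounded_ops_def bounded_linear_add scaleC_add_right)

lemma bounded_ops_uminus: "uminus \<in> bounded_ops"
  by (auto simp: bounded_ops_def bounded_linear_minus[OF bounded_linear_ident] scaleC_minus_right)

text \<open>
  Gelfand numbers satisfy \<open>c\<^sub>2\<^sub>n(X + Y) \<le> c\<^sub>n(X) + c\<^sub>n(Y)\<close>; the doubling of the index is absorbed by
  doubling the dilation.
\<close>

lemma gelfand_ideal_add:
  assumes \<omega>: "\<omega> \<in> c0_star" and X: "X \<in> gelfand_ideal \<omega>" and Y: "Y \<in> gelfand_ideal \<omega>"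
  shows "(\<lambda>x. X x + Y x) \<in> gelfand_ideal \<omega>"
proof -
  obtain C m where C: "X \<in> bounded_ops" "C \<ge> 0" "m > 0" "\<And>n. gelfand_le X n (C * \<omega> (n div m))"
    by (rule gelfand_idealD[OF X], rule that)
  obtain D k where D: "Y \<in> bounded_ops" "D \<ge> 0" "k > 0" "\<And>n. gelfand_le Y n (D * \<omega> (n div k))"
    by (rule gelfand_idealD[OF Y], rule that)
  show ?thesis
  proof (rule gelfand_idealI[of _ "C + D" "2 * (m * k)"])
    fix n
    have 1: "\<omega> (n div 2 div m) \<le> \<omega> (n div (2 * (m * k)))"
      using C(3) D(3) by (intro c0_starD(4)[OF \<omega>]) (simp add: div_mult2_eq)
    have 2: "\<omega> (n div 2 div k) \<le> \<omega> (n div (2 * (m * k)))"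
      using C(3) D(3) by (intro c0_starD(4)[OF \<omega>]) (metis div_le_dividend div_mult2_eq mult.commute)
    have "C * \<omega> (n div 2 div m) + D * \<omega> (n div 2 div k) \<le> (C + D) * \<omega> (n div (2 * (m * k)))"
      using mult_left_mono[OF 1 C(2)] mult_left_mono[OF 2 D(2)] by (simp add: distrib_right)
    moreover have "n div 2 + n div 2 \<le> n" by simp
    ultimately show "gelfand_le (\<lambda>x. X x + Y x) n ((C + D) * \<omega> (n div (2 * (m * k))))"
      using gelfand_le_add[OF C(4) D(4)] gelfand_le_mono by blast
  qed (use C D in \<open>auto intro: bounded_ops_add\<close>)
qed

lemma gelfand_ideal_comp:
  assumes \<omega>: "\<omega> \<in> c0_star" and X: "X \<in> gelfand_ideal \<omega>" and A: "A \<in> bounded_ops"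
  shows "A \<circ> X \<in> gelfand_ideal \<omega>" "X \<circ> A \<in> gelfand_ideal \<omega>"
proof -
  obtain C m where C: "X \<in> bounded_ops" "C \<ge> 0" "m > 0" "\<And>n. gelfand_le X n (C * \<omega> (n div m))"
    by (rule gelfand_idealD[OF X], rule that)
  obtain B where B: "B > 0" "\<And>x. norm (A x) \<le> B * norm x"
    using bounded_ops_norm_le[OF A] by blast
  show "A \<circ> X \<in> gelfand_ideal \<omega>"
  proof (rule gelfand_idealI[of _ "B * C" m])
    show "gelfand_le (A \<circ> X) n (B * C * \<omega> (n div m))" for n
      using gelfand_le_comp_left[of X n "C * \<omega> (n div m)" A B, OF C(4) B(2)] B(1) by (simp add: mult.assoc)
  qed (use A B C in \<open>auto intro: bounded_ops_comp\<close>)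
  show "X \<circ> A \<in> gelfand_ideal \<omega>"
  proof (rule gelfand_idealI[of _ "B * C" m])
    show "gelfand_le (X \<circ> A) n (B * C * \<omega> (n div m))" for n
      using gelfand_le_comp_right[of X n "C * \<omega> (n div m)" A B, OF C(4) A B(2)] C(2) c0_starD(1)[OF \<omega>]
      by (simp add: mult.assoc)
  qed (use A B C in \<open>auto intro: bounded_ops_comp\<close>)
qed

lemma filterlim_div_nat: "m > 0 \<Longrightarrow> filterlim (\<lambda>n. n div m :: nat) at_top sequentially"
  unfolding filterlim_at_top eventually_sequentially
proof
  fix Z :: nat assume "m > 0"
  then have "Z \<le> n div m" if "n \<ge> Z * m" for n
    using div_le_mono[OF that, of m] by simp
  then show "\<exists>N. \<forall>n\<ge>N. Z \<le> n div m" by blast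
qed

lemma gelfand_ideal_compact:
  assumes \<omega>: "\<omega> \<in> c0_star" and X: "X \<in> gelfand_ideal \<omega>"
  shows "compact_op X"
proof -
  obtain C m where C: "X \<in> bounded_ops" "C \<ge> 0" "m > 0" "\<And>n. gelfand_le X n (C * \<omega> (n div m))"
    by (rule gelfand_idealD[OF X], rule that)
  have lim: "(\<lambda>n. C * \<omega> (n div m)) \<longlonglongrightarrow> 0"
    using tendsto_mult_right_zero[OF filterlim_compose[OF c0_starD(3)[OF \<omega>] filterlim_div_nat[OF C(3)]]] .
  show ?thesis unfolding compact_op_def
  proof (intro allI impI)
    fix \<epsilon> :: real assume "\<epsilon> > 0"
    with lim have "\<forall>\<^sub>F n in sequentially. C * \<omega> (n div m) < \<epsilon>" by (auto dest: order_tendstoD)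
    then obtain n where "C * \<omega> (n div m) < \<epsilon>" by (auto simp: eventually_sequentially)
    then show "\<exists>n. gelfand_le X n \<epsilon>" using gelfand_le_mono[OF C(4)[of n], of n \<epsilon>] by auto
  qed
qed

lemma not_compact_id:
  assumes b: "orthonormal_seq (b :: nat \<Rightarrow> 'a :: complex_hilbert)"
  shows "\<not> compact_op (id :: 'a \<Rightarrow> 'a)"
proof
  assume "compact_op (id :: 'a \<Rightarrow> 'a)"
  then obtain n where n: "gelfand_le (id :: 'a \<Rightarrow> 'a) n (1 / 2)"
    unfolding compact_op_def by (meson half_gt_zero zero_less_one)
  have "id \<in> (bounded_ops :: ('a \<Rightarrow> 'a) set)" by (simp add: bounded_ops_def id_def)
  from gelfand_le_imp_weight_le[OF this b _ _ n] show False
    using b by (simp add: orthonormal_seq_norm) (simp add: orthonormal_seq_def)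
qed

lemma BH_ideal_gelfand_ideal:
  assumes b: "orthonormal_seq (b :: nat \<Rightarrow> 'a :: complex_hilbert)" and \<omega>: "\<omega> \<in> c0_star"
  shows "BH_ideal (gelfand_ideal \<omega> :: ('a \<Rightarrow> 'a) set)"
proof -
  let ?L = "gelfand_ideal \<omega> :: ('a \<Rightarrow> 'a) set"
  interpret ring "BH :: ('a \<Rightarrow> 'a) ring" by (rule ring_BH)
  have sub: "?L \<subseteq> bounded_ops" by (auto simp: gelfand_ideal_def)
  have "ideal ?L BH"
  proof (rule idealI[OF ring_BH])
    show "subgroup ?L (add_monoid BH)"
    proof (rule add.subgroupI)
      have "(\<lambda>x. 0) \<in> ?L"
        by (rule gelfand_idealI[of _ 0 1])
          (auto simp: bounded_ops_def bounded_linear_zero gelfand_le_def intro!: exI[of _ "\<lambda>_ _. 0"]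
            simp: clinear_functional_def)
      then show "?L \<noteq> {}" by blast
    next
      fix X assume X: "X \<in> ?L"
      have "\<ominus>\<^bsub>BH\<^esub> X = uminus \<circ> X"
        using X sub bounded_ops_comp[OF bounded_ops_uminus] by (intro minus_equality) auto
      then show "\<ominus>\<^bsub>BH\<^esub> X \<in> ?L" using gelfand_ideal_comp(1)[OF \<omega> X bounded_ops_uminus] by simp
    qed (use sub gelfand_ideal_add[OF \<omega>] in auto)
  qed (use gelfand_ideal_comp[OF \<omega>] in auto)
  moreover have "id \<notin> ?L" using gelfand_ideal_compact[OF \<omega>] not_compact_id[OF b] by blast
  moreover have "id \<in> carrier (BH :: ('a \<Rightarrow> 'a) ring)" by (simp add: bounded_ops_def id_def)
  ultimately show ?thesis by (auto simp: BH_ideal_def)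
qed

text \<open>
  The surjectivity of Calkin's correspondence, for the characteristic sets that occur below: every sequence
  in the set on the right is realised by a diagonal operator.
\<close>

lemma char_set_gelfand_ideal:
  fixes b :: "nat \<Rightarrow> 'a :: complex_hilbert"
  assumes b: "orthonormal_seq b" "total_seq b" and \<omega>: "\<omega> \<in> c0_star"
  shows "char_set (gelfand_ideal \<omega> :: ('a \<Rightarrow> 'a) set)
    = {\<eta> \<in> c0_star. \<exists>C\<ge>0. \<exists>m>0. \<forall>n. \<eta> n \<le> C * \<omega> (n div m)}"
proof (intro equalityI subsetI)
  fix \<eta> assume "\<eta> \<in> char_set (gelfand_ideal \<omega> :: ('a \<Rightarrow> 'a) set)"
  then obtain X :: "'a \<Rightarrow> 'a" where X: "X \<in> gelfand_ideal \<omega>" "\<eta> = singular_values X"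
    unfolding char_set_def by blast
  obtain e where e: "svd X \<eta> e"
    using proper_ideal_svd[OF b BH_ideal_gelfand_ideal[OF b(1) \<omega>] X(1)] X(2) by blast
  obtain C m where C: "X \<in> bounded_ops" "C \<ge> 0" "m > 0" "\<And>n. gelfand_le X n (C * \<omega> (n div m))"
    by (rule gelfand_idealD[OF X(1)], rule that)
  then show "\<eta> \<in> {\<eta> \<in> c0_star. \<exists>C\<ge>0. \<exists>m>0. \<forall>n. \<eta> n \<le> C * \<omega> (n div m)}"
    using svd_gelfand_le_iff[OF C(1) e] svdD(1)[OF e] by auto
next
  fix \<eta> assume "\<eta> \<in> {\<eta> \<in> c0_star. \<exists>C\<ge>0. \<exists>m>0. \<forall>n. \<eta> n \<le> C * \<omega> (n div m)}"
  then obtain C m where C: "\<eta> \<in> c0_star" "C \<ge> 0" "m > 0" "\<And>n. \<eta> n \<le> C * \<omega> (n div m)" by blast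
  note D = svd_diag_op[OF C(1) b(1)]
  have "diag_op \<eta> b b \<in> gelfand_ideal \<omega>"
    using C by (intro gelfand_idealI[of _ C m]) (auto simp: D svd_gelfand_le_iff[OF D])
  moreover have "singular_values (diag_op \<eta> b b) = \<eta>" by (rule singular_values_eq[OF D])
  ultimately show "\<eta> \<in> char_set (gelfand_ideal \<omega> :: ('a \<Rightarrow> 'a) set)" unfolding char_set_def by force
qed

definition principal_ideal :: "(nat \<Rightarrow> 'a) \<Rightarrow> (nat \<Rightarrow> real) \<Rightarrow> ('a :: complex_hilbert \<Rightarrow> 'a) set" where
  "principal_ideal b \<xi> = genideal BH {diag_op \<xi> b b}"

lemma principal_ideal_generated:
  fixes b :: "nat \<Rightarrow> 'a :: complex_hilbert"
  assumes b: "orthonormal_seq b" "total_seq b" and \<xi>: "\<xi> \<in> c0_star"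
  shows "BH_principal_ideal (principal_ideal b \<xi>)" "principal_ideal b \<xi> \<subseteq> gelfand_ideal \<xi>"
    "diag_op \<xi> b b \<in> principal_ideal b \<xi>"
proof -
  interpret ring "BH :: ('a \<Rightarrow> 'a) ring" by (rule ring_BH)
  note D = svd_diag_op[OF \<xi> b(1)]
  have i: "ideal (principal_ideal b \<xi>) BH"
    unfolding principal_ideal_def using D(1) by (intro genideal_ideal) auto
  have "diag_op \<xi> b b \<in> gelfand_ideal \<xi>"
    by (intro gelfand_idealI[of _ 1 1]) (auto simp: D svd_gelfand_le_iff[OF D])
  then show sub: "principal_ideal b \<xi> \<subseteq> gelfand_ideal \<xi>"
    unfolding principal_ideal_def using BH_ideal_gelfand_ideal[OF b(1) \<xi>]
    by (intro genideal_minimal) (auto simp: BH_ideal_def)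
  show "diag_op \<xi> b b \<in> principal_ideal b \<xi>"
    unfolding principal_ideal_def using D(1) by (intro genideal_self') auto
  have "principalideal (principal_ideal b \<xi>) BH"
    using D(1) by (intro principalidealI i) (auto simp: principal_ideal_def)
  moreover have "id \<notin> principal_ideal b \<xi>"
    using sub BH_idealD(4)[OF BH_ideal_gelfand_ideal[OF b(1) \<xi>]] by blast
  moreover have "id \<in> carrier (BH :: ('a \<Rightarrow> 'a) ring)" by (simp add: bounded_ops_def id_def)
  ultimately show "BH_principal_ideal (principal_ideal b \<xi>)" by (auto simp: BH_principal_ideal_def)
qed

text \<open>
  The quotient of the two diagonals is bounded, so the smaller operator is a multiple of the larger one.
\<close>

lemma principal_ideal_mono:
  fixes b :: "nat \<Rightarrow> 'a :: complex_hilbert"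
  assumes b: "orthonormal_seq b" "total_seq b" and \<xi>: "\<xi> \<in> c0_star" and \<eta>: "\<eta> \<in> c0_star" and le: "\<And>n. \<xi> n \<le> \<eta> n"
  shows "principal_ideal b \<xi> \<subseteq> principal_ideal b \<eta>"
proof -
  interpret ring "BH :: ('a \<Rightarrow> 'a) ring" by (rule ring_BH)
  have J: "BH_ideal (principal_ideal b \<eta>)"
    using principal_ideal_generated(1)[OF b \<eta>] by (auto simp: BH_principal_ideal_def BH_ideal_def principalideal_def)
  have ob: "orthogonal_seq b" by (rule orthonormal_imp_orthogonal[OF b(1)])
  have q: "\<bar>\<xi> n / \<eta> n\<bar> \<le> 1" for n
    using le[of n] c0_starD(1)[OF \<xi>, of n] by (auto simp: divide_simps)
  have "\<eta> n = 0 \<Longrightarrow> \<xi> n = 0" for n using le[of n] c0_starD(1)[OF \<xi>, of n] by simp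
  then have "(\<lambda>n. \<xi> n / \<eta> n * \<eta> n * (norm (b n))\<^sup>2) = \<xi>"
    by (auto simp: orthonormal_seq_norm[OF b(1)])
  then have "diag_op \<xi> b b = diag_op (\<lambda>n. \<xi> n / \<eta> n) b b \<circ> diag_op \<eta> b b"
    using diag_op_comp[where s="\<lambda>n. \<xi> n / \<eta> n" and t=\<eta>, OF ob ob ob q c0_starD(5)[OF \<eta>]] by auto
  then have "diag_op \<xi> b b \<in> principal_ideal b \<eta>"
    using BH_idealD(2)[OF J principal_ideal_generated(3)[OF b \<eta>]]
      diag_op_bounded_ops[where s="\<lambda>n. \<xi> n / \<eta> n", OF ob ob q] by simp
  then show ?thesis
    unfolding principal_ideal_def[of b \<xi>] using J by (intro genideal_minimal) (auto simp: BH_ideal_def)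
qed

section \<open>Arithmetic means\<close>

lemma arith_mean_nonneg: "\<xi> \<in> c0_star \<Longrightarrow> 0 \<le> arith_mean \<xi> n"
  by (simp add: arith_mean_def sum_nonneg c0_starD(1))

lemma arith_mean_pos:
  assumes "\<xi> \<in> c0_star" "\<xi> 0 > 0"
  shows "arith_mean \<xi> n > 0"
proof -
  have "\<xi> 0 \<le> (\<Sum>j\<le>n. \<xi> j)" by (rule member_le_sum) (auto simp: c0_starD(1)[OF assms(1)])
  then show ?thesis using assms(2) by (simp add: arith_mean_def)
qed

lemma arith_mean_le_const_mult:
  assumes "\<And>n. \<xi> n \<le> C * \<eta> n"
  shows "arith_mean \<xi> n \<le> C * arith_mean \<eta> n"
proof -
  have "(\<Sum>j\<le>n. \<xi> j) \<le> C * (\<Sum>j\<le>n. \<eta> j)"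
    unfolding sum_distrib_left by (rule sum_mono) (rule assms)
  then show ?thesis by (simp add: arith_mean_def divide_right_mono)
qed

lemma arith_mean_c0_star:
  assumes \<xi>: "\<xi> \<in> c0_star"
  shows "arith_mean \<xi> \<in> c0_star"
proof -
  note X = c0_starD[OF \<xi>]
  have "arith_mean \<xi> (Suc n) \<le> arith_mean \<xi> n" for n
  proof -
    have "real (Suc n) * \<xi> (Suc n) \<le> (\<Sum>j\<le>n. \<xi> j)"
      using sum_bounded_below[of "{..n}" "\<xi> (Suc n)" \<xi>] X(4) by simp
    then show ?thesis by (simp add: arith_mean_def divide_simps) (simp add: algebra_simps)
  qed
  moreover have "arith_mean \<xi> \<longlonglongrightarrow> 0"
  proof (rule LIMSEQ_I)
    fix \<epsilon> :: real assume "\<epsilon> > 0"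
    then have "\<forall>\<^sub>F n in sequentially. \<xi> n < \<epsilon> / 2" by (intro order_tendstoD(2)[OF X(3)]) simp
    then obtain N where N: "\<And>n. n \<ge> N \<Longrightarrow> \<xi> n < \<epsilon> / 2" by (auto simp: eventually_sequentially)
    obtain M :: nat where M: "2 * real N * \<xi> 0 / \<epsilon> < real M" using reals_Archimedean2 by blast
    have "arith_mean \<xi> n < \<epsilon>" if n: "n \<ge> M" for n
    proof -
      have "(\<Sum>j\<le>n. \<xi> j) \<le> (\<Sum>j\<le>n. (if j < N then \<xi> 0 else 0) + \<epsilon> / 2)"
        using N X(1) X(4)[of 0] \<open>\<epsilon> > 0\<close>
        by (intro sum_mono) (auto simp: not_less add_increasing2 intro: less_imp_le)
      also have "\<dots> = (\<Sum>j\<le>n. if j < N then \<xi> 0 else 0) + real (Suc n) * (\<epsilon> / 2)"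
        by (simp add: sum.distrib)
      also have "(\<Sum>j\<le>n. if j < N then \<xi> 0 else 0) = real (card ({..n} \<inter> {j. j < N})) * \<xi> 0"
        by (simp add: sum.If_cases)
      also have "\<dots> \<le> real N * \<xi> 0"
        using X(1) card_mono[of "{..<N}" "{..n} \<inter> {j. j < N}"] by (intro mult_right_mono) auto
      also have "real N * \<xi> 0 < real (Suc n) * (\<epsilon> / 2)"
      proof -
        have "2 * real N * \<xi> 0 / \<epsilon> < real (Suc n)" using M n by linarith
        then show ?thesis using \<open>\<epsilon> > 0\<close> by (simp add: field_simps)
      qed
      finally show ?thesis by (simp add: arith_mean_def field_simps)
    qed
    then show "\<exists>N. \<forall>n\<ge>N. norm (arith_mean \<xi> n - 0) < \<epsilon>"
      using arith_mean_nonneg[OF \<xi>] by auto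
  qed
  ultimately show ?thesis using arith_mean_nonneg[OF \<xi>] by (auto simp: c0_star_def decseq_Suc_iff)
qed

text \<open>
  Each entry of \<open>\<xi>\<close> is repeated \<open>m\<close> times.
\<close>

lemma sum_div_le:
  assumes \<xi>: "\<xi> \<in> c0_star" and "m > 0"
  shows "(\<Sum>j\<le>n. \<xi> (j div m)) \<le> real m * (\<Sum>j\<le>n. \<xi> j)"
proof -
  have "Suc n \<le> Suc n * m" using mult_le_mono2[of 1 m "Suc n"] \<open>m > 0\<close> by simp
  then have "{..n} \<subseteq> {..<Suc n * m}" unfolding lessThan_Suc_atMost[symmetric] lessThan_subset_iff .
  then have "(\<Sum>j\<le>n. \<xi> (j div m)) \<le> (\<Sum>j<Suc n * m. \<xi> (j div m))"
    using c0_starD(1)[OF \<xi>] by (intro sum_mono2) auto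
  also have "\<dots> = (\<Sum>i<Suc n. \<Sum>j\<in>{i * m..<i * m + m}. \<xi> (j div m))"
    by (rule sum.nat_group[symmetric])
  also have "\<dots> = (\<Sum>i<Suc n. \<Sum>j\<in>{i * m..<i * m + m}. \<xi> i)"
  proof (intro sum.cong refl)
    fix i j assume "j \<in> {i * m..<i * m + m}"
    then have "j div m = i" using \<open>m > 0\<close> by (intro div_nat_eqI) (auto simp: mult.commute)
    then show "\<xi> (j div m) = \<xi> i" by simp
  qed
  also have "\<dots> = real m * (\<Sum>j\<le>n. \<xi> j)" by (simp add: sum_distrib_left lessThan_Suc_atMost del: sum.lessThan_Suc)
  finally show ?thesis .
qed

text \<open>
  Because of this bound the number \<open>m\<close> disappears on passing to means: the arithmetic mean ideal of \<open>(\<xi>)\<close> is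
  governed by the mean of \<open>\<xi>\<close> alone.
\<close>

lemma arith_mean_le_dilation:
  assumes \<xi>: "\<xi> \<in> c0_star" and "m > 0" "C \<ge> 0" and le: "\<And>n. \<eta> n \<le> C * \<xi> (n div m)"
  shows "arith_mean \<eta> n \<le> (C * real m) * arith_mean \<xi> n"
proof -
  have "(\<Sum>j\<le>n. \<eta> j) \<le> C * (\<Sum>j\<le>n. \<xi> (j div m))"
    unfolding sum_distrib_left by (rule sum_mono) (rule le)
  also have "\<dots> \<le> C * (real m * (\<Sum>j\<le>n. \<xi> j))" by (intro mult_left_mono sum_div_le assms)
  finally show ?thesis by (simp add: arith_mean_def divide_right_mono mult.assoc)
qed

text \<open>
  Means are insensitive to dilation, so \<open>O(D\<^sub>m \<xi>\<^sub>a)\<close> is the same as \<open>O(\<xi>\<^sub>a)\<close>.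
\<close>

lemma arith_mean_div_le:
  assumes \<xi>: "\<xi> \<in> c0_star" and "m > 0"
  shows "arith_mean \<xi> (n div m) \<le> real m * arith_mean \<xi> n"
proof -
  have "n < Suc (n div m) * m" using \<open>m > 0\<close> by (metis dividend_less_div_times add.commute mult_Suc)
  then have "Suc n \<le> Suc (n div m) * m" by simp
  then have le: "real (Suc n) \<le> real m * real (Suc (n div m))"
    by (metis of_nat_le_iff of_nat_mult mult.commute)
  have "(\<Sum>j\<le>n div m. \<xi> j) \<le> (\<Sum>j\<le>n. \<xi> j)"
    using c0_starD(1)[OF \<xi>] by (intro sum_mono2) (auto intro: order_trans[OF _ div_le_dividend])
  then have "arith_mean \<xi> (n div m) \<le> (\<Sum>j\<le>n. \<xi> j) / real (Suc (n div m))"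
    by (simp add: arith_mean_def divide_right_mono)
  also have "\<dots> \<le> real m * arith_mean \<xi> n"
  proof -
    have "(\<Sum>j\<le>n. \<xi> j) * real (Suc n) \<le> (\<Sum>j\<le>n. \<xi> j) * (real m * real (Suc (n div m)))"
      using le c0_starD(1)[OF \<xi>] by (intro mult_left_mono sum_nonneg) auto
    then show ?thesis by (simp add: arith_mean_def divide_simps mult_ac del: of_nat_Suc)
  qed
  finally show ?thesis .
qed

lemma bigo_sequence_bound:
  fixes f g :: "nat \<Rightarrow> real"
  assumes "f \<in> O(g)" and pos: "\<And>n. g n > 0"
  obtains C where "C \<ge> 0" "\<And>n. \<bar>f n\<bar> \<le> C * g n"
proof -
  obtain c where c: "c > 0" "\<forall>\<^sub>F n in sequentially. norm (f n) \<le> c * norm (g n)"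
    using assms(1) by (elim landau_o.bigE)
  then obtain N where N: "\<And>n. n \<ge> N \<Longrightarrow> \<bar>f n\<bar> \<le> c * \<bar>g n\<bar>"
    by (auto simp: eventually_sequentially)
  \<comment> \<open>the sum takes care of the finitely many indices where the asymptotic bound may fail\<close>
  define C where "C = c + (\<Sum>n<N. \<bar>f n\<bar> / g n)"
  have quot: "0 \<le> \<bar>f n\<bar> / g n" for n using pos[of n] by simp
  then have s: "0 \<le> (\<Sum>n<N. \<bar>f n\<bar> / g n)" by (intro sum_nonneg)
  have "\<bar>f n\<bar> \<le> C * g n" for n
  proof (cases "n < N")
    case True
    have "\<bar>f n\<bar> / g n \<le> (\<Sum>n<N. \<bar>f n\<bar> / g n)"
      using True quot by (intro member_le_sum) auto
    then have "\<bar>f n\<bar> / g n \<le> C" using c(1) by (simp add: C_def)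
    then show ?thesis using pos[of n] by (simp add: pos_divide_le_eq)
  next
    case False
    then have "\<bar>f n\<bar> \<le> c * g n" using N[of n] pos[of n] by simp
    also have "\<dots> \<le> C * g n" using s pos[of n] by (intro mult_right_mono) (auto simp: C_def)
    finally show ?thesis .
  qed
  moreover have "C \<ge> 0" using c(1) s by (simp add: C_def)
  ultimately show ?thesis using that by blast
qed

lemma char_set_arith_mean_ideal:
  fixes b :: "nat \<Rightarrow> 'a :: complex_hilbert"
  assumes b: "orthonormal_seq b" "total_seq b" and \<xi>: "\<xi> \<in> c0_star" "\<xi> 0 > 0"
  shows "char_set (gelfand_ideal (arith_mean \<xi>) :: ('a \<Rightarrow> 'a) set) = {\<eta> \<in> c0_star. \<eta> \<in> O(arith_mean \<xi>)}"
  unfolding char_set_gelfand_ideal[OF b arith_mean_c0_star[OF \<xi>(1)]]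
proof (intro equalityI subsetI)
  fix \<eta> assume "\<eta> \<in> {\<eta> \<in> c0_star. \<exists>C\<ge>0. \<exists>m>0. \<forall>n. \<eta> n \<le> C * arith_mean \<xi> (n div m)}"
  then obtain C m where C: "\<eta> \<in> c0_star" "C \<ge> 0" "m > 0" "\<And>n. \<eta> n \<le> C * arith_mean \<xi> (n div m)" by blast
  have "norm (\<eta> n) \<le> (C * real m) * norm (arith_mean \<xi> n)" for n
    using order_trans[OF C(4) mult_left_mono[OF arith_mean_div_le[OF \<xi>(1) C(3)] C(2)], of n]
      c0_starD(1)[OF C(1), of n] arith_mean_nonneg[OF \<xi>(1), of n] by (simp add: mult.assoc)
  then have "\<eta> \<in> O(arith_mean \<xi>)" by (intro bigoI[of _ "C * real m"] always_eventually allI)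
  then show "\<eta> \<in> {\<eta> \<in> c0_star. \<eta> \<in> O(arith_mean \<xi>)}" using C(1) by simp
next
  fix \<eta> assume "\<eta> \<in> {\<eta> \<in> c0_star. \<eta> \<in> O(arith_mean \<xi>)}"
  then have \<eta>: "\<eta> \<in> c0_star" "\<eta> \<in> O(arith_mean \<xi>)" by auto
  obtain C where "C \<ge> 0" "\<And>n. \<bar>\<eta> n\<bar> \<le> C * arith_mean \<xi> n"
    using bigo_sequence_bound[OF \<eta>(2) arith_mean_pos[OF \<xi>]] by blast
  then have "\<exists>C\<ge>0. \<exists>m>0. \<forall>n. \<eta> n \<le> C * arith_mean \<xi> (n div m)"
    by (intro exI[of _ C] exI[of _ 1] conjI) (auto intro: order_trans[OF abs_ge_self])
  then show "\<eta> \<in> {\<eta> \<in> c0_star. \<exists>C\<ge>0. \<exists>m>0. \<forall>n. \<eta> n \<le> C * arith_mean \<xi> (n div m)}"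
    using \<eta>(1) by simp
qed

text \<open>
  The hypotheses hold for the principal ideal of \<open>\<xi>\<close> and for \<open>gelfand_ideal \<xi>\<close> itself, so the lemma can be
  applied a second time to its own result.
\<close>

lemma am_ideal_eq_gelfand_ideal:
  fixes b :: "nat \<Rightarrow> 'a :: complex_hilbert" and J :: "('a \<Rightarrow> 'a) set"
  assumes b: "orthonormal_seq b" "total_seq b" and \<xi>: "\<xi> \<in> c0_star" "\<xi> 0 > 0"
    and J: "J \<subseteq> gelfand_ideal \<xi>" "\<xi> \<in> char_set J"
  shows "am_ideal J = gelfand_ideal (arith_mean \<xi>)"
proof (rule am_ideal_eqI[OF b BH_ideal_gelfand_ideal[OF b(1) arith_mean_c0_star[OF \<xi>(1)]]])
  have "\<zeta> \<in> O(arith_mean \<xi>)" if "\<eta> \<in> char_set J" "\<zeta> \<in> O(arith_mean \<eta>)" for \<eta> \<zeta>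
  proof -
    have "\<eta> \<in> char_set (gelfand_ideal \<xi> :: ('a \<Rightarrow> 'a) set)" using that(1) J(1) by (auto simp: char_set_def)
    then obtain C m where C: "\<eta> \<in> c0_star" "C \<ge> 0" "m > 0" "\<And>n. \<eta> n \<le> C * \<xi> (n div m)"
      unfolding char_set_gelfand_ideal[OF b \<xi>(1)] by blast
    have "norm (arith_mean \<eta> n) \<le> (C * real m) * norm (arith_mean \<xi> n)" for n
      using arith_mean_le_dilation[OF \<xi>(1) C(3,2,4), of n] arith_mean_nonneg[OF C(1)] arith_mean_nonneg[OF \<xi>(1)]
      by simp
    then have "arith_mean \<eta> \<in> O(arith_mean \<xi>)" by (intro bigoI[of _ "C * real m"] always_eventually allI)
    with that(2) show ?thesis by (rule landau_o.big_trans)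
  qed
  then show "char_set (gelfand_ideal (arith_mean \<xi>) :: ('a \<Rightarrow> 'a) set)
      = {\<zeta> \<in> c0_star. \<exists>\<eta>\<in>char_set J. \<zeta> \<in> O(arith_mean \<eta>)}"
    unfolding char_set_arith_mean_ideal[OF b \<xi>] using J(2) by blast
qed

lemma gelfand_ideal_mono:
  assumes "C \<ge> 0" "\<And>n. \<omega> n \<le> C * \<omega>' n"
  shows "gelfand_ideal \<omega> \<subseteq> gelfand_ideal \<omega>'"
proof
  fix X :: "'a :: complex_hilbert \<Rightarrow> 'a" assume X: "X \<in> gelfand_ideal \<omega>"
  obtain D m where D: "X \<in> bounded_ops" "D \<ge> 0" "m > 0" "\<And>n. gelfand_le X n (D * \<omega> (n div m))"
    by (rule gelfand_idealD[OF X], rule that)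
  have "D * \<omega> (n div m) \<le> (D * C) * \<omega>' (n div m)" for n
    using mult_left_mono[OF assms(2) D(2)] by (simp add: mult.assoc)
  then have "gelfand_le X n ((D * C) * \<omega>' (n div m))" for n by (rule gelfand_le_mono[OF D(4) order_refl])
  then show "X \<in> gelfand_ideal \<omega>'" using D assms(1) by (intro gelfand_idealI[of _ "D * C" m]) auto
qed

lemma arith_mean_ideals_from_sequences:
  fixes b :: "nat \<Rightarrow> 'a :: complex_hilbert"
  assumes b: "orthonormal_seq b" "total_seq b"
    and \<xi>: "\<xi> \<in> c0_star" "\<xi> 0 > 0" and \<eta>: "\<eta> \<in> c0_star" and le: "\<And>n. \<xi> n \<le> \<eta> n"
    and second: "C \<ge> 0" "\<And>n. arith_mean (arith_mean \<eta>) n \<le> C * arith_mean (arith_mean \<xi>) n"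
    and first: "arith_mean \<eta> \<notin> O(arith_mean \<xi>)"
  shows "\<exists>J I :: ('a \<Rightarrow> 'a) set.
           BH_principal_ideal J \<and> BH_principal_ideal I \<and> J \<subset> I \<and>
           am_ideal (am_ideal J) = am_ideal (am_ideal I) \<and> am_ideal J \<noteq> am_ideal I"
proof -
  have \<eta>0: "\<eta> 0 > 0" using \<xi>(2) le[of 0] by simp
  have am: "am_ideal (principal_ideal b \<zeta>) = gelfand_ideal (arith_mean \<zeta>)"
    and am2: "am_ideal (am_ideal (principal_ideal b \<zeta>)) = gelfand_ideal (arith_mean (arith_mean \<zeta>))"
    if \<zeta>: "\<zeta> \<in> c0_star" "\<zeta> 0 > 0" for \<zeta>
  proof -
    note P = principal_ideal_generated[OF b \<zeta>(1)]
    have "\<zeta> \<in> char_set (principal_ideal b \<zeta>)"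
      unfolding char_set_def using singular_values_eq[OF svd_diag_op[OF \<zeta>(1) b(1)]] P(3) by force
    then show 1: "am_ideal (principal_ideal b \<zeta>) = gelfand_ideal (arith_mean \<zeta>)"
      by (rule am_ideal_eq_gelfand_ideal[OF b \<zeta> P(2)])
    have "arith_mean \<zeta> \<in> char_set (gelfand_ideal (arith_mean \<zeta>) :: ('a \<Rightarrow> 'a) set)"
      unfolding char_set_arith_mean_ideal[OF b \<zeta>] using arith_mean_c0_star[OF \<zeta>(1)] by simp
    then show "am_ideal (am_ideal (principal_ideal b \<zeta>)) = gelfand_ideal (arith_mean (arith_mean \<zeta>))"
      unfolding 1
      by (rule am_ideal_eq_gelfand_ideal[OF b arith_mean_c0_star[OF \<zeta>(1)] arith_mean_pos[OF \<zeta>] order_refl])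
  qed
  let ?J = "principal_ideal b \<xi>" and ?I = "principal_ideal b \<eta>"
  have "arith_mean \<xi> n \<le> 1 * arith_mean \<eta> n" for n by (rule arith_mean_le_const_mult) (simp add: le)
  then have "arith_mean (arith_mean \<xi>) n \<le> 1 * arith_mean (arith_mean \<eta>) n" for n by (rule arith_mean_le_const_mult)
  then have eq: "am_ideal (am_ideal ?J) = am_ideal (am_ideal ?I)"
    unfolding am2[OF \<xi>] am2[OF \<eta> \<eta>0]
    by (intro equalityI gelfand_ideal_mono[OF second] gelfand_ideal_mono[of 1]) auto
  have ne: "am_ideal ?J \<noteq> am_ideal ?I"
  proof
    assume "am_ideal ?J = am_ideal ?I"
    then have "{\<zeta> \<in> c0_star. \<zeta> \<in> O(arith_mean \<eta>)} = {\<zeta> \<in> c0_star. \<zeta> \<in> O(arith_mean \<xi>)}"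
      unfolding am[OF \<xi>] am[OF \<eta> \<eta>0]
      using char_set_arith_mean_ideal[OF b \<xi>] char_set_arith_mean_ideal[OF b \<eta> \<eta>0] by simp
    moreover have "arith_mean \<eta> \<in> {\<zeta> \<in> c0_star. \<zeta> \<in> O(arith_mean \<eta>)}" using arith_mean_c0_star[OF \<eta>] by simp
    ultimately show False using first by blast
  qed
  have "?J \<noteq> ?I" using ne by metis
  then have "?J \<subset> ?I" by (intro psubsetI principal_ideal_mono[OF b \<xi>(1) \<eta> le])
  then show ?thesis
    by (intro exI[of _ ?J] exI[of _ ?I] conjI principal_ideal_generated(1)[OF b \<xi>(1)]
      principal_ideal_generated(1)[OF b \<eta>] eq ne)
qed

section \<open>Averages of blocks\<close>

definition block :: "nat \<Rightarrow> nat \<Rightarrow> real" where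
  "block N n = (if n < N then 1 / real N else 0)"

lemma arith_mean_block: "arith_mean (block N) n = min (1 / real N) (1 / real (Suc n))" if "N > 0"
proof -
  have "{..n} \<inter> {j. j < N} = {..<min (Suc n) N}" by auto
  then have "(\<Sum>j\<le>n. block N j) = real (min (Suc n) N) / real N"
    by (simp add: block_def sum.If_cases)
  then have mean: "arith_mean (block N) n = real (min (Suc n) N) / (real N * real (Suc n))"
    by (simp add: arith_mean_def)
  show ?thesis
  proof (cases "Suc n \<le> N")
    case True
    then have "1 / real N \<le> 1 / real (Suc n)" by (intro frac_le) auto
    then show ?thesis using True that unfolding mean by (simp add: min_absorb1 del: of_nat_Suc)
  next
    case False
    then have "1 / real (Suc n) \<le> 1 / real N" using that by (intro frac_le) auto
    then show ?thesis using False that unfolding mean by (simp add: min_absorb2 del: of_nat_Suc)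
  qed
qed

lemma block_c0_star: "block N \<in> c0_star"
proof -
  have "block N \<longlonglongrightarrow> 0"
    by (rule tendsto_eventually) (auto simp: block_def eventually_sequentially intro!: exI[of _ N])
  then show ?thesis by (auto simp: c0_star_def decseq_def block_def)
qed

text \<open>
  Each dyadic interval contributes between \<open>1 / 2\<close> and 1 to the harmonic series.
\<close>

lemma dyadic_harmonic_bounds:
  assumes "m \<le> a"
  shows "real (a - m) / 2 \<le> (\<Sum>j=2^m..<2^a. 1 / real (Suc j))"
    and "(\<Sum>j=2^m..<2^a. 1 / real (Suc j)) \<le> real (a - m)"
proof -
  have "real (a - m) / 2 \<le> (\<Sum>j=2^m..<2^a. 1 / real (Suc j)) \<and> (\<Sum>j=2^m..<2^a. 1 / real (Suc j)) \<le> real (a - m)"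
    using assms
  proof (induction a rule: dec_induct)
    case (step a)
    have "(\<Sum>j=2^a..<2^Suc a. 1 / real (Suc j)) \<le> (\<Sum>j=2^a..<(2::nat)^Suc a. 1 / 2 ^ a)"
    proof (rule sum_mono)
      fix j :: nat assume "j \<in> {2^a..<2^Suc a}"
      then have "real (2 ^ a) \<le> real (Suc j)" by (subst of_nat_le_iff) auto
      then show "1 / real (Suc j) \<le> 1 / 2 ^ a" by (simp add: frac_le)
    qed
    moreover have "(\<Sum>j=2^a..<2^Suc a. 1 / real (Suc j)) \<ge> (\<Sum>j=2^a..<(2::nat)^Suc a. 1 / 2 ^ Suc a)"
    proof (rule sum_mono)
      fix j :: nat assume "j \<in> {2^a..<2^Suc a}"
      then have "real (Suc j) \<le> real (2 ^ Suc a)" by (subst of_nat_le_iff) auto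
      then show "1 / 2 ^ Suc a \<le> 1 / real (Suc j)" by (simp add: frac_le)
    qed
    ultimately have "(\<Sum>j=2^a..<2^Suc a. 1 / real (Suc j)) \<le> 1" "(\<Sum>j=2^a..<2^Suc a. 1 / real (Suc j)) \<ge> 1 / 2"
      by simp_all
    moreover have "(\<Sum>j=2^m..<2^a. 1 / real (Suc j)) + (\<Sum>j=2^a..<2^Suc a. 1 / real (Suc j))
        = (\<Sum>j=2^m..<2^Suc a. 1 / real (Suc j))"
      using step.hyps by (intro sum.atLeastLessThan_concat power_increasing) auto
    moreover have "real (Suc a - m) = real (a - m) + 1" using step.hyps by simp
    ultimately show ?case using step.IH by linarith
  qed simp
  then show "real (a - m) / 2 \<le> (\<Sum>j=2^m..<2^a. 1 / real (Suc j))"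
    and "(\<Sum>j=2^m..<2^a. 1 / real (Suc j)) \<le> real (a - m)" by auto
qed

text \<open>
  Blocks of mass \<open>c\<close> with lengths \<open>N' \<le> N\<close> are compared. The sums of their means differ by at
  most \<open>c D\<close>, where \<open>D\<close> is about \<open>log (N / N')\<close>. A block of mass \<open>d\<close> and shorter length \<open>M\<close> has accumulated
  \<open>d log (N' / M)\<close> by the time \<open>N'\<close> and can pay for the difference.
\<close>

lemma second_mean_block_compare:
  assumes "0 < M" "M \<le> N'" "N' \<le> N" "c \<ge> 0" "d \<ge> 0"
    and cd: "c * (1 + (\<Sum>j=N'..<N. 1 / real (Suc j))) \<le> d * (\<Sum>j=M..<N'. 1 / real (Suc j))"
  shows "c * arith_mean (arith_mean (block N')) n
    \<le> c * arith_mean (arith_mean (block N)) n + d * arith_mean (arith_mean (block M)) n"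
proof -
  have pos: "N > 0" "N' > 0" using assms by auto
  define t where "t K j = min (1 / real K) (1 / real (Suc j))" for K j
  have t0: "0 \<le> t K j" for K j by (simp add: t_def)
  define D where "D = 1 + (\<Sum>j=N'..<N. 1 / real (Suc j))"
  define E where "E = (\<Sum>j=M..<N'. 1 / real (Suc j))"
  have D1: "D \<ge> 1" by (simp add: D_def sum_nonneg)
  have amm: "arith_mean (arith_mean (block K)) n = (\<Sum>j\<le>n. t K j) / real (Suc n)" if "K > 0" for K n
    using that by (simp add: arith_mean_def[of "arith_mean _"] arith_mean_block t_def)
  have E: "E \<le> (\<Sum>j\<le>n. t M j)" if "N' \<le> Suc n" for n
  proof -
    have "E = (\<Sum>j=M..<N'. t M j)"
      unfolding E_def using \<open>0 < M\<close> by (intro sum.cong) (auto simp: t_def min_def field_simps)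
    also have "\<dots> \<le> (\<Sum>j\<le>n. t M j)" using that t0 by (intro sum_mono2) auto
    finally show ?thesis .
  qed
  show ?thesis
  proof (cases "N' \<le> Suc n")
    case True
    \<comment> \<open>bounds by how much the means of the shorter block exceed those of the longer one; its sum is at most \<open>D\<close>\<close>
    define u where "u j = (if j < N' then 1 / real N' else if j < N then 1 / real (Suc j) else 0)" for j
    have "(\<Sum>j\<le>n. t N' j) \<le> (\<Sum>j\<le>n. t N j + u j)"
    proof (rule sum_mono)
      fix j
      show "t N' j \<le> t N j + u j"
      proof (cases "j < N")
        case True
        moreover have "t N' j \<le> 1 / real N'" "t N' j \<le> 1 / real (Suc j)" by (simp_all add: t_def)
        ultimately show ?thesis using t0[of N j] by (auto simp: u_def simp del: of_nat_Suc)
      next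
        case False
        then have "t N j = 1 / real (Suc j)" using pos by (auto simp: t_def min_def field_simps)
        then show ?thesis using False \<open>N' \<le> N\<close> by (simp add: u_def) (simp add: t_def)
      qed
    qed
    also have "\<dots> = (\<Sum>j\<le>n. t N j) + (\<Sum>j\<le>n. u j)" by (rule sum.distrib)
    also have "(\<Sum>j\<le>n. u j) \<le> D"
    proof -
      have "(\<Sum>j\<le>n. u j) \<le> (\<Sum>j\<in>{..n} \<union> {..<N}. u j)" by (rule sum_mono2) (auto simp: u_def)
      also have "\<dots> = (\<Sum>j\<in>{..<N}. u j)"
        using \<open>N' \<le> N\<close> by (intro sum.mono_neutral_right) (auto simp: u_def)
      also have "\<dots> = (\<Sum>j=0..<N'. u j) + (\<Sum>j=N'..<N. u j)"
        using sum.atLeastLessThan_concat[of 0 N' N u] \<open>N' \<le> N\<close> by (simp add: atLeast0LessThan)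
      also have "(\<Sum>j=0..<N'. u j) = 1" using pos by (simp add: u_def)
      also have "(\<Sum>j=N'..<N. u j) = (\<Sum>j=N'..<N. 1 / real (Suc j))" by (rule sum.cong) (auto simp: u_def)
      finally show ?thesis by (simp add: D_def)
    qed
    finally have "c * (\<Sum>j\<le>n. t N' j) \<le> c * ((\<Sum>j\<le>n. t N j) + D)" using \<open>c \<ge> 0\<close> by (simp add: mult_left_mono)
    also have "\<dots> = c * (\<Sum>j\<le>n. t N j) + c * D" by (simp add: distrib_left)
    also have "c * D \<le> d * E" using cd by (simp add: D_def E_def)
    also have "d * E \<le> d * (\<Sum>j\<le>n. t M j)" using E[OF True] \<open>d \<ge> 0\<close> by (rule mult_left_mono)
    finally have "c * (\<Sum>j\<le>n. t N' j) \<le> c * (\<Sum>j\<le>n. t N j) + d * (\<Sum>j\<le>n. t M j)" by simp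
    then have "(c * (\<Sum>j\<le>n. t N' j)) / real (Suc n) \<le> (c * (\<Sum>j\<le>n. t N j) + d * (\<Sum>j\<le>n. t M j)) / real (Suc n)"
      by (rule divide_right_mono) simp
    then show ?thesis by (simp add: amm pos \<open>0 < M\<close> add_divide_distrib)
  next
    case False
    \<comment> \<open>before the time \<open>N'\<close> the mean is constant on the left and decreasing on the right, so the case of time \<open>N'\<close> decides\<close>
    have nn: "0 \<le> arith_mean (arith_mean (block N)) n"
      by (intro arith_mean_nonneg arith_mean_c0_star block_c0_star)
    have "(\<Sum>j\<le>n. t N' j) = (\<Sum>j\<le>n. 1 / real N')"
      using False pos by (intro sum.cong) (auto simp: t_def min_def field_simps)
    then have "arith_mean (arith_mean (block N')) n = 1 / real N'" by (simp add: amm pos)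
    then have "c * arith_mean (arith_mean (block N')) n \<le> (c * D) / real N'"
      using D1 \<open>c \<ge> 0\<close> by (simp add: divide_right_mono mult_left_mono[of 1 D c, simplified])
    also have "\<dots> \<le> d * E / real N'" using cd by (intro divide_right_mono) (auto simp: D_def E_def)
    also have "\<dots> \<le> d * (arith_mean (arith_mean (block M)) (N' - 1))"
      using E[of "N' - 1"] pos \<open>0 < M\<close> \<open>d \<ge> 0\<close> by (simp add: amm mult_left_mono divide_right_mono)
    also have "\<dots> \<le> d * arith_mean (arith_mean (block M)) n"
      using False \<open>d \<ge> 0\<close>
      by (intro mult_left_mono c0_starD(4)[OF arith_mean_c0_star[OF arith_mean_c0_star[OF block_c0_star]]]) auto
    finally show ?thesis using mult_nonneg_nonneg[OF \<open>c \<ge> 0\<close> nn] by linarith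
  qed
qed

section \<open>Superpositions of blocks\<close>

lemma arith_mean_cmult: "arith_mean (\<lambda>n. c * f n) n = c * arith_mean f n"
  by (simp add: arith_mean_def sum_distrib_left)

lemma arith_mean_add: "arith_mean (\<lambda>n. f n + g n) n = arith_mean f n + arith_mean g n"
  by (simp add: arith_mean_def sum.distrib add_divide_distrib)

lemma arith_mean_suminf:
  assumes "\<And>n. summable (\<lambda>k. f k n)"
  shows "summable (\<lambda>k. arith_mean (f k) n)" "arith_mean (\<lambda>n. \<Sum>k. f k n) n = (\<Sum>k. arith_mean (f k) n)"
proof -
  show "summable (\<lambda>k. arith_mean (f k) n)"
    unfolding arith_mean_def by (intro summable_divide summable_sum assms)
  show "arith_mean (\<lambda>n. \<Sum>k. f k n) n = (\<Sum>k. arith_mean (f k) n)"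
    unfolding arith_mean_def
    by (subst suminf_divide[OF summable_sum[OF assms]], subst suminf_sum[OF assms]) auto
qed

definition blocks :: "(nat \<Rightarrow> real) \<Rightarrow> (nat \<Rightarrow> nat) \<Rightarrow> nat \<Rightarrow> real" where
  "blocks w N n = (\<Sum>k. w k * block (N k) n)"

context
  fixes w :: "nat \<Rightarrow> real" and N :: "nat \<Rightarrow> nat"
  assumes w: "\<And>k. w k \<ge> 0" and summable: "summable (\<lambda>k. w k / real (N k))"
begin

lemma blocks_term_bounds: "0 \<le> w k * block (N k) n" "w k * block (N k) n \<le> w k / real (N k)"
  using w[of k] by (auto simp: block_def)

lemma blocks_summable: "summable (\<lambda>k. w k * block (N k) n)"
  by (rule summable_comparison_test'[OF summable]) (use blocks_term_bounds in auto)

lemma blocks_c0_star: "blocks w N \<in> c0_star"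
proof -
  have nonneg: "0 \<le> blocks w N n" for n
    unfolding blocks_def by (rule suminf_nonneg[OF blocks_summable]) (rule blocks_term_bounds)
  have dec: "blocks w N j \<le> blocks w N i" if "i \<le> j" for i j
    unfolding blocks_def
    by (intro suminf_le blocks_summable mult_left_mono w c0_starD(4)[OF block_c0_star that])
  have "(\<lambda>n. \<Sum>k. w k * block (N k) n) \<longlonglongrightarrow> (\<Sum>k. 0)"
  proof (rule tannerys_theorem[THEN conjunct2, THEN conjunct2, OF _ _ summable])
    show "((\<lambda>n. w k * block (N k) n) \<longlonglongrightarrow> 0)" for k
      by (rule tendsto_mult_right_zero[OF c0_starD(3)[OF block_c0_star]])
    show "\<forall>\<^sub>F (k, n) in at_top \<times>\<^sub>F sequentially. norm (w k * block (N k) n) \<le> w k / real (N k)"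
      using blocks_term_bounds by (intro always_eventually) auto
  qed simp
  then have "blocks w N \<longlonglongrightarrow> 0" by (simp add: blocks_def[abs_def])
  then show ?thesis using nonneg dec by (auto simp: c0_star_def decseq_def)
qed

lemma arith_mean_blocks:
  "summable (\<lambda>k. w k * arith_mean (block (N k)) n)"
  "arith_mean (blocks w N) n = (\<Sum>k. w k * arith_mean (block (N k)) n)"
  using arith_mean_suminf[of "\<lambda>k n. w k * block (N k) n", OF blocks_summable]
  by (simp_all add: arith_mean_cmult blocks_def[abs_def])

lemma second_mean_blocks:
  "summable (\<lambda>k. w k * arith_mean (arith_mean (block (N k))) n)"
  "arith_mean (arith_mean (blocks w N)) n = (\<Sum>k. w k * arith_mean (arith_mean (block (N k))) n)"
  using arith_mean_suminf[of "\<lambda>k n. w k * arith_mean (block (N k)) n", OF arith_mean_blocks(1)]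
    arith_mean_blocks(2)[abs_def]
  by (simp_all add: arith_mean_cmult)

end

section \<open>The two sequences\<close>

text \<open>
  The quotient of consecutive weights is \<open>4^(k + 1)\<close>, the lengths of the two blocks with index \<open>k\<close> have the quotient
  \<open>4^k\<close>, and the exponents \<open>32^k\<close> leave room for both: the harmonic sum from \<open>late k\<close> to \<open>early (k + 1)\<close>
  is of the order \<open>32^k\<close>, and the order of what has to be paid for is \<open>(k + 1) 4^k\<close>.
\<close>

definition weight :: "nat \<Rightarrow> real" where "weight k = 2 ^ (k * Suc k)"
definition early :: "nat \<Rightarrow> nat" where "early k = 2 ^ (32 ^ k)"
definition late :: "nat \<Rightarrow> nat" where "late k = 2 ^ (32 ^ k + 2 * k)"

lemma exponent_bounds:
  "j * j + 2 * j \<le> (32::nat) ^ j"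
  "k < j \<Longrightarrow> j * j + (32::nat) ^ k \<le> 32 ^ j"
  "2 * (2 * k + 3) * 4 ^ Suc k + 2 * k + (32::nat) ^ k \<le> 32 ^ Suc k"
proof -
  have lin: "Suc j \<le> 2 ^ j" for j by (induction j) auto
  have sq: "Suc j * Suc j \<le> 4 ^ j" for j
    using mult_le_mono[OF lin[of j] lin[of j]] by (simp add: power_mult_distrib[symmetric])
  have p8: "(4::nat) ^ j \<le> 8 ^ j" "(8::nat) ^ j \<le> 32 ^ j" "(2::nat) ^ j \<le> 8 ^ j" for j by (auto intro: power_mono)
  have "j * j + 2 * j \<le> Suc j * Suc j" by simp
  then show "j * j + 2 * j \<le> (32::nat) ^ j" using sq[of j] p8[of j] by linarith
  show "j * j + (32::nat) ^ k \<le> 32 ^ j" if "k < j"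
  proof -
    obtain i where j: "j = Suc i" using \<open>k < j\<close> by (cases j) auto
    have "(32::nat) ^ k \<le> 32 ^ i" using that j by (intro power_increasing) auto
    moreover have "j * j \<le> 32 ^ i" using sq[of i] p8[of i] unfolding j by linarith
    moreover have "(32::nat) ^ j = 32 * 32 ^ i" by (simp add: j)
    ultimately show ?thesis by linarith
  qed
  have "(2 * k + 3) * 4 ^ Suc k \<le> (3 * 2 ^ k) * (4 * 4 ^ k)" using lin[of k] by (intro mult_le_mono) auto
  also have "\<dots> = 12 * (8::nat) ^ k" by (simp add: power_mult_distrib[symmetric])
  finally have "(2 * k + 3) * 4 ^ Suc k \<le> 12 * (8::nat) ^ k" .
  moreover have "k \<le> 8 ^ k" using lin[of k] p8(3)[of k] by linarith
  moreover have "(32::nat) ^ Suc k = 32 * 32 ^ k" by simp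
  ultimately show "2 * (2 * k + 3) * 4 ^ Suc k + 2 * k + (32::nat) ^ k \<le> 32 ^ Suc k"
    using p8(2)[of k] by linarith
qed

lemma weight_nonneg: "weight k \<ge> 0" by (simp add: weight_def)

lemma weight_Suc: "weight (Suc k) = weight k * 4 ^ Suc k"
proof -
  have "Suc k * Suc (Suc k) = k * Suc k + 2 * Suc k" by simp
  then show ?thesis by (simp only: weight_def power_add power_mult) simp
qed

lemma summable_early: "summable (\<lambda>k. weight k / real (early k))"
  and summable_late: "summable (\<lambda>k. weight k / real (late k))"
proof -
  have early: "weight k / real (early k) \<le> (1 / 2) ^ k" for k
  proof -
    have "(2::real) ^ (k * Suc k + k) \<le> 2 ^ (32 ^ k)"
      using exponent_bounds(1)[of k] by (intro power_increasing) auto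
    then show ?thesis by (simp add: weight_def early_def power_add power_divide divide_simps)
  qed
  have "real (early k) \<le> real (late k)" for k by (auto simp: early_def late_def intro!: power_increasing)
  then have "weight k / real (late k) \<le> weight k / real (early k)" for k
    by (intro divide_left_mono) (auto simp: weight_nonneg early_def late_def)
  with early have late: "weight k / real (late k) \<le> (1 / 2) ^ k" for k by (meson order_trans)
  have geo: "summable (\<lambda>k. (1 / 2 :: real) ^ k)" by (rule summable_geometric) simp
  show "summable (\<lambda>k. weight k / real (early k))" "summable (\<lambda>k. weight k / real (late k))"
    by (rule summable_comparison_test'[OF geo]; use early late weight_nonneg in simp)+
qed

text \<open>
  The contribution of block \<open>j\<close> of the late sequence to the mean at time \<open>early k\<close>. For \<open>j < k\<close> it is small
  because \<open>weight j\<close> is small, for \<open>j = k\<close> because the block is spread over \<open>late k\<close> places, and for \<open>j > k\<close>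
  because \<open>late j\<close> exceeds \<open>early k\<close> by far.
\<close>

lemma weight_late_le:
  "weight j * min (1 / real (late j)) (1 / real (early k)) \<le> weight k / 2 ^ k / real (early k) * (1 / 2) ^ j"
proof (cases "j < k")
  case True
  have "j * j + 2 * j + k \<le> k * Suc k"
  proof -
    have "Suc j * Suc j \<le> k * k" using True by (intro mult_le_mono) auto
    then show ?thesis by simp
  qed
  then have "(2::real) ^ (j * Suc j + k + j) \<le> 2 ^ (k * Suc k)" by (intro power_increasing) auto
  then have "weight j \<le> weight k / 2 ^ k * (1 / 2) ^ j"
    by (simp add: weight_def power_add power_divide divide_simps)
  then have "weight j * (1 / real (early k)) \<le> weight k / 2 ^ k * (1 / 2) ^ j * (1 / real (early k))"
    by (intro mult_right_mono) auto
  moreover have "weight j * min (1 / real (late j)) (1 / real (early k)) \<le> weight j * (1 / real (early k))"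
    by (intro mult_left_mono weight_nonneg) simp
  ultimately show ?thesis by simp
next
  case False
  have "j * j + 32 ^ k \<le> k * k + 32 ^ j"
    using exponent_bounds(2)[of k j] False by (cases "k = j") auto
  then have "j * Suc j + k + j + 32 ^ k \<le> k * Suc k + (32 ^ j + 2 * j)" by simp
  then have "(2::real) ^ (j * Suc j + k + j + 32 ^ k) \<le> 2 ^ (k * Suc k + (32 ^ j + 2 * j))"
    by (intro power_increasing) auto
  then have "weight j * (2 ^ k * 2 ^ j * real (early k)) \<le> weight k * real (late j)"
    by (simp add: weight_def early_def late_def power_add mult_ac)
  then have "weight j * (1 / real (late j)) \<le> weight k / 2 ^ k / real (early k) * (1 / 2) ^ j"
    by (simp add: power_divide divide_simps early_def late_def mult_ac)
  moreover have "weight j * min (1 / real (late j)) (1 / real (early k)) \<le> weight j * (1 / real (late j))"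
    by (intro mult_left_mono weight_nonneg) simp
  ultimately show ?thesis by linarith
qed

lemma arith_mean_late_le:
  "arith_mean (blocks weight late) (early k - 1) \<le> 2 * (weight k / 2 ^ k / real (early k))"
proof -
  let ?K = "weight k / 2 ^ k / real (early k)"
  have pos: "early k > 0" "late j > 0" for j by (simp_all add: early_def late_def)
  have "arith_mean (blocks weight late) (early k - 1)
      = (\<Sum>j. weight j * arith_mean (block (late j)) (early k - 1))"
    by (rule arith_mean_blocks(2)[OF weight_nonneg summable_late])
  also have "\<dots> \<le> (\<Sum>j. ?K * (1 / 2) ^ j)"
  proof (rule suminf_le)
    show "weight j * arith_mean (block (late j)) (early k - 1) \<le> ?K * (1 / 2) ^ j" for j
      using weight_late_le[of j k] pos by (simp add: arith_mean_block)
    show "summable (\<lambda>j. weight j * arith_mean (block (late j)) (early k - 1))"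
      by (rule arith_mean_blocks(1)[OF weight_nonneg summable_late])
    show "summable (\<lambda>j. ?K * (1 / 2) ^ j)" by (intro summable_mult summable_geometric) simp
  qed
  also have "\<dots> = ?K * (\<Sum>j. (1 / 2) ^ j)" by (intro suminf_mult summable_geometric) simp
  also have "(\<Sum>j. (1 / 2 :: real) ^ j) = 2" by (subst suminf_geometric) auto
  finally show ?thesis by (simp only: mult.commute[of 2])
qed

lemma arith_mean_early_ge:
  "weight k / real (early k) \<le> arith_mean (blocks weight early) (early k - 1)"
proof -
  have pos: "early j > 0" for j by (simp add: early_def)
  have "weight k / real (early k) = weight k * arith_mean (block (early k)) (early k - 1)"
    using pos[of k] by (simp add: arith_mean_block)
  also have "\<dots> = (\<Sum>j\<in>{k}. weight j * arith_mean (block (early j)) (early k - 1))" by simp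
  also have "\<dots> \<le> (\<Sum>j. weight j * arith_mean (block (early j)) (early k - 1))"
    using weight_nonneg arith_mean_nonneg[OF block_c0_star]
    by (intro sum_le_suminf arith_mean_blocks(1)[OF weight_nonneg summable_early]) auto
  finally show ?thesis by (simp add: arith_mean_blocks(2)[OF weight_nonneg summable_early])
qed

lemma second_mean_early_le:
  "arith_mean (arith_mean (blocks weight early)) n \<le> 2 * arith_mean (arith_mean (blocks weight late)) n"
proof -
  define g where "g k = weight k * arith_mean (arith_mean (block (late k))) n" for k
  \<comment> \<open>the contribution of block \<open>k - 1\<close>; blocks with index 0 agree in the two sequences\<close>
  define h where "h k = (case k of 0 \<Rightarrow> 0 | Suc i \<Rightarrow> g i)" for k
  have g: "summable g" "arith_mean (arith_mean (blocks weight late)) n = suminf g"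
    using second_mean_blocks[OF weight_nonneg summable_late, of n] by (simp_all add: g_def[abs_def])
  have h: "summable h" "suminf h = suminf g"
  proof -
    have "summable (\<lambda>k. h (Suc k))" using g(1) by (simp add: h_def)
    then show "summable h" by (rule summable_Suc_iff[THEN iffD1])
    then have "suminf h = (\<Sum>k. h (Suc k)) + h 0" by (simp add: suminf_split_head)
    then show "suminf h = suminf g" by (simp add: h_def)
  qed
  have le: "weight k * arith_mean (arith_mean (block (early k))) n \<le> g k + h k" for k
  proof (cases k)
    case 0
    then show ?thesis by (simp add: g_def h_def early_def late_def)
  next
    case (Suc i)
    have e: "32 ^ i + 2 * i \<le> (32::nat) ^ Suc i" using exponent_bounds(3)[of i] by linarith
    have "(\<Sum>j=early (Suc i)..<late (Suc i). 1 / real (Suc j)) \<le> real (32 ^ Suc i + 2 * Suc i - 32 ^ Suc i)"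
      unfolding early_def late_def by (rule dyadic_harmonic_bounds(2)) simp
    then have 1: "1 + (\<Sum>j=early (Suc i)..<late (Suc i). 1 / real (Suc j)) \<le> real (2 * i + 3)"
      by (simp del: power_Suc)
    have "real (32 ^ Suc i - (32 ^ i + 2 * i)) / 2 \<le> (\<Sum>j=late i..<early (Suc i). 1 / real (Suc j))"
      unfolding early_def late_def by (rule dyadic_harmonic_bounds(1)[OF e])
    moreover have "real (2 * (2 * i + 3) * 4 ^ Suc i) \<le> real (32 ^ Suc i - (32 ^ i + 2 * i))"
      unfolding of_nat_le_iff using exponent_bounds(3)[of i] by linarith
    moreover have "real (2 * (2 * i + 3) * 4 ^ Suc i) = 2 * (real (2 * i + 3) * 4 ^ Suc i)"
      by (simp only: of_nat_mult of_nat_power of_nat_numeral mult.assoc)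
    ultimately have 2: "real (2 * i + 3) * 4 ^ Suc i \<le> (\<Sum>j=late i..<early (Suc i). 1 / real (Suc j))"
      by linarith
    have "weight (Suc i) * (1 + (\<Sum>j=early (Suc i)..<late (Suc i). 1 / real (Suc j)))
        \<le> weight (Suc i) * real (2 * i + 3)"
      by (rule mult_left_mono[OF 1 weight_nonneg])
    also have "\<dots> = weight i * (real (2 * i + 3) * 4 ^ Suc i)" by (simp add: weight_Suc)
    also have "\<dots> \<le> weight i * (\<Sum>j=late i..<early (Suc i). 1 / real (Suc j))"
      by (rule mult_left_mono[OF 2 weight_nonneg])
    finally have cd: "weight (Suc i) * (1 + (\<Sum>j=early (Suc i)..<late (Suc i). 1 / real (Suc j)))
        \<le> weight i * (\<Sum>j=late i..<early (Suc i). 1 / real (Suc j))" .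
    have "late i \<le> early (Suc i)" "early (Suc i) \<le> late (Suc i)" "0 < late i"
      using e by (auto simp: early_def late_def intro!: power_increasing simp del: power_Suc)
    from second_mean_block_compare[OF this(3,1,2) weight_nonneg weight_nonneg cd]
    show ?thesis by (simp add: Suc g_def h_def)
  qed
  have "arith_mean (arith_mean (blocks weight early)) n
      = (\<Sum>k. weight k * arith_mean (arith_mean (block (early k))) n)"
    by (rule second_mean_blocks(2)[OF weight_nonneg summable_early])
  also have "\<dots> \<le> (\<Sum>k. g k + h k)"
    by (intro suminf_le le summable_add g(1) h(1) second_mean_blocks(1)[OF weight_nonneg summable_early])
  also have "\<dots> = suminf g + suminf h" by (rule suminf_add[OF g(1) h(1), symmetric])
  finally show ?thesis by (simp add: g(2) h(2))
qed

text \<open>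
  The late sequence alone is not dominated by the early one, nor conversely; adding the two gives the
  required pointwise inequality and changes the comparison of means by a constant only.
\<close>

lemma sequences_exist:
  obtains \<xi> \<eta> where "\<xi> \<in> c0_star" "\<xi> 0 > 0" "\<eta> \<in> c0_star" "\<And>n. \<xi> n \<le> \<eta> n"
    "\<And>n. arith_mean (arith_mean \<eta>) n \<le> 3 * arith_mean (arith_mean \<xi>) n"
    "arith_mean \<eta> \<notin> O(arith_mean \<xi>)"
proof -
  define \<xi> where "\<xi> = blocks weight late"
  define \<zeta> where "\<zeta> = blocks weight early"
  define \<eta> where "\<eta> n = \<xi> n + \<zeta> n" for n
  have \<xi>: "\<xi> \<in> c0_star" unfolding \<xi>_def by (rule blocks_c0_star[OF weight_nonneg summable_late])
  have \<zeta>: "\<zeta> \<in> c0_star" unfolding \<zeta>_def by (rule blocks_c0_star[OF weight_nonneg summable_early])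
  have "\<eta> \<longlonglongrightarrow> 0 + 0" unfolding \<eta>_def by (intro tendsto_add c0_starD(3) \<xi> \<zeta>)
  then have \<eta>: "\<eta> \<in> c0_star"
    using c0_starD(1,4)[OF \<xi>] c0_starD(1,4)[OF \<zeta>] by (auto simp: c0_star_def decseq_def \<eta>_def intro: add_mono)
  have "0 < (\<Sum>k\<in>{0}. weight k * block (late k) 0)" by (simp add: weight_def block_def late_def)
  also have "\<dots> \<le> \<xi> 0"
    unfolding \<xi>_def blocks_def using blocks_term_bounds(1)[OF weight_nonneg summable_late]
    by (intro sum_le_suminf blocks_summable[OF weight_nonneg summable_late]) auto
  finally have \<xi>0: "\<xi> 0 > 0" .
  have am: "arith_mean \<eta> n = arith_mean \<xi> n + arith_mean \<zeta> n" for n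
    unfolding \<eta>_def by (rule arith_mean_add)
  then have "arith_mean \<eta> = (\<lambda>n. arith_mean \<xi> n + arith_mean \<zeta> n)" by blast
  then have "arith_mean (arith_mean \<eta>) n = arith_mean (arith_mean \<xi>) n + arith_mean (arith_mean \<zeta>) n" for n
    by (simp add: arith_mean_add)
  then have second: "arith_mean (arith_mean \<eta>) n \<le> 3 * arith_mean (arith_mean \<xi>) n" for n
    using second_mean_early_le[of n] by (simp add: \<xi>_def \<zeta>_def)
  have "arith_mean \<eta> \<notin> O(arith_mean \<xi>)"
  proof
    assume big: "arith_mean \<eta> \<in> O(arith_mean \<xi>)"
    obtain C where C: "C \<ge> 0" "\<And>n. \<bar>arith_mean \<eta> n\<bar> \<le> C * arith_mean \<xi> n"
      using bigo_sequence_bound[where f="arith_mean \<eta>" and g="arith_mean \<xi>", OF big arith_mean_pos[OF \<xi> \<xi>0]]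
      by blast
    have "2 ^ k \<le> 2 * C" for k
    proof -
      let ?n = "early k - 1"
      have pos: "weight k / real (early k) > 0" by (simp add: weight_def early_def)
      have "weight k / real (early k) \<le> arith_mean \<zeta> ?n" unfolding \<zeta>_def by (rule arith_mean_early_ge)
      also have "\<dots> \<le> arith_mean \<eta> ?n" using arith_mean_nonneg[OF \<xi>] by (simp add: am)
      also have "\<dots> \<le> C * arith_mean \<xi> ?n" using C(2)[of ?n] by linarith
      also have "\<dots> \<le> C * (2 * (weight k / 2 ^ k / real (early k)))"
        unfolding \<xi>_def by (intro mult_left_mono arith_mean_late_le C(1))
      also have "\<dots> = (2 * C / 2 ^ k) * (weight k / real (early k))" by simp
      finally have "1 * (weight k / real (early k)) \<le> (2 * C / 2 ^ k) * (weight k / real (early k))" by simp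
      then have "1 \<le> 2 * C / 2 ^ k" using pos by (rule mult_right_le_imp_le)
      then show ?thesis by (simp add: divide_simps)
    qed
    moreover obtain k where "2 * C < 2 ^ k" using real_arch_pow[of 2 "2 * C"] by auto
    ultimately show False by (meson not_less)
  qed
  moreover have "\<xi> n \<le> \<eta> n" for n using c0_starD(1)[OF \<zeta>] by (simp add: \<eta>_def)
  ultimately show ?thesis using that \<xi> \<xi>0 \<eta> second by blast
qed

section \<open>Equal second and distinct first arithmetic mean ideals\<close>

theorem mainTheorem1:
  assumes separable: "separable_space (euclidean :: 'a :: complex_hilbert topology)"
    and infinite_dim: "\<nexists>B :: 'a set. finite B \<and> complex_vector.span B = UNIV"
  shows "\<exists>J I :: ('a \<Rightarrow> 'a) set.
           BH_principal_ideal J \<and> BH_principal_ideal I \<and> J \<subset> I \<and>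
           am_ideal (am_ideal J) = am_ideal (am_ideal I) \<and>
           am_ideal J \<noteq> am_ideal I"
proof -
  obtain b :: "nat \<Rightarrow> 'a" where b: "orthonormal_seq b" "total_seq b"
    using orthonormal_basis_exists[OF separable infinite_dim] by blast
  obtain \<xi> \<eta> where \<xi>: "\<xi> \<in> c0_star" "\<xi> 0 > 0" and \<eta>: "\<eta> \<in> c0_star" "\<And>n. \<xi> n \<le> \<eta> n"
    and second: "\<And>n. arith_mean (arith_mean \<eta>) n \<le> 3 * arith_mean (arith_mean \<xi>) n"
    and first: "arith_mean \<eta> \<notin> O(arith_mean \<xi>)"
    by (rule sequences_exist, rule that)
  show ?thesis
    by (rule arith_mean_ideals_from_sequences[OF b \<xi> \<eta> _ second first]) simp
qed

end
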